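(* Let $a<b\le a+\pi$, let $\mathcal A$ be a weakly cancellative commutative Banach algebra with dense principal ideals, and let $T=(T(\zeta))_{\zeta\in S_{a,b}}$ be a holomorphic semigroup of multipliers on $\mathcal A$ such that $T(\zeta)\mathcal A$ is dense in $\mathcal A$ for $\zeta\in S_{a,b}$. Set $\alpha_n=a+\frac{b-a}{2(n+1)}$, $\beta_n=b-\frac{b-a}{2(n+1)}$ for $n\ge0$, and let $\mu=(\mu_n)_{n\ge0}$ be a nondecreasing sequence of positive real numbers satisfying $$\mu_n>\frac1{\cos\left(\frac{\beta_n-\alpha_n}2\right)}\lim_{r\to+\infty}\frac{\log\max(\|T(re^{i\alpha_n})\|,\|T(re^{i\beta_n})\|)}{r}\quad(n\ge0),$$ $$\sup_{\zeta\in\overline S_{\alpha_n,\beta_n}}\left\|e^{-\mu_n\zeta e^{-i\frac{a+b}2}}T\big(\zeta+2^{-n}e^{i\frac{a+b}2}\big)\right\|_{op,\mu_0}\le e^{2^{-n}(\mu_0+1)}\quad(n\ge1),$$ where $\|\cdot\|_{op,\mu_0}$ and the normalization $\mathcal A_{T_0}$ of $\mathcal A$ with respect to $T_0=(T(te^{i\frac{a+b}2}))_{t>0}$ are as in the context (with parameter $\mu_0$). For $n\ge1$ set $V_n=\{e^{-\mu_n\zeta e^{-i(a+b)/2}}T(\zeta)\}_{\zeta\in\overline S_{\alpha_n,\beta_n}}$ (with $T(0)=I$), $W_n=V_1\cdots V_n$, $W=\bigcup_{n\ge1}W_n$, so that $W$ is stable under products. Set $\mathcal L_\mu=\{u\in\mathcal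 A_{T_0}:\sup_{w\in W}\|wu\|_{op,\mu_0}<+\infty\}$ and $\|u\|_\mu=\sup_{w\in W\cup\{I\}}\|wu\|_{op,\mu_0}$ for $u\in\mathcal L_\mu$. Denote by $\mathcal A_{\mu,T}$ the closure of $\mathcal A_{T_0}$ in $\mathcal M(\mathcal L_\mu)$. Then $T(\zeta)u\in\mathcal L_\mu$ for $\zeta\in S_{a,b}$, $u\in\mathcal A_{T_0}$; $(\mathcal L_\mu,\|\cdot\|_\mu)$ is a Banach algebra; the inclusion map $j:\mathcal A\to\mathcal A_{\mu,T}$ is a $\mathcal{QM}$-homomorphism with respect to $T(\zeta)w^2$ for all $\zeta\in S_{a,b}$, $w\in\Omega(\mathcal A)$; and: (i) The tautological map $\tilde j:S_{u/v}\mapsto S_{u/v}$ is a pseudobounded isomorphism from $\mathcal{QM}(\mathcal A)$ onto $\mathcal{QM}(\mathcal A_{\mu,T})$, and if $\zeta\in S_{a,b}$ then $\tilde j^{-1}(S)=S_{T(\zeta)w^2u/T(\zeta)w^2v}$ for $S=S_{u/v}\in\mathcal{QM}(\mathcal A_{\mu,T})$, $w\in\Omega(\mathcal A)$. (ii) $\tilde j(\mathcal M(\mathcal A))\subset\mathcal M(\mathcal A_{\mu,T})$ and $\|\tilde j(R)\|_{\mathcal M(\mathcal A_{\mu,T})}\le\|R\|_{\mathcal M(\mathcal A)}$ for $R\in\mathcal M(\mathcal A)$. (iii) $\|T(\zeta)\|_{\mathcal M(\mathcal A_{\mu,T})}\le\|T(\zeta)\|_{\mathcal M(\mathcal L_\mu)}\le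 e^{\mu_n\mathrm{Re}(\zeta e^{-i(a+b)/2})}$ for $\zeta\in\overline S_{\alpha_n,\beta_n}$, $n\ge1$. (iv) If $a<\alpha<\beta<b$, then for $v\in\mathcal A_{\mu,T}$ $$\limsup_{\zeta\to0,\,\zeta\in S_{\alpha,\beta}}\|T(\zeta)v-v\|_{\mathcal M(\mathcal A_{\mu,T})}\le\limsup_{\zeta\to0,\,\zeta\in S_{\alpha,\beta}}\|T(\zeta)v-v\|_{\mathcal M(\mathcal L_\mu)}=0.$$
   Context: Banach algebras are complex with submultiplicative norm. A commutative Banach algebra $\mathcal A\neq\{0\}$ is weakly cancellative if $u\mathcal A\ne\{0\}$ for all $u\in\mathcal A\setminus\{0\}$; $\Omega(\mathcal A)=\{u\in\mathcal A: u\mathcal A\text{ is dense in }\mathcal A\}$; $\mathcal A$ has dense principal ideals if $\Omega(\mathcal A)\ne\emptyset$. For such $\mathcal A$, $u\in\mathcal A$, $v\in\Omega(\mathcal A)$, $S_{u/v}$ is the closed operator with domain $\{x\in\mathcal A:ux\in v\mathcal A\}$, $S_{u/v}x$ being the unique $y$ with $vy=ux$. $\mathcal{QM}(\mathcal A)$ is the algebra of all such operators (quasimultipliers), with $S_{u/v}+S_{u'/v'}=S_{(uv'+u'v)/vv'}$ and $S_{u/v}S_{u'/v'}=S_{uu'/vv'}$. A set $V\subset\mathcal{QM}(\mathcal A)$ is pseudobounded if $\sup_{S\in V}\|Su\|<\infty$ for some $u\in\Omega(\mathcal A)$ in the domain of all $S\in V$. A pseudobounded isomorphism is an algebra isomorphism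 which, together with its inverse, maps pseudobounded sets to pseudobounded sets. $\mathcal M(\mathcal A)$ is the Banach algebra (operator norm) of multipliers, i.e. bounded linear $R$ on $\mathcal A$ with $R(uv)=(Ru)v$; it is identified with the quasimultipliers of domain $\mathcal A$. A (continuous) homomorphism $\Phi:\mathcal A\to\mathcal B$ into a weakly cancellative Banach algebra is a $\mathcal{QM}$-homomorphism with respect to $u\in\Omega(\mathcal A)$ if it is injective with dense range and $\Phi(u)\mathcal B\subset\Phi(\mathcal A)$. $S_{\alpha,\beta}=\{z\ne0:\alpha<\arg z<\beta\}$, $\overline S_{\alpha,\beta}$ its closure, $\overline S_{\alpha,\alpha}=\{re^{i\alpha}:r\ge0\}$. Norms $\|T(\zeta)\|$ without index are in $\mathcal M(\mathcal A)$. Construction of $\mathcal A_{T_0}$: let $T_0(t)=T(te^{i(a+b)/2})$, $T_0(0)=I$, $\mathcal L_{T_0}=\{u\in\mathcal A:\limsup_{t\to0^+}\|T_0(t)u\|<\infty\}$, with Banach algebra norm $\|u\|_{\mu_0}=\sup_{s\ge0}e^{-\mu_0s}\|T_0(s)u\|$ (here $\mu_0>\lim_{t\to\infty}t^{-1}\log\|T_0(t)\|$); $\|\cdot\|_{op,\mu_0}$ is the operator norm on $\mathcal M(\mathcal L_{T_0})$, and $\mathcal A_{T_0}$ is the closure of $\mathcal A$ (acting by multiplication) in $(\mathcal M(\mathcal L_{T_0}),\|\cdot\|_{op,\mu_0})$. Multipliers of $\mathcal A$ act on $\mathcal L_{T_0}$ by restriction and on $\mathcal A_{T_0}$ by composition.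 Elements of $\mathcal A_{T_0}$ act on the ideal $\mathcal L_\mu$ of $\mathcal A_{T_0}$ by multiplication. *)

theory Defs
  imports "HOL-Analysis.Analysis" "HOL-Algebra.Algebraic_Closure_Type"
begin

section \<open>Banach algebras with explicit carriers\<close>

(* Non-unital complex normed algebras.  The vector space structure is that of a HOL-Algebra module
   over the ring of complex numbers.  The field one of the record is not constrained; it is only
   meaningful for algebras that happen to have a unit, such as multiplier algebras. *)
record 'a normed_alg = "(complex, 'a) module" +
  nrm :: "'a \<Rightarrow> real"

(* The guard makes the distance symmetric and nonnegative off the carrier, as Metric_space requires. *)
definition alg_dist :: "'a normed_alg \<Rightarrow> 'a \<Rightarrow> 'a \<Rightarrow> real" where
  "alg_dist A x y = (if x \<in> carrier A \<and> y \<in> carrier A then nrm A (x \<ominus>\<^bsub>A\<^esub> y) else 0)"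

definition alg_top :: "'a normed_alg \<Rightarrow> 'a topology" where
  "alg_top A = Metric_space.mtopology (carrier A) (alg_dist A)"

definition dense_in :: "'a normed_alg \<Rightarrow> 'a set \<Rightarrow> bool" where
  "dense_in A S \<longleftrightarrow> S \<subseteq> carrier A \<and> alg_top A closure_of S = carrier A"

locale banach_algebra = Module.module "ring_of_type_algebra :: complex ring" A
  for A :: "'a normed_alg" (structure) +
  assumes mult_closed: "\<lbrakk>x \<in> carrier A; y \<in> carrier A\<rbrakk> \<Longrightarrow> x \<otimes> y \<in> carrier A"
    and mult_assoc: "\<lbrakk>x \<in> carrier A; y \<in> carrier A; z \<in> carrier A\<rbrakk>
        \<Longrightarrow> (x \<otimes> y) \<otimes> z = x \<otimes> (y \<otimes> z)"
    and distrib_l: "\<lbrakk>x \<in> carrier A; y \<in> carrier A; z \<in> carrier A\<rbrakk>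
        \<Longrightarrow> (x \<oplus> y) \<otimes> z = x \<otimes> z \<oplus> y \<otimes> z"
    and distrib_r: "\<lbrakk>x \<in> carrier A; y \<in> carrier A; z \<in> carrier A\<rbrakk>
        \<Longrightarrow> x \<otimes> (y \<oplus> z) = x \<otimes> y \<oplus> x \<otimes> z"
    and smult_mult_l: "\<lbrakk>x \<in> carrier A; y \<in> carrier A\<rbrakk> \<Longrightarrow> (c \<odot> x) \<otimes> y = c \<odot> (x \<otimes> y)"
    and smult_mult_r: "\<lbrakk>x \<in> carrier A; y \<in> carrier A\<rbrakk> \<Longrightarrow> x \<otimes> (c \<odot> y) = c \<odot> (x \<otimes> y)"
    and nrm_nonneg: "x \<in> carrier A \<Longrightarrow> 0 \<le> nrm A x"
    and nrm_eq_0_iff: "x \<in> carrier A \<Longrightarrow> nrm A x = 0 \<longleftrightarrow> x = \<zero>"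
    and nrm_triangle: "\<lbrakk>x \<in> carrier A; y \<in> carrier A\<rbrakk> \<Longrightarrow> nrm A (x \<oplus> y) \<le> nrm A x + nrm A y"
    and nrm_smult: "x \<in> carrier A \<Longrightarrow> nrm A (c \<odot> x) = cmod c * nrm A x"
    and nrm_mult: "\<lbrakk>x \<in> carrier A; y \<in> carrier A\<rbrakk> \<Longrightarrow> nrm A (x \<otimes> y) \<le> nrm A x * nrm A y"
    and complete: "Metric_space.mcomplete (carrier A) (alg_dist A)"

definition weakly_cancellative :: "'a normed_alg \<Rightarrow> bool" where
  "weakly_cancellative A \<longleftrightarrow>
     banach_algebra A \<and>
     (\<forall>x\<in>carrier A. \<forall>y\<in>carrier A. x \<otimes>\<^bsub>A\<^esub> y = y \<otimes>\<^bsub>A\<^esub> x) \<and>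
     carrier A \<noteq> {\<zero>\<^bsub>A\<^esub>} \<and>
     (\<forall>u\<in>carrier A - {\<zero>\<^bsub>A\<^esub>}. (\<lambda>x. u \<otimes>\<^bsub>A\<^esub> x) ` carrier A \<noteq> {\<zero>\<^bsub>A\<^esub>})"

definition Omega :: "'a normed_alg \<Rightarrow> 'a set" where
  "Omega A = {u \<in> carrier A. dense_in A ((\<lambda>x. u \<otimes>\<^bsub>A\<^esub> x) ` carrier A)}"

definition dense_principal_ideals :: "'a normed_alg \<Rightarrow> bool" where
  "dense_principal_ideals A \<longleftrightarrow> Omega A \<noteq> {}"

(* Algebra homomorphisms, not required to preserve a unit. *)
definition alg_hom ::
  "(complex, 'a, 'm) module_scheme \<Rightarrow> (complex, 'b, 'n) module_scheme \<Rightarrow> ('a \<Rightarrow> 'b) \<Rightarrow> bool" where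
  "alg_hom A B f \<longleftrightarrow>
     f \<in> carrier A \<rightarrow> carrier B \<and>
     (\<forall>x\<in>carrier A. \<forall>y\<in>carrier A. f (x \<oplus>\<^bsub>A\<^esub> y) = f x \<oplus>\<^bsub>B\<^esub> f y) \<and>
     (\<forall>x\<in>carrier A. \<forall>y\<in>carrier A. f (x \<otimes>\<^bsub>A\<^esub> y) = f x \<otimes>\<^bsub>B\<^esub> f y) \<and>
     (\<forall>c. \<forall>x\<in>carrier A. f (c \<odot>\<^bsub>A\<^esub> x) = c \<odot>\<^bsub>B\<^esub> f x)"


section \<open>Multipliers\<close>

(* Operators on A are extensional functions on carrier A. *)
definition multipliers :: "'a normed_alg \<Rightarrow> ('a \<Rightarrow> 'a) set" where
  "multipliers A = {R \<in> carrier A \<rightarrow>\<^sub>E carrier A.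
     (\<forall>x\<in>carrier A. \<forall>y\<in>carrier A. R (x \<oplus>\<^bsub>A\<^esub> y) = R x \<oplus>\<^bsub>A\<^esub> R y) \<and>
     (\<forall>c. \<forall>x\<in>carrier A. R (c \<odot>\<^bsub>A\<^esub> x) = c \<odot>\<^bsub>A\<^esub> R x) \<and>
     (\<exists>K. \<forall>x\<in>carrier A. nrm A (R x) \<le> K * nrm A x) \<and>
     (\<forall>x\<in>carrier A. \<forall>y\<in>carrier A. R (x \<otimes>\<^bsub>A\<^esub> y) = R x \<otimes>\<^bsub>A\<^esub> y)}"

definition mult_alg :: "'a normed_alg \<Rightarrow> ('a \<Rightarrow> 'a) normed_alg" where
  "mult_alg A = \<lparr>
     carrier = multipliers A,
     monoid.mult = (\<lambda>R S. compose (carrier A) R S),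
     one = (\<lambda>x\<in>carrier A. x),
     ring.zero = (\<lambda>x\<in>carrier A. \<zero>\<^bsub>A\<^esub>),
     add = (\<lambda>R S. \<lambda>x\<in>carrier A. R x \<oplus>\<^bsub>A\<^esub> S x),
     smult = (\<lambda>c R. \<lambda>x\<in>carrier A. c \<odot>\<^bsub>A\<^esub> R x),
     nrm = (\<lambda>R. SUP x\<in>{x \<in> carrier A. nrm A x \<le> 1}. nrm A (R x)) \<rparr>"

(* r is allowed to lie outside carrier A: this is also used for r in an algebra of which A is an
   ideal, and for r in a multiplier algebra acting by composition on a subalgebra A of it. *)
definition mult_op :: "'a normed_alg \<Rightarrow> 'a \<Rightarrow> 'a \<Rightarrow> 'a" where
  "mult_op A r = (\<lambda>x\<in>carrier A. r \<otimes>\<^bsub>A\<^esub> x)"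


section \<open>Quasimultipliers\<close>

(* S_{u/v}; its domain is the dom of the partial map. *)
definition quasi :: "'a normed_alg \<Rightarrow> 'a \<Rightarrow> 'a \<Rightarrow> ('a \<rightharpoonup> 'a)" where
  "quasi A u v = (\<lambda>x. if x \<in> carrier A \<and> u \<otimes>\<^bsub>A\<^esub> x \<in> (\<lambda>y. v \<otimes>\<^bsub>A\<^esub> y) ` carrier A
      then Some (THE y. y \<in> carrier A \<and> v \<otimes>\<^bsub>A\<^esub> y = u \<otimes>\<^bsub>A\<^esub> x) else None)"

definition quasi_of_mult :: "'a normed_alg \<Rightarrow> ('a \<Rightarrow> 'a) \<Rightarrow> ('a \<rightharpoonup> 'a)" where
  "quasi_of_mult A R = (\<lambda>x. if x \<in> carrier A then Some (R x) else None)"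

(* The operations are given on fractions; for a weakly cancellative algebra they do not depend on
   the chosen representatives, so that THE is legitimate. *)
definition qm_alg :: "'a normed_alg \<Rightarrow> (complex, 'a \<rightharpoonup> 'a) module" where
  "qm_alg A = \<lparr>
     carrier = {quasi A u v |u v. u \<in> carrier A \<and> v \<in> Omega A},
     monoid.mult = (\<lambda>S S'. THE R. \<exists>u\<in>carrier A. \<exists>v\<in>Omega A. \<exists>u'\<in>carrier A. \<exists>v'\<in>Omega A.
        S = quasi A u v \<and> S' = quasi A u' v' \<and> R = quasi A (u \<otimes>\<^bsub>A\<^esub> u') (v \<otimes>\<^bsub>A\<^esub> v')),
     one = quasi_of_mult A \<one>\<^bsub>mult_alg A\<^esub>,
     ring.zero = quasi_of_mult A \<zero>\<^bsub>mult_alg A\<^esub>,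
     add = (\<lambda>S S'. THE R. \<exists>u\<in>carrier A. \<exists>v\<in>Omega A. \<exists>u'\<in>carrier A. \<exists>v'\<in>Omega A.
        S = quasi A u v \<and> S' = quasi A u' v' \<and>
        R = quasi A (u \<otimes>\<^bsub>A\<^esub> v' \<oplus>\<^bsub>A\<^esub> u' \<otimes>\<^bsub>A\<^esub> v) (v \<otimes>\<^bsub>A\<^esub> v')),
     smult = (\<lambda>c S. THE R. \<exists>u\<in>carrier A. \<exists>v\<in>Omega A.
        S = quasi A u v \<and> R = quasi A (c \<odot>\<^bsub>A\<^esub> u) v) \<rparr>"

definition pseudobounded :: "'a normed_alg \<Rightarrow> ('a \<rightharpoonup> 'a) set \<Rightarrow> bool" where
  "pseudobounded A V \<longleftrightarrow> V \<subseteq> carrier (qm_alg A) \<and>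
     (\<exists>u\<in>Omega A. (\<forall>S\<in>V. u \<in> dom S) \<and> bdd_above ((\<lambda>S. nrm A (the (S u))) ` V))"

definition pseudobounded_iso ::
  "'a normed_alg \<Rightarrow> 'b normed_alg \<Rightarrow> (('a \<rightharpoonup> 'a) \<Rightarrow> ('b \<rightharpoonup> 'b)) \<Rightarrow> bool" where
  "pseudobounded_iso A B f \<longleftrightarrow>
     alg_hom (qm_alg A) (qm_alg B) f \<and>
     bij_betw f (carrier (qm_alg A)) (carrier (qm_alg B)) \<and>
     (\<forall>V. pseudobounded A V \<longrightarrow> pseudobounded B (f ` V)) \<and>
     (\<forall>V. pseudobounded B V \<longrightarrow> pseudobounded A (inv_into (carrier (qm_alg A)) f ` V))"

definition qm_homomorphism :: "'a normed_alg \<Rightarrow> 'b normed_alg \<Rightarrow> ('a \<Rightarrow> 'b) \<Rightarrow> 'a \<Rightarrow> bool" where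
  "qm_homomorphism A B f u \<longleftrightarrow>
     weakly_cancellative B \<and>
     alg_hom A B f \<and> continuous_map (alg_top A) (alg_top B) f \<and>
     inj_on f (carrier A) \<and> dense_in B (f ` carrier A) \<and>
     u \<in> Omega A \<and> (\<lambda>y. f u \<otimes>\<^bsub>B\<^esub> y) ` carrier B \<subseteq> f ` carrier A"


section \<open>Holomorphic semigroups on sectors\<close>

(* The argument is multivalued: some determination of it lies strictly between the bounds. *)
definition sector :: "real \<Rightarrow> real \<Rightarrow> complex set" where
  "sector \<alpha> \<beta> = {rcis r \<theta> |r \<theta>. 0 < r \<and> \<alpha> < \<theta> \<and> \<theta> < \<beta>}"

definition closed_sector :: "real \<Rightarrow> real \<Rightarrow> complex set" where
  "closed_sector \<alpha> \<beta> = (if \<alpha> = \<beta> then {rcis r \<alpha> |r. 0 \<le> r} else closure (sector \<alpha> \<beta>))"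

(* Holomorphy is complex differentiability for the operator norm of the multiplier algebra. *)
definition holomorphic_semigroup ::
  "'a normed_alg \<Rightarrow> real \<Rightarrow> real \<Rightarrow> (complex \<Rightarrow> 'a \<Rightarrow> 'a) \<Rightarrow> bool" where
  "holomorphic_semigroup A a b T \<longleftrightarrow>
     (\<forall>\<zeta>\<in>sector a b. T \<zeta> \<in> carrier (mult_alg A)) \<and>
     (\<forall>\<zeta>\<in>sector a b. \<forall>\<eta>\<in>sector a b. T (\<zeta> + \<eta>) = T \<zeta> \<otimes>\<^bsub>mult_alg A\<^esub> T \<eta>) \<and>
     (\<forall>\<zeta>\<in>sector a b. \<exists>D\<in>carrier (mult_alg A).
        ((\<lambda>\<eta>. nrm (mult_alg A)
            ((1 / (\<eta> - \<zeta>)) \<odot>\<^bsub>mult_alg A\<^esub> (T \<eta> \<ominus>\<^bsub>mult_alg A\<^esub> T \<zeta>) \<ominus>\<^bsub>mult_alg A\<^esub> D))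
          \<longlongrightarrow> 0) (at \<zeta> within sector a b))"

definition alpha_seq :: "real \<Rightarrow> real \<Rightarrow> nat \<Rightarrow> real" where
  "alpha_seq a b n = a + (b - a) / (2 * (real n + 1))"

definition beta_seq :: "real \<Rightarrow> real \<Rightarrow> nat \<Rightarrow> real" where
  "beta_seq a b n = b - (b - a) / (2 * (real n + 1))"


section \<open>Normalization of an algebra with respect to a holomorphic semigroup\<close>

context
  fixes A :: "'a normed_alg" and a b :: real and T :: "complex \<Rightarrow> 'a \<Rightarrow> 'a" and \<mu> :: "nat \<Rightarrow> real"
begin

(* T, which is given on an open sector, extended by T(0) = I. *)
definition semigroup0 :: "complex \<Rightarrow> 'a \<Rightarrow> 'a" where
  "semigroup0 \<zeta> = (if \<zeta> = 0 then \<one>\<^bsub>mult_alg A\<^esub> else T \<zeta>)"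

definition T_zero :: "real \<Rightarrow> 'a \<Rightarrow> 'a" where
  "T_zero t = semigroup0 (of_real t * cis ((a + b) / 2))"

definition L_T0 :: "'a normed_alg" where
  "L_T0 = A\<lparr>
     carrier := {u \<in> carrier A. Limsup (at_right 0) (\<lambda>t. ereal (nrm A (T_zero t u))) < \<infinity>},
     nrm := (\<lambda>u. SUP s\<in>{0..}. exp (- \<mu> 0 * s) * nrm A (T_zero s u)) \<rparr>"

definition A_T0 :: "('a \<Rightarrow> 'a) normed_alg" where
  "A_T0 = (mult_alg L_T0)\<lparr>
     carrier := alg_top (mult_alg L_T0) closure_of (mult_op L_T0 ` carrier A) \<rparr>"

(* Action of a multiplier of A on L_T0; it acts on A_T0 by composition on the left with it. *)
definition act_L_T0 :: "('a \<Rightarrow> 'a) \<Rightarrow> 'a \<Rightarrow> 'a" where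
  "act_L_T0 R = restrict R (carrier L_T0)"

definition V_set :: "nat \<Rightarrow> ('a \<Rightarrow> 'a) set" where
  "V_set n = {exp (- of_real (\<mu> n) * \<zeta> * cis (- (a + b) / 2)) \<odot>\<^bsub>mult_alg A\<^esub> semigroup0 \<zeta> |\<zeta>.
     \<zeta> \<in> closed_sector (alpha_seq a b n) (beta_seq a b n)}"

(* W_upto n = V_1 ... V_n, with the empty product for n = 0. *)
primrec W_upto :: "nat \<Rightarrow> ('a \<Rightarrow> 'a) set" where
  "W_upto 0 = {\<one>\<^bsub>mult_alg A\<^esub>}"
| "W_upto (Suc n) = W_upto n <#>\<^bsub>mult_alg A\<^esub> V_set (Suc n)"

definition W_set :: "('a \<Rightarrow> 'a) set" where
  "W_set = (\<Union>n\<in>{1..}. W_upto n)"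

definition L_mu :: "('a \<Rightarrow> 'a) normed_alg" where
  "L_mu = A_T0\<lparr>
     carrier := {u \<in> carrier A_T0.
        bdd_above ((\<lambda>w. nrm (mult_alg L_T0) (act_L_T0 w \<otimes>\<^bsub>A_T0\<^esub> u)) ` W_set)},
     nrm := (\<lambda>u. SUP w\<in>W_set \<union> {\<one>\<^bsub>mult_alg A\<^esub>}.
        nrm (mult_alg L_T0) (act_L_T0 w \<otimes>\<^bsub>A_T0\<^esub> u)) \<rparr>"

definition A_mu :: "(('a \<Rightarrow> 'a) \<Rightarrow> ('a \<Rightarrow> 'a)) normed_alg" where
  "A_mu = (mult_alg L_mu)\<lparr>
     carrier := alg_top (mult_alg L_mu) closure_of (mult_op L_mu ` carrier A_T0) \<rparr>"

(* Multipliers of A acting on L_mu (part of A_T0) and on A_mu (part of the multipliers of L_mu),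
   in both cases by composition. *)
definition act_L_mu :: "('a \<Rightarrow> 'a) \<Rightarrow> ('a \<Rightarrow> 'a) \<Rightarrow> ('a \<Rightarrow> 'a)" where
  "act_L_mu R = mult_op L_mu (act_L_T0 R)"

definition act_A_mu ::
  "('a \<Rightarrow> 'a) \<Rightarrow> (('a \<Rightarrow> 'a) \<Rightarrow> ('a \<Rightarrow> 'a)) \<Rightarrow> (('a \<Rightarrow> 'a) \<Rightarrow> ('a \<Rightarrow> 'a))" where
  "act_A_mu R = mult_op A_mu (act_L_mu R)"

(* The inclusion of A into A_mu: u acts by multiplication on L_T0, and the resulting element of
   A_T0 acts by multiplication on L_mu. *)
definition incl_A_mu :: "'a \<Rightarrow> ('a \<Rightarrow> 'a) \<Rightarrow> ('a \<Rightarrow> 'a)" where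
  "incl_A_mu u = mult_op L_mu (mult_op L_T0 u)"

end

end

theory Submission
  imports Defs
begin

text \<open>
  The passages from \<open>A\<close> to \<open>A_T0\<close> and from \<open>A_T0\<close> to \<open>A_mu\<close> are two instances of one construction.
  Given a weakly cancellative algebra and a family of multipliers containing the identity, the
  elements with bounded orbit form an ideal \<open>L\<close> that is a Banach algebra for the supremum norm, and
  one takes the closure \<open>C\<close> of the algebra in the multipliers of \<open>L\<close>. If \<open>L\<close> is dense, multipliers
  of the algebra act contractively on \<open>C\<close>, and multiplication by \<open>x \<in> L\<close> sends \<open>b \<in> C\<close> back to the
  element \<open>b x\<close> of the algebra.

  Density of \<open>L_mu\<close> amounts to a bound on \<open>V_1 \<dots> V_n T(t\<delta>)\<close> that is uniform in \<open>n\<close>. The growth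
  hypothesis on \<open>\<mu>\<close>, applied along the two boundary rays of each sector, controls finitely many
  factors; all the others are absorbed by splitting off \<open>T(2\<^sup>-\<^sup>k\<delta>)\<close> for large \<open>k\<close>, where the second
  hypothesis on \<open>\<mu>\<close> applies and the bounds have a convergent product.

  Composing the two instances, multiplication by \<open>e = j(T(\<zeta>)w\<^sup>2)\<close> maps \<open>A_mu\<close> boundedly into \<open>j(A)\<close>.
  Since \<open>S_{u/v} = S_{eu/ev}\<close>, every quasimultiplier of \<open>A_mu\<close> is a fraction of elements of \<open>j(A)\<close>.
\<close>

section \<open>Normed algebras and convergence of sequences\<close>

text \<open>The order of the two normalizations matters. On \<open>A\<close> the norms of
  \<open>T(t\<delta>)\<close> may blow up as t tends to 0, and then no product of bounds at the
  times 2^-n could converge. On \<open>L0\<close> they are at most exp(t \<open>\<mu> 0\<close>), so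
  infinitely many factors can share a finite amount of time. The growth hypothesis alone would not
  do: it gives one constant for each sector, with no control on their product. The cosine in that
  hypothesis comes from writing a point of a closed sector as a sum of points on its two boundary
  rays. Both rays make the same angle with the bisector, so the two exponential bounds multiply to
  one in the real part that the scalars in \<open>V_n\<close> cancel. The hypothesis is phrased with
  \<open>Lim\<close>, so Fekete's lemma has to show first that the limit exists. The square of w
  reflects the two closures: each return, from \<open>A_mu\<close> to \<open>A_T0\<close> and from
  \<open>A_T0\<close> to \<open>A\<close>, costs one factor from the corresponding ideal, and
  \<open>T(\<zeta>/2)w\<close> serves for both.\<close>

lemma ring_of_type_algebra_sel [simp]:
  "carrier ring_of_type_algebra = UNIV"
  "x \<otimes>\<^bsub>ring_of_type_algebra\<^esub> y = x * y"
  "x \<oplus>\<^bsub>ring_of_type_algebra\<^esub> y = x + y"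
  "\<one>\<^bsub>ring_of_type_algebra\<^esub> = 1"
  "\<zero>\<^bsub>ring_of_type_algebra\<^esub> = 0"
  by (simp_all add: ring_of_type_algebra_def)

text \<open>\<open>banach_algebra\<close> without completeness. Every algebra constructed below is
  first shown to be normed, so that the calculus of convergent sequences is available in its
  completeness proof.\<close>

locale normed_algebra = Module.module "ring_of_type_algebra :: complex ring" A
  for A :: "'a normed_alg" (structure) +
  assumes mult_closed: "\<lbrakk>x \<in> carrier A; y \<in> carrier A\<rbrakk> \<Longrightarrow> x \<otimes> y \<in> carrier A"
    and mult_assoc: "\<lbrakk>x \<in> carrier A; y \<in> carrier A; z \<in> carrier A\<rbrakk>
        \<Longrightarrow> (x \<otimes> y) \<otimes> z = x \<otimes> (y \<otimes> z)"
    and distrib_l: "\<lbrakk>x \<in> carrier A; y \<in> carrier A; z \<in> carrier A\<rbrakk>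
        \<Longrightarrow> (x \<oplus> y) \<otimes> z = x \<otimes> z \<oplus> y \<otimes> z"
    and distrib_r: "\<lbrakk>x \<in> carrier A; y \<in> carrier A; z \<in> carrier A\<rbrakk>
        \<Longrightarrow> x \<otimes> (y \<oplus> z) = x \<otimes> y \<oplus> x \<otimes> z"
    and smult_mult_l: "\<lbrakk>x \<in> carrier A; y \<in> carrier A\<rbrakk> \<Longrightarrow> (c \<odot> x) \<otimes> y = c \<odot> (x \<otimes> y)"
    and smult_mult_r: "\<lbrakk>x \<in> carrier A; y \<in> carrier A\<rbrakk> \<Longrightarrow> x \<otimes> (c \<odot> y) = c \<odot> (x \<otimes> y)"
    and nrm_nonneg: "x \<in> carrier A \<Longrightarrow> 0 \<le> nrm A x"
    and nrm_eq_0_iff: "x \<in> carrier A \<Longrightarrow> nrm A x = 0 \<longleftrightarrow> x = \<zero>"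
    and nrm_triangle: "\<lbrakk>x \<in> carrier A; y \<in> carrier A\<rbrakk> \<Longrightarrow> nrm A (x \<oplus> y) \<le> nrm A x + nrm A y"
    and nrm_smult: "x \<in> carrier A \<Longrightarrow> nrm A (c \<odot> x) = cmod c * nrm A x"
    and nrm_mult: "\<lbrakk>x \<in> carrier A; y \<in> carrier A\<rbrakk> \<Longrightarrow> nrm A (x \<otimes> y) \<le> nrm A x * nrm A y"

lemma banach_algebra_iff:
  "banach_algebra A \<longleftrightarrow>
    normed_algebra A \<and> Metric_space.mcomplete (carrier A) (alg_dist A)"
  unfolding banach_algebra_def banach_algebra_axioms_def
    normed_algebra_def normed_algebra_axioms_def
  by (simp only: conj_assoc)

sublocale banach_algebra \<subseteq> normed_algebra
  using banach_algebra_iff banach_algebra_axioms by blast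

text \<open>The additive inverse of x is obtained as the scalar multiple by -1, so a record only has
  to provide sums and scalar multiples.\<close>

lemma normed_algebraI:
  fixes A :: "'a normed_alg" (structure)
  assumes "\<zero> \<in> carrier A"
    and "\<And>x y. \<lbrakk>x \<in> carrier A; y \<in> carrier A\<rbrakk> \<Longrightarrow> x \<oplus> y \<in> carrier A"
    and "\<And>c x. x \<in> carrier A \<Longrightarrow> c \<odot> x \<in> carrier A"
    and "\<And>x y. \<lbrakk>x \<in> carrier A; y \<in> carrier A\<rbrakk> \<Longrightarrow> x \<otimes> y \<in> carrier A"
    and "\<And>x y z. \<lbrakk>x \<in> carrier A; y \<in> carrier A; z \<in> carrier A\<rbrakk>
        \<Longrightarrow> (x \<oplus> y) \<oplus> z = x \<oplus> (y \<oplus> z)"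
    and "\<And>x y. \<lbrakk>x \<in> carrier A; y \<in> carrier A\<rbrakk> \<Longrightarrow> x \<oplus> y = y \<oplus> x"
    and "\<And>x. x \<in> carrier A \<Longrightarrow> \<zero> \<oplus> x = x"
    and "\<And>x. x \<in> carrier A \<Longrightarrow> (- 1) \<odot> x \<oplus> x = \<zero>"
    and "\<And>c d x. x \<in> carrier A \<Longrightarrow> (c + d) \<odot> x = c \<odot> x \<oplus> d \<odot> x"
    and "\<And>c x y. \<lbrakk>x \<in> carrier A; y \<in> carrier A\<rbrakk> \<Longrightarrow> c \<odot> (x \<oplus> y) = c \<odot> x \<oplus> c \<odot> y"
    and "\<And>c d x. x \<in> carrier A \<Longrightarrow> (c * d) \<odot> x = c \<odot> (d \<odot> x)"
    and "\<And>x. x \<in> carrier A \<Longrightarrow> 1 \<odot> x = x"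
    and "\<And>x y z. \<lbrakk>x \<in> carrier A; y \<in> carrier A; z \<in> carrier A\<rbrakk>
        \<Longrightarrow> (x \<otimes> y) \<otimes> z = x \<otimes> (y \<otimes> z)"
    and "\<And>x y z. \<lbrakk>x \<in> carrier A; y \<in> carrier A; z \<in> carrier A\<rbrakk>
        \<Longrightarrow> (x \<oplus> y) \<otimes> z = x \<otimes> z \<oplus> y \<otimes> z"
    and "\<And>x y z. \<lbrakk>x \<in> carrier A; y \<in> carrier A; z \<in> carrier A\<rbrakk>
        \<Longrightarrow> x \<otimes> (y \<oplus> z) = x \<otimes> y \<oplus> x \<otimes> z"
    and "\<And>c x y. \<lbrakk>x \<in> carrier A; y \<in> carrier A\<rbrakk> \<Longrightarrow> (c \<odot> x) \<otimes> y = c \<odot> (x \<otimes> y)"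
    and "\<And>c x y. \<lbrakk>x \<in> carrier A; y \<in> carrier A\<rbrakk> \<Longrightarrow> x \<otimes> (c \<odot> y) = c \<odot> (x \<otimes> y)"
    and "\<And>x. x \<in> carrier A \<Longrightarrow> 0 \<le> nrm A x"
    and "\<And>x. x \<in> carrier A \<Longrightarrow> nrm A x = 0 \<longleftrightarrow> x = \<zero>"
    and "\<And>x y. \<lbrakk>x \<in> carrier A; y \<in> carrier A\<rbrakk> \<Longrightarrow> nrm A (x \<oplus> y) \<le> nrm A x + nrm A y"
    and "\<And>c x. x \<in> carrier A \<Longrightarrow> nrm A (c \<odot> x) = cmod c * nrm A x"
    and "\<And>x y. \<lbrakk>x \<in> carrier A; y \<in> carrier A\<rbrakk> \<Longrightarrow> nrm A (x \<otimes> y) \<le> nrm A x * nrm A y"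
  shows "normed_algebra A"
proof -
  have "abelian_group A"
  proof (rule abelian_groupI)
    show "\<exists>y\<in>carrier A. y \<oplus> x = \<zero>" if "x \<in> carrier A" for x
      using assms(3)[OF that, of "-1"] assms(8)[OF that] by (intro bexI)
  qed (fact assms(1,2,5,6,7))+
  then have "Module.module (ring_of_type_algebra :: complex ring) A"
    by (intro moduleI cring_from_type_algebra) (simp_all add: assms)
  then show ?thesis
    by (intro normed_algebra.intro normed_algebra_axioms.intro) (simp_all add: assms)
qed

context normed_algebra
begin

lemma add_closed [simp, intro]: "\<lbrakk>x \<in> carrier A; y \<in> carrier A\<rbrakk> \<Longrightarrow> x \<oplus> y \<in> carrier A"
  by simp

lemma scale_closed [simp, intro]: "x \<in> carrier A \<Longrightarrow> c \<odot> x \<in> carrier A"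
  by (rule smult_closed) simp_all

declare mult_closed [simp, intro]

lemma diff_closed [simp, intro]: "\<lbrakk>x \<in> carrier A; y \<in> carrier A\<rbrakk> \<Longrightarrow> x \<ominus> y \<in> carrier A"
  by simp

lemma scale_add: "x \<in> carrier A \<Longrightarrow> (c + d) \<odot> x = c \<odot> x \<oplus> d \<odot> x"
  using smult_l_distr[of c d x] by simp

lemma scale_add_right: "\<lbrakk>x \<in> carrier A; y \<in> carrier A\<rbrakk> \<Longrightarrow> c \<odot> (x \<oplus> y) = c \<odot> x \<oplus> c \<odot> y"
  using smult_r_distr[of c x y] by simp

lemma scale_assoc: "x \<in> carrier A \<Longrightarrow> (c * d) \<odot> x = c \<odot> (d \<odot> x)"
  using smult_assoc1[of c d x] by simp

lemma scale_one [simp]: "x \<in> carrier A \<Longrightarrow> 1 \<odot> x = x"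
  using smult_one[of x] by simp

lemma scale_zero_left [simp]: "x \<in> carrier A \<Longrightarrow> 0 \<odot> x = \<zero>"
  using smult_l_null[of x] by simp

lemma scale_zero_right [simp]: "c \<odot> \<zero> = \<zero>"
  using smult_r_null[of c] by simp

lemma scale_minus_one_add: "x \<in> carrier A \<Longrightarrow> (- 1) \<odot> x \<oplus> x = \<zero>"
  using scale_add[of x "-1" 1] by simp

lemma minus_eq_scale: "x \<in> carrier A \<Longrightarrow> \<ominus> x = (- 1) \<odot> x"
  using minus_equality[OF scale_minus_one_add] by simp

lemma diff_eq_scale: "y \<in> carrier A \<Longrightarrow> x \<ominus> y = x \<oplus> (- 1) \<odot> y"
  by (simp add: a_minus_def minus_eq_scale)

lemma nrm_zero [simp]: "nrm A \<zero> = 0"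
  using nrm_eq_0_iff by blast

lemma diff_eq_zero_iff: "\<lbrakk>x \<in> carrier A; y \<in> carrier A\<rbrakk> \<Longrightarrow> x \<ominus> y = \<zero> \<longleftrightarrow> x = y"
  by (metis (no_types, lifting) a_minus_def local.minus_minus r_neg minus_equality a_inv_closed)

lemma diff_self [simp]: "x \<in> carrier A \<Longrightarrow> x \<ominus> x = \<zero>"
  by (simp add: diff_eq_zero_iff)

lemma nrm_diff_eq_0_iff: "\<lbrakk>x \<in> carrier A; y \<in> carrier A\<rbrakk> \<Longrightarrow> nrm A (x \<ominus> y) = 0 \<longleftrightarrow> x = y"
  by (simp add: nrm_eq_0_iff diff_eq_zero_iff)

lemma scale_diff:
  "\<lbrakk>x \<in> carrier A; y \<in> carrier A\<rbrakk> \<Longrightarrow> c \<odot> (x \<ominus> y) = c \<odot> x \<ominus> c \<odot> y"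
  by (simp add: diff_eq_scale scale_add_right flip: scale_assoc)

lemma mult_diff_left:
  "\<lbrakk>x \<in> carrier A; y \<in> carrier A; z \<in> carrier A\<rbrakk> \<Longrightarrow> (x \<ominus> y) \<otimes> z = x \<otimes> z \<ominus> y \<otimes> z"
  by (simp add: diff_eq_scale distrib_l smult_mult_l)

lemma mult_diff_right:
  "\<lbrakk>x \<in> carrier A; y \<in> carrier A; z \<in> carrier A\<rbrakk> \<Longrightarrow> x \<otimes> (y \<ominus> z) = x \<otimes> y \<ominus> x \<otimes> z"
  by (simp add: diff_eq_scale distrib_r smult_mult_r)

lemma zero_mult [simp]: "x \<in> carrier A \<Longrightarrow> \<zero> \<otimes> x = \<zero>"
  using mult_diff_left[of x x x] by simp

lemma mult_zero [simp]: "x \<in> carrier A \<Longrightarrow> x \<otimes> \<zero> = \<zero>"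
  using mult_diff_right[of x x x] by simp

lemma diff_swap: "\<lbrakk>x \<in> carrier A; y \<in> carrier A\<rbrakk> \<Longrightarrow> y \<ominus> x = (- 1) \<odot> (x \<ominus> y)"
  by (simp add: diff_eq_scale scale_add_right a_comm flip: scale_assoc)

lemma nrm_diff_commute: "\<lbrakk>x \<in> carrier A; y \<in> carrier A\<rbrakk> \<Longrightarrow> nrm A (x \<ominus> y) = nrm A (y \<ominus> x)"
  using nrm_smult[of "x \<ominus> y" "-1"] by (simp add: diff_swap[of x y])

lemma diff_add_diff:
  "\<lbrakk>x \<in> carrier A; y \<in> carrier A; z \<in> carrier A\<rbrakk> \<Longrightarrow> (x \<ominus> y) \<oplus> (y \<ominus> z) = x \<ominus> z"
  unfolding a_minus_def
  by (metis (no_types, opaque_lifting) a_assoc a_closed a_inv_closed l_neg l_zero)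

lemma add_diff_cancel: "\<lbrakk>x \<in> carrier A; y \<in> carrier A\<rbrakk> \<Longrightarrow> y \<oplus> (x \<ominus> y) = x"
  unfolding a_minus_def
  by (metis (no_types, opaque_lifting) a_assoc a_closed a_comm a_inv_closed l_neg l_zero)

lemma nrm_diff_triangle:
  "\<lbrakk>x \<in> carrier A; y \<in> carrier A; z \<in> carrier A\<rbrakk>
    \<Longrightarrow> nrm A (x \<ominus> z) \<le> nrm A (x \<ominus> y) + nrm A (y \<ominus> z)"
  using nrm_triangle[of "x \<ominus> y" "y \<ominus> z"] by (simp add: diff_add_diff)

lemma add_diff_add:
  assumes "x \<in> carrier A" "y \<in> carrier A" "x' \<in> carrier A" "y' \<in> carrier A"
  shows "(x \<oplus> y) \<ominus> (x' \<oplus> y') = (x \<ominus> x') \<oplus> (y \<ominus> y')"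
  using assms by (simp add: diff_eq_scale scale_add_right a_ac)

lemma nrm_le_add_diff: "\<lbrakk>x \<in> carrier A; y \<in> carrier A\<rbrakk> \<Longrightarrow> nrm A x \<le> nrm A y + nrm A (x \<ominus> y)"
  using nrm_triangle[of y "x \<ominus> y"] by (simp add: add_diff_cancel)

lemma abs_nrm_diff: "\<lbrakk>x \<in> carrier A; y \<in> carrier A\<rbrakk> \<Longrightarrow> \<bar>nrm A x - nrm A y\<bar> \<le> nrm A (x \<ominus> y)"
  using nrm_le_add_diff[of x y] nrm_le_add_diff[of y x] nrm_diff_commute[of x y] by linarith

lemma Metric_space_alg_dist: "Metric_space (carrier A) (alg_dist A)"
  by unfold_locales
    (auto simp: alg_dist_def nrm_diff_eq_0_iff nrm_nonneg nrm_diff_triangle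
      intro: nrm_diff_commute)

sublocale Metric_space "carrier A" "alg_dist A"
  by (rule Metric_space_alg_dist)

end

section \<open>Sequential description of limits, closures and density\<close>

definition converges_to :: "'a normed_alg \<Rightarrow> (nat \<Rightarrow> 'a) \<Rightarrow> 'a \<Rightarrow> bool" where
  "converges_to A s x \<longleftrightarrow>
    range s \<subseteq> carrier A \<and> x \<in> carrier A \<and> (\<lambda>n. nrm A (s n \<ominus>\<^bsub>A\<^esub> x)) \<longlonglongrightarrow> 0"

lemma converges_toD:
  assumes "converges_to A s x"
  shows "s n \<in> carrier A" "x \<in> carrier A" "(\<lambda>n. nrm A (s n \<ominus>\<^bsub>A\<^esub> x)) \<longlonglongrightarrow> 0"
  using assms by (auto simp: converges_to_def)

context normed_algebra
begin

lemma converges_toI: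
  assumes "\<And>n. s n \<in> carrier A" "x \<in> carrier A"
    and "\<And>n. nrm A (s n \<ominus> x) \<le> e n" "e \<longlonglongrightarrow> 0"
  shows "converges_to A s x"
  unfolding converges_to_def
proof (intro conjI)
  show "(\<lambda>n. nrm A (s n \<ominus> x)) \<longlonglongrightarrow> 0"
    by (rule tendsto_sandwich[OF _ _ tendsto_const assms(4)])
      (use assms in \<open>auto intro!: always_eventually nrm_nonneg\<close>)
qed (use assms in auto)

lemma limitin_iff_converges_to:
  assumes "range s \<subseteq> carrier A"
  shows "limitin (alg_top A) s x sequentially \<longleftrightarrow> converges_to A s x"
proof (cases "x \<in> carrier A")
  case True
  have "alg_dist A (s n) x = nrm A (s n \<ominus> x)" for n
    using True assms by (auto simp: alg_dist_def)
  then show ?thesis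
    using True assms
    by (auto simp: alg_top_def limitin_metric_dist_null converges_to_def
        intro!: always_eventually)
next
  case False
  then show ?thesis
    by (simp add: alg_top_def limitin_metric_dist_null converges_to_def)
qed

lemma mcomplete_iff:
  "mcomplete \<longleftrightarrow>
    (\<forall>s. range s \<subseteq> carrier A \<and> (\<forall>e>0. \<exists>N. \<forall>m\<ge>N. \<forall>n\<ge>N. nrm A (s m \<ominus> s n) < e)
      \<longrightarrow> (\<exists>x. converges_to A s x))"
proof -
  have "MCauchy s \<longleftrightarrow>
      range s \<subseteq> carrier A \<and> (\<forall>e>0. \<exists>N. \<forall>m\<ge>N. \<forall>n\<ge>N. nrm A (s m \<ominus> s n) < e)" for s
  proof -
    have "alg_dist A (s m) (s n) = nrm A (s m \<ominus> s n)" if "range s \<subseteq> carrier A" for m n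
      using that by (auto simp: alg_dist_def)
    then show ?thesis
      unfolding MCauchy_def by (metis (no_types, lifting))
  qed
  then show ?thesis
    unfolding mcomplete_def using limitin_iff_converges_to alg_top_def by metis
qed

lemma closure_of_subset_carrier: "alg_top A closure_of S \<subseteq> carrier A"
  unfolding alg_top_def metric_closure_of by auto

lemma in_closure_of_iff:
  "x \<in> alg_top A closure_of S \<longleftrightarrow> (\<exists>s. range s \<subseteq> S \<and> converges_to A s x)"
proof
  assume x: "x \<in> alg_top A closure_of S"
  then have xA: "x \<in> carrier A"
    using closure_of_subset_carrier by blast
  have "\<exists>y\<in>S. y \<in> mball x (1 / real (Suc n))" for n
    using x unfolding alg_top_def metric_closure_of by auto
  then obtain s where s: "s n \<in> S" "s n \<in> mball x (1 / real (Suc n))" for n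
    by metis
  have XA: "s n \<in> carrier A" for n
    using s(2)[of n] by simp
  have "nrm A (s n \<ominus> x) \<le> 1 / real (Suc n)" for n
    using s(2)[of n] XA xA by (simp add: alg_dist_def nrm_diff_commute[of x])
  moreover have "(\<lambda>n. 1 / real (Suc n)) \<longlonglongrightarrow> 0"
    using LIMSEQ_inverse_real_of_nat by (simp add: inverse_eq_divide)
  ultimately have "converges_to A s x"
    using XA xA by (intro converges_toI[where e = "\<lambda>n. 1 / real (Suc n)"])
  with s(1) show "\<exists>s. range s \<subseteq> S \<and> converges_to A s x"
    by blast
next
  assume "\<exists>s. range s \<subseteq> S \<and> converges_to A s x"
  then obtain s where s: "range s \<subseteq> S" "converges_to A s x"
    by blast
  have "\<exists>y\<in>S. y \<in> mball x r" if "0 < r" for r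
  proof -
    have "\<forall>\<^sub>F n in sequentially. nrm A (s n \<ominus> x) < r"
      using order_tendstoD(2)[OF converges_toD(3)[OF s(2)] that] .
    then obtain n where "nrm A (s n \<ominus> x) < r"
      by (auto simp: eventually_sequentially)
    moreover have "s n \<in> carrier A" "x \<in> carrier A"
      using converges_toD[OF s(2)] by auto
    ultimately have "s n \<in> mball x r"
      by (simp add: alg_dist_def nrm_diff_commute[of x])
    then show ?thesis
      using s(1) by blast
  qed
  then show "x \<in> alg_top A closure_of S"
    using converges_toD(2)[OF s(2)] unfolding alg_top_def metric_closure_of by auto
qed

lemma dense_in_iff:
  "dense_in A S \<longleftrightarrow>
    S \<subseteq> carrier A \<and> (\<forall>x\<in>carrier A. \<exists>s. range s \<subseteq> S \<and> converges_to A s x)"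
  unfolding dense_in_def using closure_of_subset_carrier in_closure_of_iff by blast

lemma dense_in_superset:
  "\<lbrakk>dense_in A S; S \<subseteq> S'; S' \<subseteq> carrier A\<rbrakk> \<Longrightarrow> dense_in A S'"
  unfolding dense_in_iff by (meson order_trans)

lemma closure_of_seqI:
  "\<lbrakk>\<And>n. s n \<in> S; converges_to A s x\<rbrakk> \<Longrightarrow> x \<in> alg_top A closure_of S"
  using in_closure_of_iff[of x S] by blast

lemma converges_to_const: "x \<in> carrier A \<Longrightarrow> converges_to A (\<lambda>n. x) x"
  by (simp add: converges_to_def)

lemma converges_to_unique:
  assumes "converges_to A s x" "converges_to A s y"
  shows "x = y"
proof -
  note c = converges_toD[OF assms(1)] converges_toD[OF assms(2)]
  have "nrm A (x \<ominus> y) \<le> nrm A (s n \<ominus> x) + nrm A (s n \<ominus> y)" for n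
    using nrm_diff_triangle[of x "s n" y] nrm_diff_commute[of x "s n"] c by simp
  moreover have "(\<lambda>n. nrm A (s n \<ominus> x) + nrm A (s n \<ominus> y)) \<longlonglongrightarrow> 0"
    using tendsto_add[OF c(3) c(6)] by simp
  ultimately have "nrm A (x \<ominus> y) \<le> 0"
    using LIMSEQ_le_const by blast
  then show ?thesis
    using c nrm_nonneg nrm_diff_eq_0_iff by (metis diff_closed order_antisym)
qed

lemma converges_to_add:
  assumes "converges_to A s x" "converges_to A t y"
  shows "converges_to A (\<lambda>n. s n \<oplus> t n) (x \<oplus> y)"
proof (rule converges_toI)
  note c = converges_toD[OF assms(1)] converges_toD[OF assms(2)]
  show "nrm A (s n \<oplus> t n \<ominus> (x \<oplus> y)) \<le> nrm A (s n \<ominus> x) + nrm A (t n \<ominus> y)" for n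
    using nrm_triangle[of "s n \<ominus> x" "t n \<ominus> y"] c by (simp add: add_diff_add)
  show "(\<lambda>n. nrm A (s n \<ominus> x) + nrm A (t n \<ominus> y)) \<longlonglongrightarrow> 0"
    using tendsto_add[OF c(3) c(6)] by simp
qed (use assms in \<open>auto dest: converges_toD\<close>)

lemma converges_to_nrm:
  assumes "converges_to A s x"
  shows "(\<lambda>n. nrm A (s n)) \<longlonglongrightarrow> nrm A x"
proof -
  note c = converges_toD[OF assms]
  have "(\<lambda>n. nrm A (s n) - nrm A x) \<longlonglongrightarrow> 0"
    by (rule Lim_null_comparison[OF _ c(3)]) (use c abs_nrm_diff in auto)
  then show ?thesis
    by (simp add: LIM_zero_iff)
qed

text \<open>Used to let one index of a Cauchy estimate tend to infinity.\<close>

lemma nrm_limit_diff_le: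
  assumes "converges_to A s x" "y \<in> carrier A"
    and "\<forall>\<^sub>F n in sequentially. nrm A (s n \<ominus> y) \<le> K"
  shows "nrm A (x \<ominus> y) \<le> K"
proof -
  note c = converges_toD[OF assms(1)]
  have "converges_to A (\<lambda>n. s n \<ominus> y) (x \<ominus> y)"
  proof (rule converges_toI[OF _ _ _ c(3)])
    show "nrm A (s n \<ominus> y \<ominus> (x \<ominus> y)) \<le> nrm A (s n \<ominus> x)" for n
      using c(1)[of n] c(2) assms(2) add_diff_add[of "s n" "(-1) \<odot> y" x "(-1) \<odot> y"]
      by (simp add: diff_eq_scale[of y])
  qed (use assms(2) c in auto)
  then have "(\<lambda>n. nrm A (s n \<ominus> y)) \<longlonglongrightarrow> nrm A (x \<ominus> y)"
    by (rule converges_to_nrm)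
  then show ?thesis
    using assms(3) tendsto_upperbound by fastforce
qed

lemma converges_to_mult:
  assumes "converges_to A s x" "converges_to A t y"
  shows "converges_to A (\<lambda>n. s n \<otimes> t n) (x \<otimes> y)"
proof (rule converges_toI)
  note c = converges_toD[OF assms(1)] converges_toD[OF assms(2)]
  show "nrm A (s n \<otimes> t n \<ominus> x \<otimes> y)
      \<le> nrm A (s n \<ominus> x) * nrm A (t n) + nrm A x * nrm A (t n \<ominus> y)" for n
  proof -
    have "nrm A (s n \<otimes> t n \<ominus> x \<otimes> y)
        \<le> nrm A (s n \<otimes> t n \<ominus> x \<otimes> t n) + nrm A (x \<otimes> t n \<ominus> x \<otimes> y)"
      using c by (intro nrm_diff_triangle) auto
    also have "\<dots> = nrm A ((s n \<ominus> x) \<otimes> t n) + nrm A (x \<otimes> (t n \<ominus> y))"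
      using c by (simp add: mult_diff_left mult_diff_right)
    also have "\<dots> \<le> nrm A (s n \<ominus> x) * nrm A (t n) + nrm A x * nrm A (t n \<ominus> y)"
      using c by (intro add_mono nrm_mult) auto
    finally show ?thesis .
  qed
  show "(\<lambda>n. nrm A (s n \<ominus> x) * nrm A (t n) + nrm A x * nrm A (t n \<ominus> y)) \<longlonglongrightarrow> 0"
    using tendsto_add[OF tendsto_mult[OF c(3) converges_to_nrm[OF assms(2)]]
        tendsto_mult[OF tendsto_const[of "nrm A x"] c(6)]] by simp
qed (use assms in \<open>auto dest: converges_toD\<close>)

lemma converges_to_scale:
  assumes "converges_to A s x"
  shows "converges_to A (\<lambda>n. c \<odot> s n) (c \<odot> x)"
proof (rule converges_toI)
  note c = converges_toD[OF assms]
  show "nrm A (c \<odot> s n \<ominus> c \<odot> x) \<le> cmod c * nrm A (s n \<ominus> x)" for n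
    using c by (simp add: nrm_smult flip: scale_diff)
  show "(\<lambda>n. cmod c * nrm A (s n \<ominus> x)) \<longlonglongrightarrow> 0"
    using tendsto_mult[OF tendsto_const[of "cmod c"] c(3)] by simp
qed (use assms in \<open>auto dest: converges_toD\<close>)

end

section \<open>Bounded linear maps with an explicit constant\<close>

definition bounded_linear_map :: "'a normed_alg \<Rightarrow> 'b normed_alg \<Rightarrow> ('a \<Rightarrow> 'b) \<Rightarrow> real \<Rightarrow> bool" where
  "bounded_linear_map A B f K \<longleftrightarrow>
     f \<in> carrier A \<rightarrow> carrier B \<and>
     (\<forall>x\<in>carrier A. \<forall>y\<in>carrier A. f (x \<oplus>\<^bsub>A\<^esub> y) = f x \<oplus>\<^bsub>B\<^esub> f y) \<and>
     (\<forall>c. \<forall>x\<in>carrier A. f (c \<odot>\<^bsub>A\<^esub> x) = c \<odot>\<^bsub>B\<^esub> f x) \<and>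
     (\<forall>x\<in>carrier A. nrm B (f x) \<le> K * nrm A x)"

lemma bounded_linear_mapD:
  assumes "bounded_linear_map A B f K"
  shows "x \<in> carrier A \<Longrightarrow> f x \<in> carrier B"
    "\<lbrakk>x \<in> carrier A; y \<in> carrier A\<rbrakk> \<Longrightarrow> f (x \<oplus>\<^bsub>A\<^esub> y) = f x \<oplus>\<^bsub>B\<^esub> f y"
    "x \<in> carrier A \<Longrightarrow> f (c \<odot>\<^bsub>A\<^esub> x) = c \<odot>\<^bsub>B\<^esub> f x"
    "x \<in> carrier A \<Longrightarrow> nrm B (f x) \<le> K * nrm A x"
  using assms by (auto simp: bounded_linear_map_def)

lemma bounded_linear_map_diff:
  assumes "normed_algebra A" "normed_algebra B" "bounded_linear_map A B f K"
    and "x \<in> carrier A" "y \<in> carrier A"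
  shows "f (x \<ominus>\<^bsub>A\<^esub> y) = f x \<ominus>\<^bsub>B\<^esub> f y"
proof -
  interpret A: normed_algebra A by fact
  interpret B: normed_algebra B by fact
  show ?thesis
    using assms(4,5) bounded_linear_mapD[OF assms(3)]
    by (simp add: A.diff_eq_scale B.diff_eq_scale)
qed

lemma bounded_linear_map_converges:
  assumes "normed_algebra A" "normed_algebra B" "bounded_linear_map A B f K"
    and "converges_to A s x"
  shows "converges_to B (\<lambda>n. f (s n)) (f x)"
proof -
  interpret A: normed_algebra A by fact
  interpret B: normed_algebra B by fact
  note c = converges_toD[OF assms(4)] and f = bounded_linear_mapD[OF assms(3)]
  show ?thesis
  proof (rule B.converges_toI)
    show "nrm B (f (s n) \<ominus>\<^bsub>B\<^esub> f x) \<le> K * nrm A (s n \<ominus>\<^bsub>A\<^esub> x)" for n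
      using f(4)[of "s n \<ominus>\<^bsub>A\<^esub> x"] c bounded_linear_map_diff[OF assms(1-3)] by simp
    show "(\<lambda>n. K * nrm A (s n \<ominus>\<^bsub>A\<^esub> x)) \<longlonglongrightarrow> 0"
      using tendsto_mult[OF tendsto_const[of K] c(3)] by simp
  qed (use c f in auto)
qed

text \<open>By continuity the closure of \<open>f\<close> S\<open>contains\<close>f
  \<open>carrier A\<close>, which is itself dense.\<close>

lemma dense_in_image:
  assumes "normed_algebra A" "normed_algebra B" "bounded_linear_map A B f K"
    and "dense_in A S" "dense_in B (f ` carrier A)"
  shows "dense_in B (f ` S)"
proof -
  interpret A: normed_algebra A by fact
  interpret B: normed_algebra B by fact
  note f = bounded_linear_mapD[OF assms(3)]
  have S: "S \<subseteq> carrier A"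
    using assms(4) by (simp add: dense_in_def)
  have "f ` carrier A \<subseteq> alg_top B closure_of (f ` S)"
  proof clarify
    fix x assume "x \<in> carrier A"
    then obtain s where "range s \<subseteq> S" "converges_to A s x"
      using assms(4) A.dense_in_iff by blast
    then have "range (\<lambda>n. f (s n)) \<subseteq> f ` S" "converges_to B (\<lambda>n. f (s n)) (f x)"
      using bounded_linear_map_converges[OF assms(1-3)] by auto
    then show "f x \<in> alg_top B closure_of (f ` S)"
      using B.in_closure_of_iff by blast
  qed
  then have "alg_top B closure_of (f ` carrier A) \<subseteq> alg_top B closure_of (f ` S)"
    by (simp add: closure_of_minimal)
  then have "carrier B \<subseteq> alg_top B closure_of (f ` S)"
    using assms(5) by (simp add: dense_in_def)
  moreover have "f ` S \<subseteq> carrier B"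
    using S f(1) by auto
  ultimately show ?thesis
    using B.closure_of_subset_carrier by (simp add: dense_in_def subset_antisym)
qed

lemma (in banach_algebra) cauchy_converges_to:
  assumes "range s \<subseteq> carrier A" "\<forall>e>0. \<exists>N. \<forall>m\<ge>N. \<forall>n\<ge>N. nrm A (s m \<ominus> s n) < e"
  shows "\<exists>x. converges_to A s x"
  using mcomplete_iff complete assms by metis

lemma banach_algebraI:
  assumes "normed_algebra A"
    and "\<And>s. \<lbrakk>range s \<subseteq> carrier A;
      \<forall>e>0. \<exists>N. \<forall>m\<ge>N. \<forall>n\<ge>N. nrm A (s m \<ominus>\<^bsub>A\<^esub> s n) < e\<rbrakk> \<Longrightarrow> \<exists>x. converges_to A s x"
  shows "banach_algebra A"
  using assms normed_algebra.mcomplete_iff[OF assms(1)] by (simp add: banach_algebra_iff)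


section \<open>Subalgebras and closures\<close>

context normed_algebra
begin

text \<open>The norm \<open>N\<close> is free because two cases are needed: closures keep the norm
  of \<open>A\<close>, while algebras of bounded orbits carry a stronger one.\<close>

lemma normed_subalgebra:
  assumes "C \<subseteq> carrier A" "\<zero> \<in> C"
    and "\<And>x y. \<lbrakk>x \<in> C; y \<in> C\<rbrakk> \<Longrightarrow> x \<oplus> y \<in> C"
    and "\<And>c x. x \<in> C \<Longrightarrow> c \<odot> x \<in> C"
    and "\<And>x y. \<lbrakk>x \<in> C; y \<in> C\<rbrakk> \<Longrightarrow> x \<otimes> y \<in> C"
    and "\<And>x. x \<in> C \<Longrightarrow> 0 \<le> N x"
    and "\<And>x. x \<in> C \<Longrightarrow> N x = 0 \<longleftrightarrow> x = \<zero>"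
    and "\<And>x y. \<lbrakk>x \<in> C; y \<in> C\<rbrakk> \<Longrightarrow> N (x \<oplus> y) \<le> N x + N y"
    and "\<And>c x. x \<in> C \<Longrightarrow> N (c \<odot> x) = cmod c * N x"
    and "\<And>x y. \<lbrakk>x \<in> C; y \<in> C\<rbrakk> \<Longrightarrow> N (x \<otimes> y) \<le> N x * N y"
  shows "normed_algebra (A\<lparr>carrier := C, nrm := N\<rparr>)"
proof -
  have C: "x \<in> carrier A" if "x \<in> C" for x
    using assms(1) that by blast
  show ?thesis
    by (rule normed_algebraI)
      (simp_all add: assms C scale_minus_one_add scale_add scale_add_right scale_assoc mult_assoc
        distrib_l distrib_r smult_mult_l smult_mult_r a_assoc, auto intro: a_comm C)
qed

text \<open>Subtraction goes through the additive inverse, which is a description over the carrier.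
  It therefore changes formally when the carrier shrinks, unlike sums and scalar multiples, which
  are record fields.\<close>

lemma normed_subalgebra_diff:
  assumes "normed_algebra (A\<lparr>carrier := C, nrm := N\<rparr>)" "C \<subseteq> carrier A" "x \<in> C" "y \<in> C"
  shows "x \<ominus>\<^bsub>A\<lparr>carrier := C, nrm := N\<rparr>\<^esub> y = x \<ominus> y"
proof -
  interpret C: normed_algebra "A\<lparr>carrier := C, nrm := N\<rparr>" by fact
  show ?thesis
    using assms C.diff_eq_scale[of y x] diff_eq_scale[of y x] by auto
qed

lemma closure_of_le_carrier: "x \<in> alg_top A closure_of S \<Longrightarrow> x \<in> carrier A"
  using closure_of_subset_carrier by blast

lemma closure_of_limit:
  assumes "range s \<subseteq> alg_top A closure_of S" "converges_to A s x"
  shows "x \<in> alg_top A closure_of S"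
  using assms in_closure_of_iff[of x "alg_top A closure_of S"] by auto

lemma closure_of_incl: "S \<subseteq> carrier A \<Longrightarrow> S \<subseteq> alg_top A closure_of S"
  by (metis closure_of_subset topspace_mtopology alg_top_def)

end

lemma closure_normed_algebra:
  fixes A :: "'a normed_alg" (structure)
  assumes "normed_algebra A" "S \<subseteq> carrier A" "\<zero> \<in> S"
    and add: "\<And>x y. \<lbrakk>x \<in> S; y \<in> S\<rbrakk> \<Longrightarrow> x \<oplus> y \<in> S"
    and scale: "\<And>c x. x \<in> S \<Longrightarrow> c \<odot> x \<in> S"
    and mult: "\<And>x y. \<lbrakk>x \<in> S; y \<in> S\<rbrakk> \<Longrightarrow> x \<otimes> y \<in> S"
  shows "normed_algebra (A\<lparr>carrier := alg_top A closure_of S\<rparr>)"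
proof -
  interpret normed_algebra A by fact
  let ?C = "alg_top A closure_of S"
  have "x \<oplus> y \<in> ?C \<and> x \<otimes> y \<in> ?C" if "x \<in> ?C" "y \<in> ?C" for x y
  proof -
    obtain s where s: "range s \<subseteq> S" "converges_to A s x"
      using \<open>x \<in> ?C\<close> unfolding in_closure_of_iff by blast
    obtain t where t: "range t \<subseteq> S" "converges_to A t y"
      using \<open>y \<in> ?C\<close> unfolding in_closure_of_iff by blast
    have "s n \<in> S" "t n \<in> S" for n
      using s(1) t(1) by auto
    then have "range (\<lambda>n. s n \<oplus> t n) \<subseteq> S" "range (\<lambda>n. s n \<otimes> t n) \<subseteq> S"
      using add mult by auto
    with converges_to_add[OF s(2) t(2)] converges_to_mult[OF s(2) t(2)] show ?thesis
      using in_closure_of_iff by blast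
  qed
  moreover have "c \<odot> x \<in> ?C" if "x \<in> ?C" for c x
  proof -
    obtain s where s: "range s \<subseteq> S" "converges_to A s x"
      using \<open>x \<in> ?C\<close> unfolding in_closure_of_iff by blast
    have "range (\<lambda>n. c \<odot> s n) \<subseteq> S"
      using s(1) scale by auto
    with converges_to_scale[OF s(2)] show ?thesis
      using in_closure_of_iff by blast
  qed
  moreover have "\<zero> \<in> ?C"
    using closure_of_incl assms(2,3) by blast
  ultimately have "normed_algebra (A\<lparr>carrier := ?C, nrm := nrm A\<rparr>)"
    by (intro normed_subalgebra)
      (auto dest!: closure_of_le_carrier simp: nrm_nonneg nrm_eq_0_iff nrm_triangle nrm_smult nrm_mult)
  then show ?thesis
    by simp
qed

lemma carrier_restriction_diff:
  fixes A :: "'a normed_alg" (structure)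
  assumes "normed_algebra A" "normed_algebra (A\<lparr>carrier := C\<rparr>)" "C \<subseteq> carrier A" "x \<in> C" "y \<in> C"
  shows "x \<ominus>\<^bsub>A\<lparr>carrier := C\<rparr>\<^esub> y = x \<ominus> y"
  using normed_algebra.normed_subalgebra_diff[OF assms(1), where C = C and N = "nrm A"] assms(2-) by simp

lemma carrier_restriction_converges_to:
  fixes A :: "'a normed_alg" (structure)
  assumes "normed_algebra A" "normed_algebra (A\<lparr>carrier := C\<rparr>)" "C \<subseteq> carrier A"
    and "range s \<subseteq> C" "x \<in> C"
  shows "converges_to (A\<lparr>carrier := C\<rparr>) s x \<longleftrightarrow> converges_to A s x"
proof -
  have "s n \<ominus>\<^bsub>A\<lparr>carrier := C\<rparr>\<^esub> x = s n \<ominus> x" for n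
    using assms by (intro carrier_restriction_diff) auto
  then show ?thesis
    using assms(3-5) by (auto simp: converges_to_def)
qed

lemma closure_banach_algebra:
  fixes A :: "'a normed_alg" (structure)
  assumes "banach_algebra A" "S \<subseteq> carrier A" "\<zero> \<in> S"
    and "\<And>x y. \<lbrakk>x \<in> S; y \<in> S\<rbrakk> \<Longrightarrow> x \<oplus> y \<in> S"
    and "\<And>c x. x \<in> S \<Longrightarrow> c \<odot> x \<in> S"
    and "\<And>x y. \<lbrakk>x \<in> S; y \<in> S\<rbrakk> \<Longrightarrow> x \<otimes> y \<in> S"
  shows "banach_algebra (A\<lparr>carrier := alg_top A closure_of S\<rparr>)"
proof -
  interpret banach_algebra A by fact
  let ?C = "alg_top A closure_of S"
  have na: "normed_algebra A"
    by unfold_locales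
  then interpret C: normed_algebra "A\<lparr>carrier := ?C\<rparr>"
    by (rule closure_normed_algebra) (use assms in auto)
  note C = closure_of_subset_carrier[of S]
  have "\<exists>x. converges_to (A\<lparr>carrier := ?C\<rparr>) s x"
    if s: "range s \<subseteq> ?C" "\<forall>e>0. \<exists>N. \<forall>m\<ge>N. \<forall>n\<ge>N. nrm A (s m \<ominus>\<^bsub>A\<lparr>carrier := ?C\<rparr>\<^esub> s n) < e"
    for s
  proof -
    have "s m \<ominus>\<^bsub>A\<lparr>carrier := ?C\<rparr>\<^esub> s n = s m \<ominus> s n" for m n
      using s(1) by (intro carrier_restriction_diff[OF na C.normed_algebra_axioms C]) auto
    then have "\<exists>x. converges_to A s x"
      using s C by (intro cauchy_converges_to) auto
    then obtain x where x: "converges_to A s x" ..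
    then have "x \<in> ?C"
      using closure_of_limit s(1) by blast
    then show ?thesis
      using carrier_restriction_converges_to[OF na C.normed_algebra_axioms C s(1)] x by blast
  qed
  then show ?thesis
    by (intro banach_algebraI C.normed_algebra_axioms) simp
qed


section \<open>The multiplier algebra\<close>

lemma mult_alg_sel [simp]:
  "carrier (mult_alg A) = multipliers A"
  "r \<otimes>\<^bsub>mult_alg A\<^esub> r' = compose (carrier A) r r'"
  "\<one>\<^bsub>mult_alg A\<^esub> = (\<lambda>x\<in>carrier A. x)"
  "\<zero>\<^bsub>mult_alg A\<^esub> = (\<lambda>x\<in>carrier A. \<zero>\<^bsub>A\<^esub>)"
  "r \<oplus>\<^bsub>mult_alg A\<^esub> r' = (\<lambda>x\<in>carrier A. r x \<oplus>\<^bsub>A\<^esub> r' x)"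
  "c \<odot>\<^bsub>mult_alg A\<^esub> r = (\<lambda>x\<in>carrier A. c \<odot>\<^bsub>A\<^esub> r x)"
  by (simp_all add: mult_alg_def)

lemma nrm_mult_alg: "nrm (mult_alg A) r = (SUP x\<in>{x \<in> carrier A. nrm A x \<le> 1}. nrm A (r x))"
  by (simp add: mult_alg_def)

lemma multipliersD:
  assumes "r \<in> multipliers A"
  shows "x \<in> carrier A \<Longrightarrow> r x \<in> carrier A"
    and "r \<in> extensional (carrier A)"
    and "\<lbrakk>x \<in> carrier A; y \<in> carrier A\<rbrakk> \<Longrightarrow> r (x \<oplus>\<^bsub>A\<^esub> y) = r x \<oplus>\<^bsub>A\<^esub> r y"
    and "x \<in> carrier A \<Longrightarrow> r (c \<odot>\<^bsub>A\<^esub> x) = c \<odot>\<^bsub>A\<^esub> r x"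
    and "\<lbrakk>x \<in> carrier A; y \<in> carrier A\<rbrakk> \<Longrightarrow> r (x \<otimes>\<^bsub>A\<^esub> y) = r x \<otimes>\<^bsub>A\<^esub> y"
  using assms by (auto simp: multipliers_def PiE_def)

lemma multipliersI:
  assumes "r \<in> extensional (carrier A)"
    and "\<And>x. x \<in> carrier A \<Longrightarrow> r x \<in> carrier A"
    and "\<And>x y. \<lbrakk>x \<in> carrier A; y \<in> carrier A\<rbrakk> \<Longrightarrow> r (x \<oplus>\<^bsub>A\<^esub> y) = r x \<oplus>\<^bsub>A\<^esub> r y"
    and "\<And>c x. x \<in> carrier A \<Longrightarrow> r (c \<odot>\<^bsub>A\<^esub> x) = c \<odot>\<^bsub>A\<^esub> r x"
    and "\<And>x y. \<lbrakk>x \<in> carrier A; y \<in> carrier A\<rbrakk> \<Longrightarrow> r (x \<otimes>\<^bsub>A\<^esub> y) = r x \<otimes>\<^bsub>A\<^esub> y"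
    and "\<And>x. x \<in> carrier A \<Longrightarrow> nrm A (r x) \<le> K * nrm A x"
  shows "r \<in> multipliers A"
  using assms by (auto simp: multipliers_def PiE_def intro!: exI[of _ K])

lemma multipliers_eqI:
  assumes "r \<in> multipliers A" "r' \<in> multipliers A" "\<And>x. x \<in> carrier A \<Longrightarrow> r x = r' x"
  shows "r = r'"
  using assms multipliersD(2) extensionalityI by metis

context normed_algebra
begin

lemma nrm_mult_alg_leI:
  assumes "\<And>x. x \<in> carrier A \<Longrightarrow> nrm A (r x) \<le> K * nrm A x" "0 \<le> K"
  shows "nrm (mult_alg A) r \<le> K"
  unfolding nrm_mult_alg
proof (rule cSUP_least)
  \<comment> \<open>A real \<open>SUP\<close> over the empty set would have no useful value; zero
    keeps the unit ball nonempty.\<close>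
  have "\<zero> \<in> {x \<in> carrier A. nrm A x \<le> 1}"
    by simp
  then show "{x \<in> carrier A. nrm A x \<le> 1} \<noteq> {}"
    by blast
  fix x assume "x \<in> {x \<in> carrier A. nrm A x \<le> 1}"
  then show "nrm A (r x) \<le> K"
    using assms(1)[of x] mult_left_mono[of "nrm A x" 1 K] assms(2) by simp
qed

lemma multipliers_bounded:
  assumes "r \<in> multipliers A"
  obtains K where "0 \<le> K" "\<And>x. x \<in> carrier A \<Longrightarrow> nrm A (r x) \<le> K * nrm A x"
proof -
  obtain K where K: "\<forall>x\<in>carrier A. nrm A (r x) \<le> K * nrm A x"
    using assms by (auto simp: multipliers_def)
  have "nrm A (r x) \<le> max K 0 * nrm A x" if "x \<in> carrier A" for x
    using K that nrm_nonneg[OF that] mult_right_mono[of K "max K 0" "nrm A x"] by force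
  then show ?thesis
    using that[of "max K 0"] by simp
qed

lemma multiplier_bdd_above:
  assumes "r \<in> multipliers A"
  shows "bdd_above ((\<lambda>x. nrm A (r x)) ` {x \<in> carrier A. nrm A x \<le> 1})"
proof -
  obtain K where K: "0 \<le> K" "\<And>x. x \<in> carrier A \<Longrightarrow> nrm A (r x) \<le> K * nrm A x"
    using multipliers_bounded[OF assms] by blast
  have "nrm A (r x) \<le> K" if "x \<in> carrier A" "nrm A x \<le> 1" for x
    using K(2)[OF that(1)] mult_left_mono[OF that(2) K(1)] by simp
  then show ?thesis
    by (intro bdd_aboveI2[where M = K]) auto
qed

lemma multiplier_zero: "r \<in> multipliers A \<Longrightarrow> r \<zero> = \<zero>"
  using multipliersD(4)[of r A \<zero> 0] multipliersD(1)[of r A \<zero>] by simp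

lemma nrm_mult_alg_nonneg:
  assumes "r \<in> multipliers A"
  shows "0 \<le> nrm (mult_alg A) r"
  unfolding nrm_mult_alg
  using cSUP_upper[OF _ multiplier_bdd_above[OF assms], of \<zero>] multiplier_zero[OF assms] by simp

lemma nrm_multiplier:
  assumes "r \<in> multipliers A" "x \<in> carrier A"
  shows "nrm A (r x) \<le> nrm (mult_alg A) r * nrm A x"
proof (cases "nrm A x = 0")
  case True
  then show ?thesis
    using assms(2) multiplier_zero[OF assms(1)] nrm_eq_0_iff by auto
next
  case False
  define y where "y = complex_of_real (1 / nrm A x) \<odot> x"
  have pos: "0 < nrm A x"
    using False nrm_nonneg[OF assms(2)] by simp
  have "y \<in> carrier A" "nrm A y = 1"
    using assms pos by (simp_all add: y_def nrm_smult norm_divide)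
  then have "nrm A (r y) \<le> nrm (mult_alg A) r"
    unfolding nrm_mult_alg by (intro cSUP_upper multiplier_bdd_above assms) auto
  moreover have "nrm A (r y) = nrm A (r x) / nrm A x"
    using assms pos by (simp add: y_def multipliersD nrm_smult norm_divide)
  ultimately show ?thesis
    using pos by (simp add: field_simps)
qed

lemma multiplier_bounded_linear_map:
  "r \<in> multipliers A \<Longrightarrow> bounded_linear_map A A r (nrm (mult_alg A) r)"
  by (auto simp: bounded_linear_map_def multipliersD nrm_multiplier)

lemma multiplier_diff:
  "\<lbrakk>r \<in> multipliers A; x \<in> carrier A; y \<in> carrier A\<rbrakk> \<Longrightarrow> r (x \<ominus> y) = r x \<ominus> r y"
  by (rule bounded_linear_map_diff[OF normed_algebra_axioms normed_algebra_axioms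
        multiplier_bounded_linear_map])

lemma multiplier_converges_to:
  "\<lbrakk>r \<in> multipliers A; converges_to A s x\<rbrakk> \<Longrightarrow> converges_to A (\<lambda>n. r (s n)) (r x)"
  by (rule bounded_linear_map_converges[OF normed_algebra_axioms normed_algebra_axioms
        multiplier_bounded_linear_map])

lemma scale_left_commute: "x \<in> carrier A \<Longrightarrow> c \<odot> (d \<odot> x) = d \<odot> (c \<odot> x)"
  by (metis mult.commute scale_assoc)

lemma multipliers_add:
  assumes "r \<in> multipliers A" "r' \<in> multipliers A"
  shows "(\<lambda>x\<in>carrier A. r x \<oplus> r' x) \<in> multipliers A"
    "nrm (mult_alg A) (\<lambda>x\<in>carrier A. r x \<oplus> r' x) \<le> nrm (mult_alg A) r + nrm (mult_alg A) r'"
proof -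
  note r = multipliersD[OF assms(1)] and r' = multipliersD[OF assms(2)]
  have b: "nrm A (r x \<oplus> r' x) \<le> (nrm (mult_alg A) r + nrm (mult_alg A) r') * nrm A x"
    if "x \<in> carrier A" for x
    using nrm_triangle[OF r(1)[OF that] r'(1)[OF that]] nrm_multiplier[OF assms(1) that]
      nrm_multiplier[OF assms(2) that] by (simp add: algebra_simps)
  show "(\<lambda>x\<in>carrier A. r x \<oplus> r' x) \<in> multipliers A"
    by (rule multipliersI[where K = "nrm (mult_alg A) r + nrm (mult_alg A) r'"])
      (use b r r' in \<open>auto simp: a_ac scale_add_right distrib_l\<close>)
  show "nrm (mult_alg A) (\<lambda>x\<in>carrier A. r x \<oplus> r' x) \<le> nrm (mult_alg A) r + nrm (mult_alg A) r'"
    by (rule nrm_mult_alg_leI) (use b nrm_mult_alg_nonneg assms in auto)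
qed

text \<open>The upper bound holds for every scalar and every multiplier. Applied to
  \<open>inverse c\<close> and the scaled multiplier it gives the reverse inequality.\<close>

lemma multipliers_scale:
  assumes "r \<in> multipliers A"
  shows "(\<lambda>x\<in>carrier A. c \<odot> r x) \<in> multipliers A"
    "nrm (mult_alg A) (\<lambda>x\<in>carrier A. c \<odot> r x) = cmod c * nrm (mult_alg A) r"
proof -
  have *: "(\<lambda>x\<in>carrier A. d \<odot> q x) \<in> multipliers A \<and>
      nrm (mult_alg A) (\<lambda>x\<in>carrier A. d \<odot> q x) \<le> cmod d * nrm (mult_alg A) q"
    if q: "q \<in> multipliers A" for q d
  proof -
    note q' = multipliersD[OF q]
    have b: "nrm A (d \<odot> q x) \<le> cmod d * nrm (mult_alg A) q * nrm A x" if "x \<in> carrier A" for x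
      using nrm_multiplier[OF q that] q'(1)[OF that]
      by (simp add: nrm_smult mult.assoc mult_left_mono)
    have "(\<lambda>x\<in>carrier A. d \<odot> q x) \<in> multipliers A"
      by (rule multipliersI[where K = "cmod d * nrm (mult_alg A) q"])
        (use b q' in \<open>auto simp: scale_add_right smult_mult_l intro: scale_left_commute\<close>)
    moreover have "nrm (mult_alg A) (\<lambda>x\<in>carrier A. d \<odot> q x) \<le> cmod d * nrm (mult_alg A) q"
      by (rule nrm_mult_alg_leI) (use b nrm_mult_alg_nonneg q in auto)
    ultimately show ?thesis ..
  qed
  show c: "(\<lambda>x\<in>carrier A. c \<odot> r x) \<in> multipliers A"
    using * assms by blast
  show "nrm (mult_alg A) (\<lambda>x\<in>carrier A. c \<odot> r x) = cmod c * nrm (mult_alg A) r"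
  proof (cases "c = 0")
    case True
    then show ?thesis
      using *[OF assms, of c] nrm_mult_alg_nonneg[OF c] by simp
  next
    case False
    have "(\<lambda>x\<in>carrier A. inverse c \<odot> (\<lambda>x\<in>carrier A. c \<odot> r x) x) = r"
    proof (rule extensionalityI)
      show "(\<lambda>x\<in>carrier A. inverse c \<odot> (\<lambda>x\<in>carrier A. c \<odot> r x) x) x = r x"
        if "x \<in> carrier A" for x
        using that False multipliersD(1)[OF assms] by (simp flip: scale_assoc)
    qed (use multipliersD(2)[OF assms] in auto)
    then have "nrm (mult_alg A) r
        \<le> cmod (inverse c) * nrm (mult_alg A) (\<lambda>x\<in>carrier A. c \<odot> r x)"
      using *[OF c, of "inverse c"] by simp
    then have "cmod c * nrm (mult_alg A) r \<le> nrm (mult_alg A) (\<lambda>x\<in>carrier A. c \<odot> r x)"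
      using False by (simp add: norm_inverse norm_divide field_simps)
    then show ?thesis
      using *[OF assms, of c] by linarith
  qed
qed

lemma multipliers_compose:
  assumes "r \<in> multipliers A" "r' \<in> multipliers A"
  shows "compose (carrier A) r r' \<in> multipliers A"
    "nrm (mult_alg A) (compose (carrier A) r r') \<le> nrm (mult_alg A) r * nrm (mult_alg A) r'"
proof -
  note r = multipliersD[OF assms(1)] and r' = multipliersD[OF assms(2)]
  have b: "nrm A (r (r' x)) \<le> nrm (mult_alg A) r * nrm (mult_alg A) r' * nrm A x"
    if "x \<in> carrier A" for x
    using nrm_multiplier[OF assms(1) r'(1)[OF that]] nrm_multiplier[OF assms(2) that]
      mult_left_mono[OF _ nrm_mult_alg_nonneg[OF assms(1)]] by (fastforce simp: mult.assoc)
  show "compose (carrier A) r r' \<in> multipliers A"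
    by (rule multipliersI[where K = "nrm (mult_alg A) r * nrm (mult_alg A) r'"])
      (use b r r' in \<open>auto simp: compose_def\<close>)
  show "nrm (mult_alg A) (compose (carrier A) r r') \<le> nrm (mult_alg A) r * nrm (mult_alg A) r'"
    by (rule nrm_mult_alg_leI) (use b nrm_mult_alg_nonneg assms in \<open>auto simp: compose_def\<close>)
qed

lemma multipliers_one: "(\<lambda>x\<in>carrier A. x) \<in> multipliers A"
  by (rule multipliersI[where K = 1]) auto

lemma multipliers_zero: "(\<lambda>x\<in>carrier A. \<zero>) \<in> multipliers A"
  by (rule multipliersI[where K = 1]) (auto simp: nrm_nonneg)

lemma normed_algebra_mult_alg: "normed_algebra (mult_alg A)"
proof (rule normed_algebraI, simp_all only: mult_alg_sel)
  fix x y z c d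
  assume x: "x \<in> multipliers A"
  note x' = multipliersD[OF x]
  show "(\<lambda>a\<in>carrier A. (\<lambda>x\<in>carrier A. \<zero>) a \<oplus> x a) = x"
    by (rule extensionalityI[where A = "carrier A"]) (use x' in auto)
  show "(\<lambda>a\<in>carrier A. (\<lambda>xa\<in>carrier A. - 1 \<odot> x xa) a \<oplus> x a) = (\<lambda>x\<in>carrier A. \<zero>)"
    by (rule restrict_ext) (use x' scale_minus_one_add in auto)
  show "(\<lambda>a\<in>carrier A. (c + d) \<odot> x a) =
      (\<lambda>a\<in>carrier A. (\<lambda>xa\<in>carrier A. c \<odot> x xa) a \<oplus> (\<lambda>xa\<in>carrier A. d \<odot> x xa) a)"
    by (rule restrict_ext) (use x' scale_add in auto)
  show "(\<lambda>a\<in>carrier A. (c * d) \<odot> x a) = (\<lambda>a\<in>carrier A. c \<odot> (\<lambda>xa\<in>carrier A. d \<odot> x xa) a)"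
    by (rule restrict_ext) (use x' scale_assoc in auto)
  show "(\<lambda>a\<in>carrier A. 1 \<odot> x a) = x"
    by (rule extensionalityI[where A = "carrier A"]) (use x' in auto)
  show "nrm (mult_alg A) x = 0 \<longleftrightarrow> x = (\<lambda>x\<in>carrier A. \<zero>)"
  proof
    assume 0: "nrm (mult_alg A) x = 0"
    have "x a = \<zero>" if "a \<in> carrier A" for a
      using nrm_multiplier[OF x that] nrm_nonneg[OF x'(1)[OF that]] nrm_eq_0_iff[OF x'(1)[OF that]] 0
      by simp
    then show "x = (\<lambda>x\<in>carrier A. \<zero>)"
      using x'(2) by (intro extensionalityI[where A = "carrier A"]) auto
  next
    assume "x = (\<lambda>x\<in>carrier A. \<zero>)"
    then have "nrm (mult_alg A) x \<le> 0"
      by (intro nrm_mult_alg_leI) auto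
    then show "nrm (mult_alg A) x = 0"
      using nrm_mult_alg_nonneg[OF x] by simp
  qed
  assume y: "y \<in> multipliers A"
  note y' = multipliersD[OF y]
  show "(\<lambda>a\<in>carrier A. x a \<oplus> y a) = (\<lambda>a\<in>carrier A. y a \<oplus> x a)"
    by (rule restrict_ext) (use x' y' a_comm in auto)
  show "(\<lambda>a\<in>carrier A. c \<odot> (\<lambda>a\<in>carrier A. x a \<oplus> y a) a) =
      (\<lambda>a\<in>carrier A. (\<lambda>a\<in>carrier A. c \<odot> x a) a \<oplus> (\<lambda>a\<in>carrier A. c \<odot> y a) a)"
    by (rule restrict_ext) (use x' y' scale_add_right in auto)
  show "compose (carrier A) (\<lambda>a\<in>carrier A. c \<odot> x a) y = (\<lambda>a\<in>carrier A. c \<odot> compose (carrier A) x y a)"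
    unfolding compose_def by (rule restrict_ext) (use x' y' in auto)
  show "compose (carrier A) x (\<lambda>a\<in>carrier A. c \<odot> y a) = (\<lambda>a\<in>carrier A. c \<odot> compose (carrier A) x y a)"
    unfolding compose_def by (rule restrict_ext) (use x' y' in auto)
  assume z: "z \<in> multipliers A"
  note z' = multipliersD[OF z]
  show "(\<lambda>a\<in>carrier A. (\<lambda>a\<in>carrier A. x a \<oplus> y a) a \<oplus> z a) =
      (\<lambda>a\<in>carrier A. x a \<oplus> (\<lambda>a\<in>carrier A. y a \<oplus> z a) a)"
    by (rule restrict_ext) (use x' y' z' a_assoc in auto)
  show "compose (carrier A) (compose (carrier A) x y) z = compose (carrier A) x (compose (carrier A) y z)"
    unfolding compose_def by (rule restrict_ext) (use x' y' z' in auto)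
  show "compose (carrier A) (\<lambda>a\<in>carrier A. x a \<oplus> y a) z =
      (\<lambda>a\<in>carrier A. compose (carrier A) x z a \<oplus> compose (carrier A) y z a)"
    unfolding compose_def by (rule restrict_ext) (use x' y' z' in auto)
  show "compose (carrier A) x (\<lambda>a\<in>carrier A. y a \<oplus> z a) =
      (\<lambda>a\<in>carrier A. compose (carrier A) x y a \<oplus> compose (carrier A) x z a)"
    unfolding compose_def by (rule restrict_ext) (use x' y' z' in auto)
qed (rule multipliers_add multipliers_scale multipliers_compose multipliers_zero
    nrm_mult_alg_nonneg; assumption)+

lemma mult_alg_diff:
  assumes "r \<in> multipliers A" "r' \<in> multipliers A" "x \<in> carrier A"
  shows "(r \<ominus>\<^bsub>mult_alg A\<^esub> r') x = r x \<ominus> r' x"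
proof -
  interpret M: normed_algebra "mult_alg A"
    by (rule normed_algebra_mult_alg)
  show ?thesis
    using assms multipliersD(1)[OF assms(2,3)] by (simp add: M.diff_eq_scale diff_eq_scale)
qed

lemma mult_op_multiplier:
  assumes "u \<in> carrier A"
  shows "mult_op A u \<in> multipliers A" "nrm (mult_alg A) (mult_op A u) \<le> nrm A u"
proof -
  show "mult_op A u \<in> multipliers A"
    by (rule multipliersI[where K = "nrm A u"])
      (use assms in \<open>auto simp: mult_op_def distrib_r smult_mult_r mult_assoc nrm_mult\<close>)
  show "nrm (mult_alg A) (mult_op A u) \<le> nrm A u"
    by (rule nrm_mult_alg_leI) (use assms in \<open>auto simp: mult_op_def nrm_mult nrm_nonneg\<close>)
qed

end

text \<open>A Cauchy sequence of multipliers converges pointwise. The algebraic identities pass to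
  the limit, and the Cauchy estimate does so uniformly on the unit ball.\<close>

lemma (in banach_algebra) banach_algebra_mult_alg: "banach_algebra (mult_alg A)"
proof -
  interpret M: normed_algebra "mult_alg A"
    by (rule normed_algebra_mult_alg)
  have "\<exists>r. converges_to (mult_alg A) s r"
    if s: "range s \<subseteq> multipliers A"
      and cauchy: "\<forall>e>0. \<exists>N. \<forall>m\<ge>N. \<forall>n\<ge>N. nrm (mult_alg A) (s m \<ominus>\<^bsub>mult_alg A\<^esub> s n) < e" for s
  proof -
    have sm: "s n \<in> multipliers A" for n
      using s by blast
    note s' = multipliersD[OF sm]
    have diff: "nrm A (s m x \<ominus> s n x) \<le> nrm (mult_alg A) (s m \<ominus>\<^bsub>mult_alg A\<^esub> s n) * nrm A x"
      if "x \<in> carrier A" for m n x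
      using nrm_multiplier[of "s m \<ominus>\<^bsub>mult_alg A\<^esub> s n" x] M.diff_closed[of "s m" "s n"] sm that
      by (simp add: mult_alg_diff)
    have "\<exists>l. converges_to A (\<lambda>n. s n x) l" if x: "x \<in> carrier A" for x
    proof -
      have "\<exists>N. \<forall>m\<ge>N. \<forall>n\<ge>N. nrm A (s m x \<ominus> s n x) < e" if "0 < e" for e
      proof -
        have pos: "0 < nrm A x + 1"
          using nrm_nonneg[OF x] by simp
        \<comment> \<open>Adding 1 keeps the divisor positive when \<open>x\<close> is zero.\<close>
        obtain N where N: "\<forall>m\<ge>N. \<forall>n\<ge>N. nrm (mult_alg A) (s m \<ominus>\<^bsub>mult_alg A\<^esub> s n) < e / (nrm A x + 1)"
          using cauchy \<open>0 < e\<close> pos by (meson divide_pos_pos)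
        have "nrm A (s m x \<ominus> s n x) < e" if "N \<le> m" "N \<le> n" for m n
        proof -
          have "nrm A (s m x \<ominus> s n x) \<le> e / (nrm A x + 1) * nrm A x"
            using diff[OF x, of m n] mult_right_mono[OF less_imp_le nrm_nonneg[OF x]] N that
            by (meson order_trans)
          also have "\<dots> < e"
            using pos \<open>0 < e\<close> by (simp add: divide_simps)
          finally show ?thesis .
        qed
        then show ?thesis
          by blast
      qed
      then show ?thesis
        by (intro cauchy_converges_to) (use s'(1)[OF x] in auto)
    qed
    then obtain l where l: "\<And>x. x \<in> carrier A \<Longrightarrow> converges_to A (\<lambda>n. s n x) (l x)"
      by metis
    define r where "r = restrict l (carrier A)"
    have r: "converges_to A (\<lambda>n. s n x) (r x)" if "x \<in> carrier A" for x
      using l[OF that] that by (simp add: r_def)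
    note rc = converges_toD(2)[OF r]
    \<comment> \<open>One uniform estimate serves twice: with \<open>e = 1\<close> it shows that the
      limit is bounded, with small \<open>e\<close> that convergence holds in operator norm.\<close>
    have bound: "\<exists>N. \<forall>n\<ge>N. \<forall>x\<in>carrier A. nrm A (s n x \<ominus> r x) \<le> e * nrm A x" if "0 < e" for e
    proof -
      obtain N where N: "\<forall>m\<ge>N. \<forall>n\<ge>N. nrm (mult_alg A) (s m \<ominus>\<^bsub>mult_alg A\<^esub> s n) < e"
        using cauchy \<open>0 < e\<close> by blast
      have "nrm A (s n x \<ominus> r x) \<le> e * nrm A x" if n: "n \<ge> N" and x: "x \<in> carrier A" for n x
      proof -
        have "nrm A (s m x \<ominus> s n x) \<le> e * nrm A x" if "m \<ge> N" for m
        proof -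
          have "nrm (mult_alg A) (s m \<ominus>\<^bsub>mult_alg A\<^esub> s n) \<le> e"
            using N n that by (simp add: less_imp_le)
          then show ?thesis
            using diff[OF x, of m n] mult_right_mono[OF _ nrm_nonneg[OF x]] order_trans by blast
        qed
        then have "\<forall>\<^sub>F m in sequentially. nrm A (s m x \<ominus> s n x) \<le> e * nrm A x"
          unfolding eventually_sequentially by blast
        then have "nrm A (r x \<ominus> s n x) \<le> e * nrm A x"
          by (rule nrm_limit_diff_le[OF r[OF x] s'(1)[OF x]])
        then show ?thesis
          using nrm_diff_commute rc s' x by simp
      qed
      then show ?thesis
        by blast
    qed
    obtain N where N: "\<forall>n\<ge>N. \<forall>x\<in>carrier A. nrm A (s n x \<ominus> r x) \<le> 1 * nrm A x"
      using bound[of 1] by auto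
    have rm: "r \<in> multipliers A"
    proof (rule multipliersI)
      show "r \<in> extensional (carrier A)"
        by (simp add: r_def)
      show "r x \<in> carrier A" if "x \<in> carrier A" for x
        using rc that .
      show "r (x \<oplus> y) = r x \<oplus> r y" if "x \<in> carrier A" "y \<in> carrier A" for x y
        using converges_to_add[OF r[OF that(1)] r[OF that(2)]] r[of "x \<oplus> y"] s'(3) that
          converges_to_unique by simp
      show "r (c \<odot> x) = c \<odot> r x" if "x \<in> carrier A" for x c
        using converges_to_scale[OF r[OF that], of c] r[of "c \<odot> x"] s'(4) that
          converges_to_unique by simp
      show "r (x \<otimes> y) = r x \<otimes> y" if "x \<in> carrier A" "y \<in> carrier A" for x y
        using converges_to_mult[OF r[OF that(1)] converges_to_const[OF that(2)]] r[of "x \<otimes> y"]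
          s'(5) that converges_to_unique by simp
      show "nrm A (r x) \<le> (nrm (mult_alg A) (s N) + 1) * nrm A x" if "x \<in> carrier A" for x
      proof -
        have "nrm A (r x) \<le> nrm A (s N x) + nrm A (s N x \<ominus> r x)"
          using nrm_le_add_diff[of "r x" "s N x"] nrm_diff_commute rc s' that by simp
        then show ?thesis
          using nrm_multiplier[OF sm that, of N] N that by (simp add: distrib_right) (smt (verit) order_refl)
      qed
    qed
    have "(\<lambda>n. nrm (mult_alg A) (s n \<ominus>\<^bsub>mult_alg A\<^esub> r)) \<longlonglongrightarrow> 0"
    proof (rule LIMSEQ_I)
      fix e :: real assume "0 < e"
      then obtain N where N: "\<forall>n\<ge>N. \<forall>x\<in>carrier A. nrm A (s n x \<ominus> r x) \<le> e / 2 * nrm A x"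
        using bound[of "e / 2"] by auto
      have "norm (nrm (mult_alg A) (s n \<ominus>\<^bsub>mult_alg A\<^esub> r) - 0) < e" if "N \<le> n" for n
      proof -
        have "nrm (mult_alg A) (s n \<ominus>\<^bsub>mult_alg A\<^esub> r) \<le> e / 2"
          using N that \<open>0 < e\<close> by (intro nrm_mult_alg_leI) (auto simp: mult_alg_diff sm rm)
        then show ?thesis
          using M.nrm_nonneg[of "s n \<ominus>\<^bsub>mult_alg A\<^esub> r"] M.diff_closed[of "s n" r] sm rm \<open>0 < e\<close> by simp
      qed
      then show "\<exists>no. \<forall>n\<ge>no. norm (nrm (mult_alg A) (s n \<ominus>\<^bsub>mult_alg A\<^esub> r) - 0) < e"
        by blast
    qed
    then show ?thesis
      using s rm by (auto simp: converges_to_def)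
  qed
  then show ?thesis
    by (intro banach_algebraI M.normed_algebra_axioms) simp
qed

section \<open>Weakly cancellative algebras\<close>

text \<open>The condition on principal ideals is used in the form that only zero annihilates the
  whole algebra.\<close>

lemma weakly_cancellativeD:
  fixes A :: "'a normed_alg" (structure)
  assumes "weakly_cancellative A"
  shows "banach_algebra A" "normed_algebra A"
    and "\<lbrakk>x \<in> carrier A; y \<in> carrier A\<rbrakk> \<Longrightarrow> x \<otimes> y = y \<otimes> x"
    and "\<exists>x\<in>carrier A. x \<noteq> \<zero>"
    and "\<lbrakk>u \<in> carrier A; \<And>x. x \<in> carrier A \<Longrightarrow> u \<otimes> x = \<zero>\<rbrakk> \<Longrightarrow> u = \<zero>"
proof -
  show b: "banach_algebra A"
    using assms by (simp add: weakly_cancellative_def)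
  then interpret banach_algebra A .
  show "normed_algebra A"
    by unfold_locales
  show "x \<otimes> y = y \<otimes> x" if "x \<in> carrier A" "y \<in> carrier A"
    using assms that by (simp add: weakly_cancellative_def)
  show "\<exists>x\<in>carrier A. x \<noteq> \<zero>"
    using assms zero_closed unfolding weakly_cancellative_def by blast
  show "u = \<zero>" if u: "u \<in> carrier A" "\<And>x. x \<in> carrier A \<Longrightarrow> u \<otimes> x = \<zero>"
  proof (rule ccontr)
    assume "u \<noteq> \<zero>"
    then have "(\<lambda>x. u \<otimes> x) ` carrier A \<noteq> {\<zero>}"
      using assms u(1) unfolding weakly_cancellative_def by blast
    moreover have "(\<lambda>x. u \<otimes> x) ` carrier A = {\<zero>}"
      using u(2) zero_closed by (auto simp: image_iff)
    ultimately show False ..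
  qed
qed

lemma weakly_cancellativeI:
  fixes A :: "'a normed_alg" (structure)
  assumes "banach_algebra A"
    and "\<And>x y. \<lbrakk>x \<in> carrier A; y \<in> carrier A\<rbrakk> \<Longrightarrow> x \<otimes> y = y \<otimes> x"
    and "\<exists>x\<in>carrier A. x \<noteq> \<zero>"
    and "\<And>u. \<lbrakk>u \<in> carrier A; \<And>x. x \<in> carrier A \<Longrightarrow> u \<otimes> x = \<zero>\<rbrakk> \<Longrightarrow> u = \<zero>"
  shows "weakly_cancellative A"
  unfolding weakly_cancellative_def
proof (intro conjI ballI)
  show "(\<lambda>x. u \<otimes> x) ` carrier A \<noteq> {\<zero>}" if "u \<in> carrier A - {\<zero>}" for u
  proof
    assume "(\<lambda>x. u \<otimes> x) ` carrier A = {\<zero>}"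
    then have "u \<otimes> x = \<zero>" if "x \<in> carrier A" for x
      using that by blast
    then show False
      using assms(4)[of u] that by blast
  qed
qed (use assms(1-3) in auto)

locale wc_algebra = banach_algebra A for A :: "'a normed_alg" (structure) +
  assumes wc: "weakly_cancellative A"

lemma wc_algebraI: "weakly_cancellative A \<Longrightarrow> wc_algebra A"
  by (simp add: wc_algebra_def wc_algebra_axioms_def weakly_cancellativeD(1))

context wc_algebra
begin

lemma mult_commute: "\<lbrakk>x \<in> carrier A; y \<in> carrier A\<rbrakk> \<Longrightarrow> x \<otimes> y = y \<otimes> x"
  by (rule weakly_cancellativeD(3)[OF wc])

lemma mult_eq_zeroD:
  "\<lbrakk>u \<in> carrier A; \<And>x. x \<in> carrier A \<Longrightarrow> u \<otimes> x = \<zero>\<rbrakk> \<Longrightarrow> u = \<zero>"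
  by (rule weakly_cancellativeD(5)[OF wc])

text \<open>Multiplication is continuous, so annihilating a dense set already means annihilating
  everything.\<close>

lemma mult_dense_eq_zeroD:
  assumes "dense_in A D" "u \<in> carrier A" "\<And>d. d \<in> D \<Longrightarrow> u \<otimes> d = \<zero>"
  shows "u = \<zero>"
proof (rule mult_eq_zeroD[OF assms(2)])
  fix x assume "x \<in> carrier A"
  then obtain s where s: "range s \<subseteq> D" "converges_to A s x"
    using assms(1) unfolding dense_in_iff by blast
  have "(\<lambda>n. u \<otimes> s n) = (\<lambda>n. \<zero>)"
    using s(1) assms(3) by auto
  then show "u \<otimes> x = \<zero>"
    using converges_to_mult[OF converges_to_const[OF assms(2)] s(2)]
      converges_to_const[OF zero_closed] converges_to_unique by metis
qed

lemma mult_dense_cancel: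
  assumes "dense_in A D" "u \<in> carrier A" "v \<in> carrier A" "\<And>d. d \<in> D \<Longrightarrow> u \<otimes> d = v \<otimes> d"
  shows "u = v"
proof -
  have D: "D \<subseteq> carrier A"
    using assms(1) by (simp add: dense_in_def)
  have "(u \<ominus> v) \<otimes> d = \<zero>" if "d \<in> D" for d
  proof -
    have "d \<in> carrier A"
      using D that by blast
    then show ?thesis
      using assms(4)[OF that] assms(2,3) by (simp add: mult_diff_left)
  qed
  then have "u \<ominus> v = \<zero>"
    using mult_dense_eq_zeroD[OF assms(1)] assms(2,3) by simp
  then show ?thesis
    using assms(2,3) diff_eq_zero_iff by simp
qed

lemma dense_in_carrier: "dense_in A (carrier A)"
  unfolding dense_in_iff
proof (intro conjI ballI)
  fix x assume "x \<in> carrier A"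
  then show "\<exists>s. range s \<subseteq> carrier A \<and> converges_to A s x"
    using converges_to_const[of x] by (intro exI[of _ "\<lambda>n. x"]) auto
qed simp

lemma mult_cancel:
  assumes "u \<in> carrier A" "v \<in> carrier A" "\<And>x. x \<in> carrier A \<Longrightarrow> u \<otimes> x = v \<otimes> x"
  shows "u = v"
  using mult_dense_cancel[OF dense_in_carrier assms] .

lemma multiplier_mult_right:
  assumes "r \<in> multipliers A" "x \<in> carrier A" "y \<in> carrier A"
  shows "r (x \<otimes> y) = x \<otimes> r y"
proof -
  note r = multipliersD[OF assms(1)]
  show ?thesis
    using r(5)[OF assms(3,2)] assms r(1) by (simp add: mult_commute)
qed

text \<open>Against a test factor y, each of the two multipliers can be moved from one factor to the
  other. This exchanges their order, and y is then cancelled.\<close>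

lemma multipliers_commute:
  assumes "r \<in> multipliers A" "r' \<in> multipliers A" "x \<in> carrier A"
  shows "r (r' x) = r' (r x)"
proof (rule mult_cancel)
  note r = multipliersD[OF assms(1)] and r' = multipliersD[OF assms(2)]
  show "r (r' x) \<in> carrier A" "r' (r x) \<in> carrier A"
    using r(1) r'(1) assms(3) by auto
  fix y assume y: "y \<in> carrier A"
  have "r (r' x) \<otimes> y = r (r' x \<otimes> y)"
    using r(5) r'(1) assms(3) y by simp
  also have "\<dots> = r (x \<otimes> r' y)"
    using r'(5) assms multiplier_mult_right[OF assms(2,3) y] y by simp
  also have "\<dots> = r x \<otimes> r' y"
    using r(5) r'(1) assms(3) y by simp
  also have "\<dots> = r' (r x \<otimes> y)"
    using multiplier_mult_right[OF assms(2)] r(1) assms(3) y by simp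
  also have "\<dots> = r' (r x) \<otimes> y"
    using r'(5) r(1) assms(3) y by simp
  finally show "r (r' x) \<otimes> y = r' (r x) \<otimes> y" .
qed

end


section \<open>Algebras of elements with bounded orbit\<close>

text \<open>The functional \<open>p\<close> is kept apart from the norm of \<open>w i u\<close>
  because the two given algebras express it differently. The index \<open>i0\<close> is that of the
  identity; it makes \<open>nrm L\<close> dominate \<open>nrm A\<close>. \<open>L\<close> is a
  parameter subject to an equation so that the given records can be matched with it.\<close>

locale orbit_algebra = banach_algebra A for A :: "'a normed_alg" (structure) +
  fixes I :: "'i set" and p :: "'i \<Rightarrow> 'a \<Rightarrow> real" and w :: "'i \<Rightarrow> 'a \<Rightarrow> 'a" and i0 :: 'i
    and L :: "'a normed_alg"
  assumes family: "i \<in> I \<Longrightarrow> w i \<in> multipliers A"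
    and p_eq: "\<lbrakk>i \<in> I; u \<in> carrier A\<rbrakk> \<Longrightarrow> p i u = nrm A (w i u)"
    and i0: "i0 \<in> I" "u \<in> carrier A \<Longrightarrow> p i0 u = nrm A u"
    and L_def: "L = A\<lparr>carrier := {u \<in> carrier A. bdd_above ((\<lambda>i. p i u) ` I)},
      nrm := (\<lambda>u. SUP i\<in>I. p i u)\<rparr>"
begin

lemma L_sel [simp]:
  "(\<otimes>\<^bsub>L\<^esub>) = (\<otimes>)" "(\<oplus>\<^bsub>L\<^esub>) = (\<oplus>)" "(\<odot>\<^bsub>L\<^esub>) = (\<odot>)" "\<zero>\<^bsub>L\<^esub> = \<zero>"
  by (simp_all add: L_def)

lemma in_L_iff: "u \<in> carrier L \<longleftrightarrow> u \<in> carrier A \<and> bdd_above ((\<lambda>i. p i u) ` I)"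
  by (simp add: L_def)

lemma nrm_L: "nrm L u = (SUP i\<in>I. p i u)"
  by (simp add: L_def)

lemma L_subset: "carrier L \<subseteq> carrier A"
  by (auto simp: in_L_iff)

lemma L_carrier [simp]: "u \<in> carrier L \<Longrightarrow> u \<in> carrier A"
  by (simp add: in_L_iff)

lemma p_le_nrm_L: "\<lbrakk>u \<in> carrier L; i \<in> I\<rbrakk> \<Longrightarrow> p i u \<le> nrm L u"
  unfolding nrm_L by (intro cSUP_upper) (auto simp: in_L_iff)

lemma in_L_I:
  assumes "u \<in> carrier A" "\<And>i. i \<in> I \<Longrightarrow> p i u \<le> K"
  shows "u \<in> carrier L" "nrm L u \<le> K"
proof -
  show "u \<in> carrier L"
    using assms by (auto simp: in_L_iff intro: bdd_aboveI2[where M = K])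
  show "nrm L u \<le> K"
    unfolding nrm_L using i0(1) assms(2) by (intro cSUP_least) auto
qed

lemma nrm_le_nrm_L: "u \<in> carrier L \<Longrightarrow> nrm A u \<le> nrm L u"
  using p_le_nrm_L[OF _ i0(1)] i0(2) by simp

lemma family_closed: "\<lbrakk>i \<in> I; u \<in> carrier A\<rbrakk> \<Longrightarrow> w i u \<in> carrier A"
  by (rule multipliersD(1)[OF family])

text \<open>A multiplier acts on the first factor only, so orbits of a product stay bounded whatever
  the second factor is. The estimate with the weaker norm on \<open>v\<close> implies
  submultiplicativity of \<open>nrm L\<close>.\<close>

lemma L_ideal:
  assumes "u \<in> carrier L" "v \<in> carrier A"
  shows "u \<otimes> v \<in> carrier L" "nrm L (u \<otimes> v) \<le> nrm L u * nrm A v"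
proof -
  have "p i (u \<otimes> v) \<le> nrm L u * nrm A v" if i: "i \<in> I" for i
  proof -
    have "p i (u \<otimes> v) = nrm A (w i u \<otimes> v)"
      using multipliersD(5)[OF family[OF i]] p_eq[OF i] assms by simp
    also have "\<dots> \<le> nrm A (w i u) * nrm A v"
      using nrm_mult family_closed i assms by simp
    also have "\<dots> \<le> nrm L u * nrm A v"
      using p_le_nrm_L[OF assms(1) i] p_eq[OF i] assms by (intro mult_right_mono) (auto simp: nrm_nonneg)
    finally show ?thesis .
  qed
  then show "u \<otimes> v \<in> carrier L" "nrm L (u \<otimes> v) \<le> nrm L u * nrm A v"
    using in_L_I[of "u \<otimes> v"] assms by auto
qed

lemma L_add:
  assumes "u \<in> carrier L" "v \<in> carrier L"
  shows "u \<oplus> v \<in> carrier L" "nrm L (u \<oplus> v) \<le> nrm L u + nrm L v"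
proof -
  have "p i (u \<oplus> v) \<le> nrm L u + nrm L v" if i: "i \<in> I" for i
  proof -
    have "p i (u \<oplus> v) = nrm A (w i u \<oplus> w i v)"
      using multipliersD(3)[OF family[OF i]] p_eq[OF i] assms by simp
    also have "\<dots> \<le> nrm A (w i u) + nrm A (w i v)"
      using nrm_triangle family_closed i assms by simp
    also have "\<dots> \<le> nrm L u + nrm L v"
      using p_le_nrm_L[OF assms(1) i] p_le_nrm_L[OF assms(2) i] p_eq[OF i] assms by simp
    finally show ?thesis .
  qed
  then show "u \<oplus> v \<in> carrier L" "nrm L (u \<oplus> v) \<le> nrm L u + nrm L v"
    using in_L_I[of "u \<oplus> v"] assms by auto
qed

lemma L_scale:
  assumes "u \<in> carrier L"
  shows "c \<odot> u \<in> carrier L" "nrm L (c \<odot> u) = cmod c * nrm L u"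
proof -
  have *: "d \<odot> v \<in> carrier L \<and> nrm L (d \<odot> v) \<le> cmod d * nrm L v" if v: "v \<in> carrier L" for d v
  proof -
    have "p i (d \<odot> v) \<le> cmod d * nrm L v" if i: "i \<in> I" for i
      using multipliersD(4)[OF family[OF i]] p_eq[OF i] v family_closed[OF i] p_le_nrm_L[OF v i]
      by (simp add: nrm_smult mult_left_mono)
    then show ?thesis
      using in_L_I[of "d \<odot> v"] v by auto
  qed
  show c: "c \<odot> u \<in> carrier L"
    using * assms by blast
  show "nrm L (c \<odot> u) = cmod c * nrm L u"
  proof (cases "c = 0")
    case True
    then show ?thesis
      using *[OF assms, of c] nrm_le_nrm_L[OF c] nrm_nonneg[of "c \<odot> u"] assms by simp
  next
    case False
    then have "nrm L u \<le> cmod (inverse c) * nrm L (c \<odot> u)"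
      using *[OF c, of "inverse c"] assms by (simp flip: scale_assoc)
    then have "cmod c * nrm L u \<le> nrm L (c \<odot> u)"
      using False by (simp add: norm_inverse norm_divide field_simps)
    then show ?thesis
      using *[OF assms, of c] by linarith
  qed
qed

lemma zero_in_L: "\<zero> \<in> carrier L" "nrm L \<zero> = 0"
proof -
  have "p i \<zero> = 0" if "i \<in> I" for i
    using multiplier_zero[OF family[OF that]] p_eq[OF that] by simp
  then show z: "\<zero> \<in> carrier L" "nrm L \<zero> = 0"
    using in_L_I[of \<zero> 0] nrm_le_nrm_L[of \<zero>] by auto
qed

lemma normed_algebra_L: "normed_algebra L"
proof -
  have nonneg: "0 \<le> nrm L u" if "u \<in> carrier L" for u
    using nrm_le_nrm_L[OF that] nrm_nonneg[of u] that by simp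
  have "normed_algebra (A\<lparr>carrier := carrier L, nrm := nrm L\<rparr>)"
  proof (rule normed_subalgebra)
    show "nrm L x = 0 \<longleftrightarrow> x = \<zero>" if "x \<in> carrier L" for x
      using nrm_le_nrm_L[OF that] nrm_nonneg[of x] nrm_eq_0_iff[of x] zero_in_L that by auto
    show "x \<otimes> y \<in> carrier L" if "x \<in> carrier L" "y \<in> carrier L" for x y
      using L_ideal that by simp
    show "nrm L (x \<otimes> y) \<le> nrm L x * nrm L y" if "x \<in> carrier L" "y \<in> carrier L" for x y
      using L_ideal(2)[of x y] that nrm_le_nrm_L[of y] nonneg[of x]
      by (meson L_carrier mult_left_mono order_trans)
  qed (fact L_subset zero_in_L(1) L_add L_scale nonneg)+
  moreover have "A\<lparr>carrier := carrier L, nrm := nrm L\<rparr> = L"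
    unfolding L_def by simp
  ultimately show ?thesis
    by simp
qed

lemma L_diff: "\<lbrakk>x \<in> carrier L; y \<in> carrier L\<rbrakk> \<Longrightarrow> x \<ominus>\<^bsub>L\<^esub> y = x \<ominus> y"
  using normed_algebra.diff_eq_scale[OF normed_algebra_L, of y x] by (simp add: diff_eq_scale)

text \<open>The norm of \<open>L\<close> dominates that of \<open>A\<close>, so a Cauchy sequence
  has a limit in \<open>A\<close>. Each \<open>w i\<close> is continuous and the Cauchy estimate is
  uniform in \<open>i\<close>, so it survives the passage to this limit.\<close>

lemma banach_algebra_L: "banach_algebra L"
proof (rule banach_algebraI[OF normed_algebra_L])
  interpret L: normed_algebra L
    by (rule normed_algebra_L)
  fix s :: "nat \<Rightarrow> 'a" assume s: "range s \<subseteq> carrier L"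
    and cauchy: "\<forall>e>0. \<exists>N. \<forall>m\<ge>N. \<forall>n\<ge>N. nrm L (s m \<ominus>\<^bsub>L\<^esub> s n) < e"
  have sL: "s n \<in> carrier L" for n
    using s by auto
  then have sA: "s n \<in> carrier A" for n
    by simp
  have p_diff: "p i (x \<ominus> y) = nrm A (w i x \<ominus> w i y)"
    if "i \<in> I" "x \<in> carrier A" "y \<in> carrier A" for i x y
    using that p_eq multiplier_diff[OF family] by simp
  have "\<exists>x. converges_to A s x"
  proof (intro cauchy_converges_to allI impI)
    fix e :: real assume "0 < e"
    then obtain N where N: "\<forall>m\<ge>N. \<forall>n\<ge>N. nrm L (s m \<ominus>\<^bsub>L\<^esub> s n) < e"
      using cauchy by blast
    have "nrm A (s m \<ominus> s n) \<le> nrm L (s m \<ominus>\<^bsub>L\<^esub> s n)" for m n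
      using nrm_le_nrm_L[of "s m \<ominus>\<^bsub>L\<^esub> s n"] sL L.diff_closed L_diff by simp
    then show "\<exists>N. \<forall>m\<ge>N. \<forall>n\<ge>N. nrm A (s m \<ominus> s n) < e"
      using N order_le_less_trans by blast
  qed (use sA in auto)
  then obtain x where x: "converges_to A s x" ..
  note xA = converges_toD(2)[OF x]
  have bound: "\<exists>N. \<forall>n\<ge>N. \<forall>i\<in>I. p i (x \<ominus> s n) \<le> e" if "0 < e" for e
  proof -
    obtain N where N: "\<forall>m\<ge>N. \<forall>n\<ge>N. nrm L (s m \<ominus>\<^bsub>L\<^esub> s n) < e"
      using cauchy \<open>0 < e\<close> by blast
    have "p i (x \<ominus> s n) \<le> e" if i: "i \<in> I" and n: "N \<le> n" for i n
    proof -
      have "nrm A (w i (s m) \<ominus> w i (s n)) \<le> e" if "N \<le> m" for m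
      proof -
        have "p i (s m \<ominus>\<^bsub>L\<^esub> s n) \<le> nrm L (s m \<ominus>\<^bsub>L\<^esub> s n)"
          by (rule p_le_nrm_L[OF _ i]) (simp add: sL L.diff_closed)
        also have "\<dots> \<le> e"
          using N n that by (simp add: less_imp_le)
        finally show ?thesis
          by (simp add: p_diff i sA sL L_diff)
      qed
      then have "\<forall>\<^sub>F m in sequentially. nrm A (w i (s m) \<ominus> w i (s n)) \<le> e"
        unfolding eventually_sequentially by blast
      then have "nrm A (w i x \<ominus> w i (s n)) \<le> e"
        by (rule nrm_limit_diff_le[OF multiplier_converges_to[OF family[OF i] x] family_closed[OF i sA]])
      then show ?thesis
        using p_diff i xA sA by simp
    qed
    then show ?thesis
      by blast
  qed
  \<comment> \<open>The limit belongs to \<open>L\<close> because it differs from one term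
    \<open>s N\<close> by an element with bounded orbit.\<close>
  obtain N where N: "\<forall>n\<ge>N. \<forall>i\<in>I. p i (x \<ominus> s n) \<le> 1"
    using bound[of 1] by auto
  then have "x \<ominus> s N \<in> carrier L"
    using in_L_I(1)[of "x \<ominus> s N" 1] xA sA by simp
  then have "s N \<oplus> (x \<ominus> s N) \<in> carrier L"
    using L_add(1) sL by blast
  then have xL: "x \<in> carrier L"
    using add_diff_cancel xA sA by simp
  have "(\<lambda>n. nrm L (s n \<ominus>\<^bsub>L\<^esub> x)) \<longlonglongrightarrow> 0"
  proof (rule LIMSEQ_I)
    fix e :: real assume "0 < e"
    then obtain N where N: "\<forall>n\<ge>N. \<forall>i\<in>I. p i (x \<ominus> s n) \<le> e / 2"
      using bound[of "e / 2"] by auto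
    have "norm (nrm L (s n \<ominus>\<^bsub>L\<^esub> x) - 0) < e" if "N \<le> n" for n
    proof -
      have "nrm L (x \<ominus>\<^bsub>L\<^esub> s n) \<le> e / 2"
        using N that in_L_I(2)[of "x \<ominus> s n" "e / 2"] xA sA by (simp add: L_diff xL sL)
      then show ?thesis
        using L.nrm_nonneg[of "s n \<ominus>\<^bsub>L\<^esub> x"] L.nrm_diff_commute[of "s n" x] xL sL
          L.diff_closed[of "s n" x] \<open>0 < e\<close> by simp
    qed
    then show "\<exists>N. \<forall>n\<ge>N. norm (nrm L (s n \<ominus>\<^bsub>L\<^esub> x) - 0) < e"
      by blast
  qed
  then show "\<exists>x. converges_to L s x"
    using s xL by (auto simp: converges_to_def)
qed

end

section \<open>Normalization\<close>

text \<open>Density of \<open>L\<close> is what makes the action of \<open>A\<close> on it faithful,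
  so that \<open>A\<close> embeds in the closure \<open>C\<close>.\<close>

locale normalization = orbit_algebra A I p w i0 L + wc_algebra A
  for A :: "'a normed_alg" (structure) and I :: "'i set" and p w i0 L +
  fixes C :: "('a \<Rightarrow> 'a) normed_alg"
  assumes L_dense: "dense_in A (carrier L)"
    and C_def: "C = (mult_alg L)\<lparr>carrier := alg_top (mult_alg L) closure_of (mult_op L ` carrier A)\<rparr>"
begin


lemma cancel_on_L:
  assumes "u \<in> carrier A" "v \<in> carrier A" "\<And>x. x \<in> carrier L \<Longrightarrow> u \<otimes> x = v \<otimes> x"
  shows "u = v"
  by (rule mult_dense_cancel[OF L_dense assms])

text \<open>Multipliers commute: \<open>p i (r u)\<close> is the norm of \<open>r (w i u)\<close>,
  which is controlled by the orbit of \<open>u\<close>.\<close>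

lemma multiplier_L:
  assumes "r \<in> multipliers A" "u \<in> carrier L"
  shows "r u \<in> carrier L" "nrm L (r u) \<le> nrm (mult_alg A) r * nrm L u"
proof -
  have uA: "u \<in> carrier A"
    using assms(2) by simp
  have "p i (r u) \<le> nrm (mult_alg A) r * nrm L u" if i: "i \<in> I" for i
  proof -
    have "p i (r u) = nrm A (r (w i u))"
      using p_eq[OF i multipliersD(1)[OF assms(1) uA]] multipliers_commute[OF assms(1) family[OF i] uA]
      by simp
    also have "\<dots> \<le> nrm (mult_alg A) r * nrm A (w i u)"
      by (rule nrm_multiplier[OF assms(1) family_closed[OF i uA]])
    also have "\<dots> \<le> nrm (mult_alg A) r * nrm L u"
      using p_le_nrm_L[OF assms(2) i] p_eq[OF i uA]
      by (intro mult_left_mono nrm_mult_alg_nonneg assms(1)) simp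
    finally show ?thesis .
  qed
  then show "r u \<in> carrier L" "nrm L (r u) \<le> nrm (mult_alg A) r * nrm L u"
    using in_L_I[of "r u"] multipliersD(1)[OF assms(1) uA] by auto
qed

sublocale L: banach_algebra L
  by (rule banach_algebra_L)

sublocale OpL: banach_algebra "mult_alg L"
  by (rule L.banach_algebra_mult_alg)

lemma wc_L: "weakly_cancellative L"
proof (rule weakly_cancellativeI[OF banach_algebra_L])
  show "x \<otimes>\<^bsub>L\<^esub> y = y \<otimes>\<^bsub>L\<^esub> x" if "x \<in> carrier L" "y \<in> carrier L" for x y
    using mult_commute that by simp
  have 1: "u = \<zero>\<^bsub>L\<^esub>" if u: "u \<in> carrier A" "\<And>x. x \<in> carrier L \<Longrightarrow> u \<otimes>\<^bsub>L\<^esub> x = \<zero>\<^bsub>L\<^esub>" for u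
    using cancel_on_L[OF u(1) zero_closed] u(2) by simp
  then show "u = \<zero>\<^bsub>L\<^esub>"
    if "u \<in> carrier L" "\<And>x. x \<in> carrier L \<Longrightarrow> u \<otimes>\<^bsub>L\<^esub> x = \<zero>\<^bsub>L\<^esub>" for u
    using that by simp
  show "\<exists>x\<in>carrier L. x \<noteq> \<zero>\<^bsub>L\<^esub>"
  proof (rule ccontr)
    assume "\<not> (\<exists>x\<in>carrier L. x \<noteq> \<zero>\<^bsub>L\<^esub>)"
    then have "x = \<zero>" if "x \<in> carrier L" for x
      using that by simp
    then have "u = \<zero>" if "u \<in> carrier A" for u
      using 1[OF that] that by fastforce
    then show False
      using weakly_cancellativeD(4)[OF wc] by blast
  qed
qed

sublocale L: wc_algebra L
  by (rule wc_algebraI[OF wc_L])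

lemma restrict_multiplier:
  assumes "r \<in> multipliers A"
  shows "restrict r (carrier L) \<in> multipliers L"
    "nrm (mult_alg L) (restrict r (carrier L)) \<le> nrm (mult_alg A) r"
proof -
  note r = multipliersD[OF assms]
  show "restrict r (carrier L) \<in> multipliers L"
  proof (rule multipliersI[where K = "nrm (mult_alg A) r"])
    show "restrict r (carrier L) (x \<oplus>\<^bsub>L\<^esub> y) = restrict r (carrier L) x \<oplus>\<^bsub>L\<^esub> restrict r (carrier L) y"
      if "x \<in> carrier L" "y \<in> carrier L" for x y
      using that r(3)[of x y] L_add(1)[of x y] by simp
    show "restrict r (carrier L) (c \<odot>\<^bsub>L\<^esub> x) = c \<odot>\<^bsub>L\<^esub> restrict r (carrier L) x"
      if "x \<in> carrier L" for x c
      using that r(4)[of x c] L_scale(1)[of x c] by simp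
    show "restrict r (carrier L) (x \<otimes>\<^bsub>L\<^esub> y) = restrict r (carrier L) x \<otimes>\<^bsub>L\<^esub> y"
      if "x \<in> carrier L" "y \<in> carrier L" for x y
      using that r(5)[of x y] L_ideal(1)[of x y] by simp
  qed (use multiplier_L[OF assms] in auto)
  show "nrm (mult_alg L) (restrict r (carrier L)) \<le> nrm (mult_alg A) r"
    by (rule L.nrm_mult_alg_leI) (use multiplier_L(2)[OF assms] nrm_mult_alg_nonneg[OF assms] in auto)
qed

text \<open>This is the gain from passing to \<open>L\<close>. If \<open>r\<close> merely moves the
  family to another index at the cost of a factor \<open>c\<close>, its norm on \<open>L\<close> is
  at most \<open>c\<close>, however large its norm on \<open>A\<close> may be.\<close>

lemma nrm_restrict_multiplier_le:
  assumes "r \<in> multipliers A" "0 \<le> c"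
    and "\<And>i. i \<in> I \<Longrightarrow> \<exists>k\<in>I. \<forall>u\<in>carrier L. p i (r u) \<le> c * p k u"
  shows "nrm (mult_alg L) (restrict r (carrier L)) \<le> c"
proof (rule L.nrm_mult_alg_leI[OF _ assms(2)])
  fix u assume u: "u \<in> carrier L"
  have "p i (r u) \<le> c * nrm L u" if i: "i \<in> I" for i
  proof -
    obtain k where k: "k \<in> I" "p i (r u) \<le> c * p k u"
      using assms(3)[OF i] u by blast
    then show ?thesis
      using mult_left_mono[OF p_le_nrm_L[OF u k(1)] assms(2)] by simp
  qed
  then show "nrm L (restrict r (carrier L) u) \<le> c * nrm L u"
    using in_L_I(2)[of "r u"] multipliersD(1)[OF assms(1)] u by simp
qed

lemma mult_op_L_eq: "mult_op L u = restrict (mult_op A u) (carrier L)"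
  by (auto simp: mult_op_def restrict_def fun_eq_iff)

lemma mult_op_L_apply: "x \<in> carrier L \<Longrightarrow> mult_op L u x = u \<otimes> x"
  by (simp add: mult_op_def)

lemma mult_op_L:
  assumes "u \<in> carrier A"
  shows "mult_op L u \<in> multipliers L" "nrm (mult_alg L) (mult_op L u) \<le> nrm A u"
  unfolding mult_op_L_eq
  using restrict_multiplier[OF mult_op_multiplier(1)[OF assms]] mult_op_multiplier(2)[OF assms]
  by simp_all

lemma mult_op_L_hom:
  shows "\<lbrakk>u \<in> carrier A; v \<in> carrier A\<rbrakk>
      \<Longrightarrow> mult_op L (u \<oplus> v) = mult_op L u \<oplus>\<^bsub>mult_alg L\<^esub> mult_op L v"
    and "u \<in> carrier A \<Longrightarrow> mult_op L (c \<odot> u) = c \<odot>\<^bsub>mult_alg L\<^esub> mult_op L u"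
    and "\<lbrakk>u \<in> carrier A; v \<in> carrier A\<rbrakk>
      \<Longrightarrow> mult_op L (u \<otimes> v) = mult_op L u \<otimes>\<^bsub>mult_alg L\<^esub> mult_op L v"
    and "mult_op L \<zero> = \<zero>\<^bsub>mult_alg L\<^esub>"
proof -
  have ideal: "v \<otimes> x \<in> carrier L" if "x \<in> carrier L" "v \<in> carrier A" for x v
    using L_ideal(1)[OF that] mult_commute[of x v] that by simp
  assume u: "u \<in> carrier A"
  show "mult_op L (c \<odot> u) = c \<odot>\<^bsub>mult_alg L\<^esub> mult_op L u"
    unfolding mult_alg_sel mult_op_def
    by (rule restrict_ext) (use u in \<open>simp add: smult_mult_l\<close>)
  assume v: "v \<in> carrier A"
  show "mult_op L (u \<oplus> v) = mult_op L u \<oplus>\<^bsub>mult_alg L\<^esub> mult_op L v"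
    unfolding mult_alg_sel mult_op_def
    by (rule restrict_ext) (use u v in \<open>simp add: distrib_l\<close>)
  show "mult_op L (u \<otimes> v) = mult_op L u \<otimes>\<^bsub>mult_alg L\<^esub> mult_op L v"
    unfolding mult_alg_sel mult_op_def compose_def
    by (rule restrict_ext) (use u v ideal in \<open>simp add: mult_assoc\<close>)
next
  show "mult_op L \<zero> = \<zero>\<^bsub>mult_alg L\<^esub>"
    unfolding mult_alg_sel mult_op_def
    by (rule restrict_ext) simp
qed

lemma mult_op_L_inj: "inj_on (mult_op L) (carrier A)"
proof (rule inj_onI)
  fix u v assume "u \<in> carrier A" "v \<in> carrier A" "mult_op L u = mult_op L v"
  then show "u = v"
    using cancel_on_L[of u v] mult_op_L_apply by metis
qed

lemma mult_multiplier_L: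
  assumes "b \<in> multipliers L" "x \<in> carrier L"
  shows "compose (carrier L) (mult_op L x) b = mult_op L (b x)"
    "compose (carrier L) b (mult_op L x) = mult_op L (b x)"
proof -
  note b = multipliersD[OF assms(1)]
  have "x \<otimes> b y = b x \<otimes> y" "b (x \<otimes> y) = b x \<otimes> y" if y: "y \<in> carrier L" for y
    using L.multiplier_mult_right[OF assms(1,2) y] b(5)[OF assms(2) y] by simp_all
  then show "compose (carrier L) (mult_op L x) b = mult_op L (b x)"
    "compose (carrier L) b (mult_op L x) = mult_op L (b x)"
    using b(1) by (simp_all add: compose_def mult_op_def fun_eq_iff restrict_def)
qed

lemma C_sel [simp]:
  "(\<otimes>\<^bsub>C\<^esub>) = (\<otimes>\<^bsub>mult_alg L\<^esub>)" "(\<oplus>\<^bsub>C\<^esub>) = (\<oplus>\<^bsub>mult_alg L\<^esub>)" "(\<odot>\<^bsub>C\<^esub>) = (\<odot>\<^bsub>mult_alg L\<^esub>)"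
  "\<zero>\<^bsub>C\<^esub> = \<zero>\<^bsub>mult_alg L\<^esub>" "nrm C = nrm (mult_alg L)"
  by (simp_all add: C_def)

lemma carrier_C: "carrier C = alg_top (mult_alg L) closure_of (mult_op L ` carrier A)"
  by (simp add: C_def)

lemma mult_op_L_subset: "mult_op L ` carrier A \<subseteq> carrier (mult_alg L)"
  using mult_op_L(1) by auto

lemma C_subset: "carrier C \<subseteq> multipliers L"
  using OpL.closure_of_subset_carrier unfolding carrier_C by simp

lemma C_multiplier [simp]: "b \<in> carrier C \<Longrightarrow> b \<in> multipliers L"
  using C_subset by blast

lemma mult_op_in_C: "u \<in> carrier A \<Longrightarrow> mult_op L u \<in> carrier C"
  unfolding carrier_C using OpL.closure_of_incl[OF mult_op_L_subset] by blast

lemma banach_algebra_C: "banach_algebra C"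
  unfolding C_def
proof (rule closure_banach_algebra)
  show "banach_algebra (mult_alg L)"
    by (rule L.banach_algebra_mult_alg)
  show "mult_op L ` carrier A \<subseteq> carrier (mult_alg L)"
    by (rule mult_op_L_subset)
  show "\<zero>\<^bsub>mult_alg L\<^esub> \<in> mult_op L ` carrier A"
    using mult_op_L_hom(4) zero_closed by (metis image_eqI)
next
  fix x y c assume "x \<in> mult_op L ` carrier A"
  then obtain u where u: "u \<in> carrier A" "x = mult_op L u"
    by blast
  show "c \<odot>\<^bsub>mult_alg L\<^esub> x \<in> mult_op L ` carrier A"
    unfolding u(2) mult_op_L_hom(2)[OF u(1), symmetric] using u(1) by (intro imageI) simp
  assume "y \<in> mult_op L ` carrier A"
  then obtain v where v: "v \<in> carrier A" "y = mult_op L v"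
    by blast
  show "x \<oplus>\<^bsub>mult_alg L\<^esub> y \<in> mult_op L ` carrier A"
    unfolding u(2) v(2) mult_op_L_hom(1)[OF u(1) v(1), symmetric] using u(1) v(1) by (intro imageI) simp
  show "x \<otimes>\<^bsub>mult_alg L\<^esub> y \<in> mult_op L ` carrier A"
    unfolding u(2) v(2) mult_op_L_hom(3)[OF u(1) v(1), symmetric] using u(1) v(1) by (intro imageI) simp
qed

sublocale C: banach_algebra C
  by (rule banach_algebra_C)

lemma C_diff: "\<lbrakk>x \<in> carrier C; y \<in> carrier C\<rbrakk> \<Longrightarrow> x \<ominus>\<^bsub>C\<^esub> y = x \<ominus>\<^bsub>mult_alg L\<^esub> y"
  using C.diff_eq_scale[of y x] OpL.diff_eq_scale[of y x] by simp

lemma converges_to_C_iff: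
  assumes "range s \<subseteq> carrier C" "x \<in> carrier C"
  shows "converges_to C s x \<longleftrightarrow> converges_to (mult_alg L) s x"
proof -
  have "s n \<ominus>\<^bsub>C\<^esub> x = s n \<ominus>\<^bsub>mult_alg L\<^esub> x" for n
    using assms by (intro C_diff) auto
  then show ?thesis
    using assms C_subset by (auto simp: converges_to_def)
qed

lemma mult_op_bounded_linear_map: "bounded_linear_map A C (mult_op L) 1"
  unfolding bounded_linear_map_def
  using mult_op_in_C mult_op_L_hom(1,2) mult_op_L(2) by auto

lemma mult_op_L_dense: "dense_in C (mult_op L ` carrier A)"
  unfolding C.dense_in_iff
proof (intro conjI ballI)
  show "mult_op L ` carrier A \<subseteq> carrier C"
    using mult_op_in_C by blast
  fix b assume b: "b \<in> carrier C"
  then obtain s where s: "range s \<subseteq> mult_op L ` carrier A" "converges_to (mult_alg L) s b"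
    unfolding carrier_C OpL.in_closure_of_iff by blast
  have "range s \<subseteq> carrier C"
    using s(1) mult_op_in_C by auto
  then show "\<exists>s. range s \<subseteq> mult_op L ` carrier A \<and> converges_to C s b"
    using s converges_to_C_iff b by blast
qed

text \<open>The norm estimate, used once in each normalization, is the source of the constant
  \<open>M\<close> of \<open>qm_embedding\<close>.\<close>

lemma mult_op_L_compose_C:
  assumes "b \<in> carrier C" "x \<in> carrier L"
  shows "mult_op L x \<otimes>\<^bsub>C\<^esub> b = mult_op L (b x)" "nrm A (b x) \<le> nrm C b * nrm L x" "b x \<in> carrier L"
proof -
  show "mult_op L x \<otimes>\<^bsub>C\<^esub> b = mult_op L (b x)"
    using mult_multiplier_L(1)[OF C_multiplier[OF assms(1)] assms(2)] by simp
  show bx: "b x \<in> carrier L"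
    by (rule multipliersD(1)[OF C_multiplier[OF assms(1)] assms(2)])
  show "nrm A (b x) \<le> nrm C b * nrm L x"
    using nrm_le_nrm_L[OF bx] L.nrm_multiplier[OF C_multiplier[OF assms(1)] assms(2)] by simp
qed

lemma wc_C: "weakly_cancellative C"
proof (rule weakly_cancellativeI[OF banach_algebra_C])
  have commute: "compose (carrier L) x y = compose (carrier L) y x"
    if "x \<in> multipliers L" "y \<in> multipliers L" for x y
    unfolding compose_def by (rule restrict_ext) (rule L.multipliers_commute[OF that])
  then show "x \<otimes>\<^bsub>C\<^esub> y = y \<otimes>\<^bsub>C\<^esub> x" if "x \<in> carrier C" "y \<in> carrier C" for x y
    using that by simp
  obtain u where u: "u \<in> carrier A" "u \<noteq> \<zero>"
    using weakly_cancellativeD(4)[OF wc] by blast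
  then have "mult_op L u \<noteq> \<zero>\<^bsub>C\<^esub>"
    using inj_onD[OF mult_op_L_inj _ u(1) zero_closed] mult_op_L_hom(4) by auto
  then show "\<exists>x\<in>carrier C. x \<noteq> \<zero>\<^bsub>C\<^esub>"
    using mult_op_in_C[OF u(1)] by blast
  fix b assume b: "b \<in> carrier C" and 0: "\<And>x. x \<in> carrier C \<Longrightarrow> b \<otimes>\<^bsub>C\<^esub> x = \<zero>\<^bsub>C\<^esub>"
  \<comment> \<open>It suffices to test \<open>b\<close> on images of elements of \<open>L\<close>:
    there the product is the image of \<open>b x\<close>, and the embedding is injective.\<close>
  have "b x = \<zero>\<^bsub>L\<^esub>" if x: "x \<in> carrier L" for x
  proof -
    have "mult_op L (b x) = b \<otimes>\<^bsub>C\<^esub> mult_op L x"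
      using mult_multiplier_L(2)[OF C_multiplier[OF b] x] by simp
    also have "\<dots> = mult_op L \<zero>"
      using 0[OF mult_op_in_C[of x]] x mult_op_L_hom(4) by simp
    finally show ?thesis
      using inj_onD[OF mult_op_L_inj, of "b x" \<zero>] mult_op_L_compose_C(3)[OF b x] by simp
  qed
  then show "b = \<zero>\<^bsub>C\<^esub>"
    using multipliers_eqI[OF C_multiplier[OF b] L.multipliers_zero] by simp
qed

sublocale C: wc_algebra C
  by (rule wc_algebraI[OF wc_C])

lemma restrict_compose_mult_op:
  assumes "r \<in> multipliers A" "u \<in> carrier A"
  shows "compose (carrier L) (restrict r (carrier L)) (mult_op L u) = mult_op L (r u)"
  unfolding compose_def mult_op_def
proof (rule restrict_ext)
  fix x assume x: "x \<in> carrier L"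
  have "u \<otimes> x \<in> carrier L"
    using L_ideal(1)[OF x assms(2)] mult_commute[of x u] x assms(2) by simp
  then show "restrict r (carrier L) ((\<lambda>x\<in>carrier L. u \<otimes>\<^bsub>L\<^esub> x) x) = r u \<otimes>\<^bsub>L\<^esub> x"
    using multipliersD(5)[OF assms(1,2), of x] x by simp
qed

lemma mult_op_C_multiplier:
  assumes r: "r \<in> multipliers A"
  defines "r' \<equiv> restrict r (carrier L)"
  shows "mult_op C r' \<in> multipliers C"
    "nrm (mult_alg C) (mult_op C r') \<le> nrm (mult_alg L) r'"
    "nrm (mult_alg C) (mult_op C r') \<le> nrm (mult_alg A) r"
    "u \<in> carrier A \<Longrightarrow> mult_op C r' (mult_op L u) = mult_op L (r u)"
proof -
  have r': "r' \<in> multipliers L"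
    using restrict_multiplier(1)[OF r] by (simp add: r'_def)
  have image: "compose (carrier L) r' (mult_op L u) = mult_op L (r u)" if "u \<in> carrier A" for u
    using restrict_compose_mult_op[OF r that] by (simp add: r'_def)
  \<comment> \<open>Composition with \<open>r'\<close> is continuous and sends the image of
    \<open>u\<close> to the image of \<open>r u\<close>, so it preserves the closure of the image of
    \<open>A\<close>.\<close>
  have closed: "compose (carrier L) r' b \<in> carrier C" if b: "b \<in> carrier C" for b
  proof -
    obtain s where s: "range s \<subseteq> mult_op L ` carrier A" "converges_to (mult_alg L) s b"
      using b unfolding carrier_C OpL.in_closure_of_iff by blast
    have "compose (carrier L) r' (s n) \<in> mult_op L ` carrier A" for n
    proof -
      have "s n \<in> mult_op L ` carrier A"
        using s(1) by (rule range_subsetD)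
      then obtain u where u: "u \<in> carrier A" "s n = mult_op L u"
        by blast
      then show ?thesis
        using image[OF u(1)] multipliersD(1)[OF r u(1)] by simp
    qed
    moreover have "converges_to (mult_alg L) (\<lambda>n. compose (carrier L) r' (s n)) (compose (carrier L) r' b)"
      using OpL.converges_to_mult[OF OpL.converges_to_const[of r'] s(2)] r' by simp
    ultimately show ?thesis
      unfolding carrier_C by (rule OpL.closure_of_seqI)
  qed
  have bound: "nrm C (mult_op C r' b) \<le> nrm (mult_alg L) r' * nrm C b" if "b \<in> carrier C" for b
    using L.multipliers_compose(2)[OF r' C_multiplier[OF that]] that by (simp add: mult_op_def)
  show "mult_op C r' \<in> multipliers C"
  proof (rule multipliersI[where K = "nrm (mult_alg L) r'"])
    show "mult_op C r' x \<in> carrier C" if "x \<in> carrier C" for x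
      using closed[OF that] that by (simp add: mult_op_def)
    show "mult_op C r' (x \<oplus>\<^bsub>C\<^esub> y) = mult_op C r' x \<oplus>\<^bsub>C\<^esub> mult_op C r' y"
      if "x \<in> carrier C" "y \<in> carrier C" for x y
      using OpL.distrib_r[of r' x y] C.add_closed[OF that] r' that by (simp add: mult_op_def)
    show "mult_op C r' (c \<odot>\<^bsub>C\<^esub> x) = c \<odot>\<^bsub>C\<^esub> mult_op C r' x" if "x \<in> carrier C" for x c
      using OpL.smult_mult_r[of r' x c] C.scale_closed[OF that] r' that by (simp add: mult_op_def)
    show "mult_op C r' (x \<otimes>\<^bsub>C\<^esub> y) = mult_op C r' x \<otimes>\<^bsub>C\<^esub> y"
      if "x \<in> carrier C" "y \<in> carrier C" for x y
      using OpL.mult_assoc[of r' x y] C.mult_closed[OF that] r' that by (simp add: mult_op_def)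
    show "mult_op C r' \<in> extensional (carrier C)"
      by (simp add: mult_op_def)
  qed (fact bound)
  show 1: "nrm (mult_alg C) (mult_op C r') \<le> nrm (mult_alg L) r'"
    by (rule C.nrm_mult_alg_leI[OF bound L.nrm_mult_alg_nonneg[OF r']])
  show "nrm (mult_alg C) (mult_op C r') \<le> nrm (mult_alg A) r"
    using 1 restrict_multiplier(2)[OF r] by (simp add: r'_def)
  show "mult_op C r' (mult_op L u) = mult_op L (r u)" if "u \<in> carrier A"
    using image[OF that] mult_op_in_C[OF that] by (simp add: mult_op_def)
qed

end

section \<open>Quasimultipliers\<close>

context wc_algebra
begin

lemma normed: "normed_algebra A"
  by unfold_locales

lemma mult_left_commute:
  "\<lbrakk>x \<in> carrier A; y \<in> carrier A; z \<in> carrier A\<rbrakk> \<Longrightarrow> x \<otimes> (y \<otimes> z) = y \<otimes> (x \<otimes> z)"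
  by (metis mult_assoc mult_commute)

lemmas mult_ac = mult_assoc mult_commute mult_left_commute

lemma Omega_carrier [simp]: "v \<in> Omega A \<Longrightarrow> v \<in> carrier A"
  by (simp add: Omega_def)

text \<open>The elements \<open>x\<close> and \<open>y\<close> have the same products with the dense
  ideal generated by \<open>v\<close>.\<close>

lemma Omega_cancel:
  assumes "v \<in> Omega A" "x \<in> carrier A" "y \<in> carrier A" "v \<otimes> x = v \<otimes> y"
  shows "x = y"
proof (rule mult_dense_cancel[OF _ assms(2,3)])
  show "dense_in A ((\<lambda>x. v \<otimes> x) ` carrier A)"
    using assms(1) by (simp add: Omega_def del: Omega_carrier)
  fix d assume "d \<in> (\<lambda>x. v \<otimes> x) ` carrier A"
  then obtain z where z: "z \<in> carrier A" "d = v \<otimes> z"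
    by blast
  have "x \<otimes> d = (v \<otimes> x) \<otimes> z" "y \<otimes> d = (v \<otimes> y) \<otimes> z"
    using z assms(1-3) by (simp_all add: mult_ac)
  then show "x \<otimes> d = y \<otimes> d"
    using assms(4) by simp
qed

text \<open>The multiplier maps the dense ideal generated by \<open>v\<close> onto the ideal
  generated by \<open>r v\<close>, and dense range preserves density.\<close>

lemma dense_multiplier_Omega:
  assumes "r \<in> multipliers A" "dense_in A (r ` carrier A)" "v \<in> Omega A"
  shows "r v \<in> Omega A"
proof -
  have "dense_in A (r ` (\<lambda>x. v \<otimes> x) ` carrier A)"
    by (rule dense_in_image[OF normed normed multiplier_bounded_linear_map[OF assms(1)] _ assms(2)])
      (use assms(3) in \<open>simp add: Omega_def del: Omega_carrier\<close>)
  moreover have "r ` (\<lambda>x. v \<otimes> x) ` carrier A = (\<lambda>x. r v \<otimes> x) ` carrier A"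
    using multipliersD(5)[OF assms(1) Omega_carrier[OF assms(3)]]
    by (auto simp: image_image intro!: image_cong)
  ultimately show ?thesis
    using multipliersD(1)[OF assms(1) Omega_carrier[OF assms(3)]] by (simp add: Omega_def del: Omega_carrier)
qed

lemma Omega_mult:
  assumes "u \<in> Omega A" "v \<in> Omega A"
  shows "u \<otimes> v \<in> Omega A"
proof -
  have "mult_op A u ` carrier A = (\<lambda>x. u \<otimes> x) ` carrier A"
    by (intro image_cong) (auto simp: mult_op_def)
  then have "dense_in A (mult_op A u ` carrier A)"
    using assms(1) by (simp add: Omega_def del: Omega_carrier)
  then have "mult_op A u v \<in> Omega A"
    by (rule dense_multiplier_Omega[OF mult_op_multiplier(1)[OF Omega_carrier[OF assms(1)]] _ assms(2)])
  then show ?thesis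
    using assms(2) by (simp add: mult_op_def)
qed

text \<open>Replaces the description in \<open>quasi\<close> by an equation; uniqueness of the value
  is \<open>Omega_cancel\<close>. From here on a quasimultiplier is handled as the graph of this
  equation.\<close>

lemma quasi_eq_Some_iff:
  assumes "u \<in> carrier A" "v \<in> Omega A"
  shows "quasi A u v x = Some y \<longleftrightarrow> x \<in> carrier A \<and> y \<in> carrier A \<and> u \<otimes> x = v \<otimes> y"
proof -
  have the: "(THE y. y \<in> carrier A \<and> v \<otimes> y = u \<otimes> x) = z"
    if "z \<in> carrier A" "u \<otimes> x = v \<otimes> z" for z
    using that Omega_cancel[OF assms(2)] by (intro the_equality) auto
  show ?thesis
  proof
    assume "quasi A u v x = Some y"
    then have x: "x \<in> carrier A" "u \<otimes> x \<in> (\<lambda>y. v \<otimes> y) ` carrier A"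
      and y: "y = (THE y. y \<in> carrier A \<and> v \<otimes> y = u \<otimes> x)"
      by (auto simp: quasi_def split: if_splits)
    obtain z where "z \<in> carrier A" "u \<otimes> x = v \<otimes> z"
      using x(2) by blast
    then show "x \<in> carrier A \<and> y \<in> carrier A \<and> u \<otimes> x = v \<otimes> y"
      using x(1) y the by auto
  next
    assume "x \<in> carrier A \<and> y \<in> carrier A \<and> u \<otimes> x = v \<otimes> y"
    then show "quasi A u v x = Some y"
      using the[of y] by (auto simp: quasi_def)
  qed
qed

lemma quasi_eqI:
  assumes "u \<in> carrier A" "v \<in> Omega A" "u' \<in> carrier A" "v' \<in> Omega A" "u \<otimes> v' = u' \<otimes> v"
  shows "quasi A u v = quasi A u' v'"
proof -
  \<comment> \<open>Inclusion of graphs suffices, as the hypotheses are symmetric.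
    Cross-multiplication produces q (p' x) = q (q' y), and q cancels.\<close>
  have *: "quasi A p' q' x = Some y"
    if "p \<in> carrier A" "q \<in> Omega A" "p' \<in> carrier A" "q' \<in> Omega A" "p \<otimes> q' = p' \<otimes> q"
      "quasi A p q x = Some y" for p q p' q' x y
  proof -
    have xy: "x \<in> carrier A" "y \<in> carrier A" "p \<otimes> x = q \<otimes> y"
      using that(6) quasi_eq_Some_iff[OF that(1,2)] by auto
    note c = that(1,3) Omega_carrier[OF that(2)] Omega_carrier[OF that(4)] xy(1,2)
    have "q \<otimes> (p' \<otimes> x) = (p' \<otimes> q) \<otimes> x"
      using c by (simp add: mult_ac)
    also have "\<dots> = q' \<otimes> (p \<otimes> x)"
      unfolding that(5)[symmetric] using c by (simp add: mult_ac)
    also have "\<dots> = q \<otimes> (q' \<otimes> y)"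
      unfolding xy(3) using c by (simp add: mult_left_commute)
    finally have "q \<otimes> (p' \<otimes> x) = q \<otimes> (q' \<otimes> y)" .
    then have "p' \<otimes> x = q' \<otimes> y"
      by (rule Omega_cancel[OF that(2), rotated 2]) (use c in simp_all)
    then show ?thesis
      using quasi_eq_Some_iff[OF that(3,4)] xy by simp
  qed
  have "quasi A u v x = Some y \<longleftrightarrow> quasi A u' v' x = Some y" for x y
    using *[OF assms] *[OF assms(3,4,1,2) assms(5)[symmetric]] by blast
  then show ?thesis
    by (intro ext option.expand) (metis option.exhaust_sel option.distinct(1) option.sel)+
qed

lemma quasi_eq_iff:
  assumes "u \<in> carrier A" "v \<in> Omega A" "u' \<in> carrier A" "v' \<in> Omega A"
  shows "quasi A u v = quasi A u' v' \<longleftrightarrow> u \<otimes> v' = u' \<otimes> v"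
proof
  assume eq: "quasi A u v = quasi A u' v'"
  \<comment> \<open>The denominator \<open>v\<close> always lies in the domain, with value
    \<open>u\<close>; evaluating the second fraction there yields the cross-multiplied
    equation.\<close>
  have "quasi A u v v = Some u"
    using quasi_eq_Some_iff[OF assms(1,2)] assms(1) Omega_carrier[OF assms(2)] by (simp add: mult_commute)
  then have "u' \<otimes> v = v' \<otimes> u"
    unfolding eq using quasi_eq_Some_iff[OF assms(3,4)] by blast
  then show "u \<otimes> v' = u' \<otimes> v"
    using assms by (simp add: mult_commute)
qed (rule quasi_eqI[OF assms])

lemma qm_carrierI: "\<lbrakk>u \<in> carrier A; v \<in> Omega A\<rbrakk> \<Longrightarrow> quasi A u v \<in> carrier (qm_alg A)"
  by (auto simp: qm_alg_def)

lemma qm_carrierE: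
  assumes "s \<in> carrier (qm_alg A)"
  obtains u v where "u \<in> carrier A" "v \<in> Omega A" "s = quasi A u v"
  using assms by (auto simp: qm_alg_def)

text \<open>The description in \<open>qm_alg\<close> ranges over all representatives of both
  operators, so it denotes only after independence of the representatives has been checked by
  cross-multiplication. The same holds for \<open>qm_add\<close> and
  \<open>qm_smult\<close>.\<close>

lemma qm_mult:
  assumes "u \<in> carrier A" "v \<in> Omega A" "u' \<in> carrier A" "v' \<in> Omega A"
  shows "quasi A u v \<otimes>\<^bsub>qm_alg A\<^esub> quasi A u' v' = quasi A (u \<otimes> u') (v \<otimes> v')"
proof -
  have "quasi A (p \<otimes> p') (q \<otimes> q') = quasi A (u \<otimes> u') (v \<otimes> v')"
    if c: "p \<in> carrier A" "q \<in> Omega A" "p' \<in> carrier A" "q' \<in> Omega A"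
      and "quasi A u v = quasi A p q" "quasi A u' v' = quasi A p' q'" for p q p' q'
  proof (rule quasi_eqI)
    have eq: "u \<otimes> q = p \<otimes> v" "u' \<otimes> q' = p' \<otimes> v'"
      using that(5,6) assms c quasi_eq_iff by auto
    have "(p \<otimes> p') \<otimes> (v \<otimes> v') = (p \<otimes> v) \<otimes> (p' \<otimes> v')"
      using assms c by (simp add: mult_ac)
    also have "\<dots> = (u \<otimes> u') \<otimes> (q \<otimes> q')"
      unfolding eq[symmetric] using assms c by (simp add: mult_ac)
    finally show "(p \<otimes> p') \<otimes> (v \<otimes> v') = (u \<otimes> u') \<otimes> (q \<otimes> q')" .
  qed (use assms c Omega_mult in auto)
  then show ?thesis
    unfolding qm_alg_def monoid.simps ring.simps partial_object.simps
    by (intro the_equality) (use assms in blast)+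
qed

lemma qm_add:
  assumes "u \<in> carrier A" "v \<in> Omega A" "u' \<in> carrier A" "v' \<in> Omega A"
  shows "quasi A u v \<oplus>\<^bsub>qm_alg A\<^esub> quasi A u' v' = quasi A (u \<otimes> v' \<oplus> u' \<otimes> v) (v \<otimes> v')"
proof -
  have "quasi A (p \<otimes> q' \<oplus> p' \<otimes> q) (q \<otimes> q') = quasi A (u \<otimes> v' \<oplus> u' \<otimes> v) (v \<otimes> v')"
    if c: "p \<in> carrier A" "q \<in> Omega A" "p' \<in> carrier A" "q' \<in> Omega A"
      and "quasi A u v = quasi A p q" "quasi A u' v' = quasi A p' q'" for p q p' q'
  proof (rule quasi_eqI)
    note c' = Omega_carrier[OF c(2)] Omega_carrier[OF c(4)]
      Omega_carrier[OF assms(2)] Omega_carrier[OF assms(4)]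
    have eq: "u \<otimes> q = p \<otimes> v" "u' \<otimes> q' = p' \<otimes> v'"
      using that(5,6) assms c quasi_eq_iff by auto
    have "(p \<otimes> q' \<oplus> p' \<otimes> q) \<otimes> (v \<otimes> v') = (p \<otimes> v) \<otimes> (q' \<otimes> v') \<oplus> (p' \<otimes> v') \<otimes> (q \<otimes> v)"
      using assms(1,3) c(1,3) c' by (simp add: distrib_l distrib_r mult_ac a_ac)
    also have "\<dots> = (u \<otimes> v' \<oplus> u' \<otimes> v) \<otimes> (q \<otimes> q')"
      unfolding eq[symmetric] using assms(1,3) c(1,3) c' by (simp add: distrib_l distrib_r mult_ac a_ac)
    finally show "(p \<otimes> q' \<oplus> p' \<otimes> q) \<otimes> (v \<otimes> v') = (u \<otimes> v' \<oplus> u' \<otimes> v) \<otimes> (q \<otimes> q')" .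
  qed (use assms c Omega_mult in auto)
  then show ?thesis
    unfolding qm_alg_def monoid.simps ring.simps partial_object.simps
    by (intro the_equality) (use assms in blast)+
qed

lemma qm_smult:
  assumes "u \<in> carrier A" "v \<in> Omega A"
  shows "c \<odot>\<^bsub>qm_alg A\<^esub> quasi A u v = quasi A (c \<odot> u) v"
proof -
  have "quasi A (c \<odot> p) q = quasi A (c \<odot> u) v"
    if "p \<in> carrier A" "q \<in> Omega A" "quasi A u v = quasi A p q" for p q
    using that assms quasi_eq_iff[OF assms that(1,2)]
    by (intro quasi_eqI) (auto simp: smult_mult_l)
  then show ?thesis
    unfolding qm_alg_def module.simps
    by (intro the_equality) (use assms in blast)+
qed

lemma quasi_of_mult_eq:
  assumes "r \<in> multipliers A" "v \<in> Omega A"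
  shows "quasi_of_mult A r = quasi A (r v) v"
proof
  note r = multipliersD[OF assms(1)] and v = Omega_carrier[OF assms(2)]
  fix x
  show "quasi_of_mult A r x = quasi A (r v) v x"
  proof (cases "x \<in> carrier A")
    case True
    have "r v \<otimes> x = v \<otimes> r x"
      using r(5)[OF v True] multiplier_mult_right[OF assms(1) v True] by simp
    then have "quasi A (r v) v x = Some (r x)"
      using quasi_eq_Some_iff[OF r(1)[OF v] assms(2)] True r(1) by simp
    then show ?thesis
      using True by (simp add: quasi_of_mult_def)
  next
    case False
    then show ?thesis
      by (simp add: quasi_of_mult_def quasi_def)
  qed
qed

end

section \<open>Extension of an embedding to quasimultipliers\<close>

definition qm_extension ::
  "'a normed_alg \<Rightarrow> 'b normed_alg \<Rightarrow> ('a \<Rightarrow> 'b) \<Rightarrow> ('a \<rightharpoonup> 'a) \<Rightarrow> ('b \<rightharpoonup> 'b)" where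
  "qm_extension A B j s =
    (THE r. \<exists>u\<in>carrier A. \<exists>v\<in>Omega A. s = quasi A u v \<and> r = quasi B (j u) (j v))"

text \<open>The constant \<open>M\<close> bounds the map \<open>b \<mapsto> j\<inverse>(j e \<cdot> b)\<close>; its existence would also follow
  from the closed graph theorem.\<close>

locale qm_embedding = A: wc_algebra A + B: wc_algebra B
  for A :: "'a normed_alg" and B :: "'b normed_alg" +
  fixes j :: "'a \<Rightarrow> 'b" and e :: 'a and M :: real
  assumes j_bounded: "bounded_linear_map A B j 1"
    and j_mult: "\<lbrakk>x \<in> carrier A; y \<in> carrier A\<rbrakk> \<Longrightarrow> j (x \<otimes>\<^bsub>A\<^esub> y) = j x \<otimes>\<^bsub>B\<^esub> j y"
    and j_inj: "inj_on j (carrier A)"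
    and j_dense: "dense_in B (j ` carrier A)"
    and e_Omega: "e \<in> Omega A"
    and e_range: "b \<in> carrier B
      \<Longrightarrow> \<exists>a\<in>carrier A. j a = j e \<otimes>\<^bsub>B\<^esub> b \<and> nrm A a \<le> M * nrm B b"
begin

lemmas j_closed = bounded_linear_mapD(1)[OF j_bounded]

lemma j_nrm: "x \<in> carrier A \<Longrightarrow> nrm B (j x) \<le> nrm A x"
  using bounded_linear_mapD(4)[OF j_bounded] by simp

lemma j_eq_iff: "\<lbrakk>x \<in> carrier A; y \<in> carrier A\<rbrakk> \<Longrightarrow> j x = j y \<longleftrightarrow> x = y"
  using j_inj by (auto simp: inj_on_def)

text \<open>The image of the dense ideal generated by \<open>v\<close> is dense, since
  \<open>j\<close> has dense range, and it is contained in the ideal generated by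
  \<open>j v\<close>.\<close>

lemma j_Omega:
  assumes "v \<in> Omega A"
  shows "j v \<in> Omega B"
proof -
  have v: "v \<in> carrier A" "dense_in A ((\<lambda>x. v \<otimes>\<^bsub>A\<^esub> x) ` carrier A)"
    using assms by (simp_all add: Omega_def del: A.Omega_carrier B.Omega_carrier)
  have "dense_in B (j ` (\<lambda>x. v \<otimes>\<^bsub>A\<^esub> x) ` carrier A)"
    by (rule dense_in_image[OF A.normed B.normed j_bounded v(2) j_dense])
  moreover have "j ` (\<lambda>x. v \<otimes>\<^bsub>A\<^esub> x) ` carrier A \<subseteq> (\<lambda>x. j v \<otimes>\<^bsub>B\<^esub> x) ` carrier B"
    using j_mult[OF v(1)] j_closed by auto
  moreover have "(\<lambda>x. j v \<otimes>\<^bsub>B\<^esub> x) ` carrier B \<subseteq> carrier B"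
    using j_closed[OF v(1)] by auto
  ultimately have "dense_in B ((\<lambda>x. j v \<otimes>\<^bsub>B\<^esub> x) ` carrier B)"
    unfolding B.dense_in_iff by (meson order_trans)
  then show ?thesis
    using j_closed[OF v(1)] by (simp add: Omega_def del: A.Omega_carrier B.Omega_carrier)
qed

lemma continuous_j: "continuous_map (alg_top A) (alg_top B) j"
  unfolding alg_top_def A.metric_continuous_map[OF B.Metric_space_alg_dist]
proof (intro conjI ballI allI impI)
  show "j ` carrier A \<subseteq> carrier B"
    using j_closed by blast
  fix x \<epsilon> assume x: "x \<in> carrier A" and "(0::real) < \<epsilon>"
  moreover have "alg_dist B (j x) (j y) \<le> alg_dist A x y" if "y \<in> carrier A" for y
    using that x j_closed j_nrm[of "x \<ominus>\<^bsub>A\<^esub> y"] bounded_linear_map_diff[OF A.normed B.normed j_bounded x that]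
    by (simp add: alg_dist_def)
  ultimately show "\<exists>\<delta>>0. \<forall>y. y \<in> carrier A \<and> alg_dist A x y < \<delta> \<longrightarrow> alg_dist B (j x) (j y) < \<epsilon>"
    by (meson order_le_less_trans)
qed

lemma alg_hom_j: "alg_hom A B j"
  using j_bounded j_mult by (simp add: alg_hom_def bounded_linear_map_def)

lemma qm_homomorphism_j: "qm_homomorphism A B j e"
proof -
  have "(\<lambda>y. j e \<otimes>\<^bsub>B\<^esub> y) ` carrier B \<subseteq> j ` carrier A"
    using e_range by force
  then show ?thesis
    unfolding qm_homomorphism_def
    using B.wc alg_hom_j continuous_j j_inj j_dense e_Omega by blast
qed

text \<open>A way back from \<open>B\<close> to \<open>A\<close>: up to multiplication by
  \<open>e\<close> it is a two-sided inverse of \<open>j\<close>, as \<open>retract_j\<close> and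
  the second part of \<open>retract\<close> show.\<close>

definition retract :: "'b \<Rightarrow> 'a" where
  "retract b = inv_into (carrier A) j (j e \<otimes>\<^bsub>B\<^esub> b)"

lemma retract:
  assumes "b \<in> carrier B"
  shows "retract b \<in> carrier A" "j (retract b) = j e \<otimes>\<^bsub>B\<^esub> b" "nrm A (retract b) \<le> M * nrm B b"
proof -
  obtain a where a: "a \<in> carrier A" "j a = j e \<otimes>\<^bsub>B\<^esub> b" "nrm A a \<le> M * nrm B b"
    using e_range[OF assms] by blast
  then have "retract b = a"
    using inv_into_f_f[OF j_inj a(1)] by (simp add: retract_def)
  then show "retract b \<in> carrier A" "j (retract b) = j e \<otimes>\<^bsub>B\<^esub> b" "nrm A (retract b) \<le> M * nrm B b"
    using a by auto
qed

lemma retract_eqI: "\<lbrakk>b \<in> carrier B; a \<in> carrier A; j a = j e \<otimes>\<^bsub>B\<^esub> b\<rbrakk> \<Longrightarrow> retract b = a"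
  using retract j_eq_iff by metis

lemma e_carrier: "e \<in> carrier A"
  using e_Omega by simp

lemma retract_bounded: "bounded_linear_map B A retract M"
  unfolding bounded_linear_map_def
proof (intro conjI ballI allI)
  note je = j_closed[OF e_carrier]
  show "retract (x \<oplus>\<^bsub>B\<^esub> y) = retract x \<oplus>\<^bsub>A\<^esub> retract y" if "x \<in> carrier B" "y \<in> carrier B" for x y
    by (rule retract_eqI)
      (use that je in \<open>simp_all add: retract bounded_linear_mapD(2)[OF j_bounded] B.distrib_r\<close>)
  show "retract (c \<odot>\<^bsub>B\<^esub> x) = c \<odot>\<^bsub>A\<^esub> retract x" if "x \<in> carrier B" for x c
    by (rule retract_eqI)
      (use that je in \<open>simp_all add: retract bounded_linear_mapD(3)[OF j_bounded] B.smult_mult_r\<close>)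
qed (auto simp: retract)

lemma retract_mult:
  assumes "b \<in> carrier B" "a \<in> carrier A"
  shows "retract (b \<otimes>\<^bsub>B\<^esub> j a) = retract b \<otimes>\<^bsub>A\<^esub> a"
  by (rule retract_eqI)
    (use assms j_closed[OF assms(2)] j_closed[OF e_carrier] in \<open>simp_all add: retract j_mult B.mult_assoc\<close>)

lemma retract_j:
  assumes "a \<in> carrier A"
  shows "retract (j a) = e \<otimes>\<^bsub>A\<^esub> a"
  by (rule retract_eqI) (use assms j_closed e_carrier in \<open>simp_all add: j_mult\<close>)

text \<open>By \<open>retract_mult\<close>, the ideal generated by \<open>retract v\<close> is the
  image under \<open>retract\<close> of the multiples of \<open>v\<close> by elements of
  \<open>j(A)\<close>. These multiples are dense in \<open>B\<close>, and \<open>retract\<close> has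
  dense range because its range contains \<open>e A\<close>.\<close>

lemma retract_Omega:
  assumes "v \<in> Omega B"
  shows "retract v \<in> Omega A"
proof -
  have v: "v \<in> carrier B" "dense_in B ((\<lambda>x. v \<otimes>\<^bsub>B\<^esub> x) ` carrier B)"
    using assms by (simp_all add: Omega_def del: A.Omega_carrier B.Omega_carrier)
  have "dense_in B (mult_op B v ` j ` carrier A)"
  proof (rule dense_in_image[OF B.normed B.normed _ j_dense])
    show "bounded_linear_map B B (mult_op B v) (nrm (mult_alg B) (mult_op B v))"
      by (rule B.multiplier_bounded_linear_map[OF B.mult_op_multiplier(1)[OF v(1)]])
    have "mult_op B v ` carrier B = (\<lambda>x. v \<otimes>\<^bsub>B\<^esub> x) ` carrier B"
      by (intro image_cong) (auto simp: mult_op_def)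
    then show "dense_in B (mult_op B v ` carrier B)"
      using v(2) by simp
  qed
  moreover have "dense_in A (retract ` carrier B)"
    unfolding A.dense_in_iff
  proof (intro conjI ballI)
    show "retract ` carrier B \<subseteq> carrier A"
      using retract(1) by blast
    fix x assume "x \<in> carrier A"
    then obtain s where s: "range s \<subseteq> (\<lambda>x. e \<otimes>\<^bsub>A\<^esub> x) ` carrier A" "converges_to A s x"
      using e_Omega A.dense_in_iff unfolding Omega_def by blast
    have "(\<lambda>x. e \<otimes>\<^bsub>A\<^esub> x) ` carrier A \<subseteq> retract ` carrier B"
      using retract_j j_closed by (auto simp: image_iff) metis
    then show "\<exists>s. range s \<subseteq> retract ` carrier B \<and> converges_to A s x"
      using s by (meson order_trans)
  qed
  ultimately have "dense_in A (retract ` mult_op B v ` j ` carrier A)"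
    by (rule dense_in_image[OF B.normed A.normed retract_bounded])
  moreover have "retract ` mult_op B v ` j ` carrier A = (\<lambda>x. retract v \<otimes>\<^bsub>A\<^esub> x) ` carrier A"
    unfolding image_image
    by (rule image_cong) (use retract_mult[OF v(1)] j_closed in \<open>auto simp: mult_op_def\<close>)
  ultimately show ?thesis
    using retract(1)[OF v(1)] by (simp add: Omega_def del: A.Omega_carrier B.Omega_carrier)
qed

abbreviation "jt \<equiv> qm_extension A B j"

lemma jt_quasi:
  assumes "u \<in> carrier A" "v \<in> Omega A"
  shows "jt (quasi A u v) = quasi B (j u) (j v)"
proof -
  \<comment> \<open>Independence of the representative: the cross-multiplied equation in
    \<open>A\<close> is carried over by the homomorphism \<open>j\<close>.\<close>
  have "quasi B (j p) (j q) = quasi B (j u) (j v)"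
    if "p \<in> carrier A" "q \<in> Omega A" "quasi A u v = quasi A p q" for p q
  proof (rule B.quasi_eqI)
    have "u \<otimes>\<^bsub>A\<^esub> q = p \<otimes>\<^bsub>A\<^esub> v"
      using that assms A.quasi_eq_iff by auto
    then show "j p \<otimes>\<^bsub>B\<^esub> j v = j u \<otimes>\<^bsub>B\<^esub> j q"
      using that assms by (simp flip: j_mult)
  qed (use that assms j_closed j_Omega in auto)
  then show ?thesis
    unfolding qm_extension_def by (intro the_equality) (use assms in blast)+
qed

lemma jt_closed: "s \<in> carrier (qm_alg A) \<Longrightarrow> jt s \<in> carrier (qm_alg B)"
  by (metis A.qm_carrierE B.qm_carrierI j_Omega j_closed jt_quasi)

lemma jt_retract:
  assumes "u \<in> carrier B" "v \<in> Omega B"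
  shows "jt (quasi A (retract u) (retract v)) = quasi B u v"
proof -
  have c: "j e \<in> carrier B" "v \<in> carrier B"
    using j_closed[OF e_carrier] assms(2) by simp_all
  have "jt (quasi A (retract u) (retract v)) = quasi B (j (retract u)) (j (retract v))"
    using jt_quasi retract(1)[OF assms(1)] retract_Omega[OF assms(2)] by simp
  also have "\<dots> = quasi B u v"
  proof (rule B.quasi_eqI)
    show "j (retract u) \<otimes>\<^bsub>B\<^esub> v = u \<otimes>\<^bsub>B\<^esub> j (retract v)"
      unfolding retract(2)[OF assms(1)] retract(2)[OF c(2)] using c assms(1) by (simp add: B.mult_ac)
  qed (use assms j_closed[OF retract(1)[OF assms(1)]] j_Omega[OF retract_Omega[OF assms(2)]] in auto)
  finally show ?thesis .
qed

lemma inj_on_jt: "inj_on jt (carrier (qm_alg A))"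
proof (rule inj_onI)
  fix r s assume rs: "r \<in> carrier (qm_alg A)" "s \<in> carrier (qm_alg A)" "jt r = jt s"
  obtain u v where u: "u \<in> carrier A" "v \<in> Omega A" "r = quasi A u v"
    using A.qm_carrierE[OF rs(1)] .
  obtain u' v' where u': "u' \<in> carrier A" "v' \<in> Omega A" "s = quasi A u' v'"
    using A.qm_carrierE[OF rs(2)] .
  have "quasi B (j u) (j v) = quasi B (j u') (j v')"
    using rs(3) u u' jt_quasi by simp
  then have "j (u \<otimes>\<^bsub>A\<^esub> v') = j (u' \<otimes>\<^bsub>A\<^esub> v)"
    using B.quasi_eq_iff[OF j_closed[OF u(1)] j_Omega[OF u(2)] j_closed[OF u'(1)] j_Omega[OF u'(2)]]
      u u' by (simp add: j_mult)
  then show "r = s"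
    unfolding u(3) u'(3) using u(1,2) u'(1,2) by (intro A.quasi_eqI) (auto simp: j_eq_iff)
qed

lemma bij_betw_jt: "bij_betw jt (carrier (qm_alg A)) (carrier (qm_alg B))"
proof (rule bij_betw_imageI[OF inj_on_jt], intro subset_antisym subsetI)
  show "r \<in> carrier (qm_alg B)" if "r \<in> jt ` carrier (qm_alg A)" for r
    using that jt_closed by blast
  fix r assume "r \<in> carrier (qm_alg B)"
  then obtain u v where u: "u \<in> carrier B" "v \<in> Omega B" "r = quasi B u v"
    using B.qm_carrierE by blast
  then show "r \<in> jt ` carrier (qm_alg A)"
    using jt_retract[OF u(1,2)] A.qm_carrierI[OF retract(1)[OF u(1)] retract_Omega[OF u(2)]]
    by (metis image_eqI)
qed

lemma inv_jt_quasi: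
  assumes "u \<in> carrier B" "v \<in> Omega B"
  shows "inv_into (carrier (qm_alg A)) jt (quasi B u v) = quasi A (retract u) (retract v)"
  using inv_into_f_f[OF inj_on_jt A.qm_carrierI[OF retract(1)[OF assms(1)] retract_Omega[OF assms(2)]]]
    jt_retract[OF assms] by simp

lemma jt_apply:
  assumes "s \<in> carrier (qm_alg A)" "s x = Some y"
  shows "jt s (j x) = Some (j y)" "x \<in> carrier A" "y \<in> carrier A"
proof -
  obtain u v where u: "u \<in> carrier A" "v \<in> Omega A" "s = quasi A u v"
    using A.qm_carrierE[OF assms(1)] .
  have xy: "x \<in> carrier A \<and> y \<in> carrier A \<and> u \<otimes>\<^bsub>A\<^esub> x = v \<otimes>\<^bsub>A\<^esub> y"
    using assms(2) A.quasi_eq_Some_iff[OF u(1,2)] u(3) by simp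
  then show "x \<in> carrier A" "y \<in> carrier A"
    by simp_all
  have "j u \<otimes>\<^bsub>B\<^esub> j x = j v \<otimes>\<^bsub>B\<^esub> j y"
    using xy u by (simp flip: j_mult)
  then show "jt s (j x) = Some (j y)"
    unfolding u(3) jt_quasi[OF u(1,2)] B.quasi_eq_Some_iff[OF j_closed[OF u(1)] j_Omega[OF u(2)]]
    using xy j_closed by simp
qed

lemma inv_jt_apply:
  assumes "r \<in> carrier (qm_alg B)" "r x = Some y"
  shows "inv_into (carrier (qm_alg A)) jt r (retract x) = Some (retract y)"
    "x \<in> carrier B" "y \<in> carrier B"
proof -
  obtain u v where u: "u \<in> carrier B" "v \<in> Omega B" "r = quasi B u v"
    using B.qm_carrierE[OF assms(1)] .
  have xy: "x \<in> carrier B \<and> y \<in> carrier B \<and> u \<otimes>\<^bsub>B\<^esub> x = v \<otimes>\<^bsub>B\<^esub> y"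
    using assms(2) B.quasi_eq_Some_iff[OF u(1,2)] u(3) by simp
  then show c: "x \<in> carrier B" "y \<in> carrier B"
    by simp_all
  have c': "v \<in> carrier B" "j e \<in> carrier B"
    using u(2) j_closed[OF e_carrier] by simp_all
  \<comment> \<open>Each \<open>retract\<close> contributes one factor \<open>j e\<close>. The two
    sides are the equation for x and y in \<open>B\<close> multiplied by the square of
    \<open>j e\<close>, and injectivity of \<open>j\<close> brings it back to
    \<open>A\<close>.\<close>
  have "j (retract u \<otimes>\<^bsub>A\<^esub> retract x) = (j e \<otimes>\<^bsub>B\<^esub> j e) \<otimes>\<^bsub>B\<^esub> (u \<otimes>\<^bsub>B\<^esub> x)"
    using u(1) c c' retract by (simp add: j_mult B.mult_ac)
  also have "\<dots> = j (retract v \<otimes>\<^bsub>A\<^esub> retract y)"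
    using xy u(1) c c' retract by (simp add: j_mult B.mult_ac)
  finally have "retract u \<otimes>\<^bsub>A\<^esub> retract x = retract v \<otimes>\<^bsub>A\<^esub> retract y"
    using u(1) c c' retract(1) by (simp add: j_eq_iff)
  then show "inv_into (carrier (qm_alg A)) jt r (retract x) = Some (retract y)"
    unfolding u(3) inv_jt_quasi[OF u(1,2)]
      A.quasi_eq_Some_iff[OF retract(1)[OF u(1)] retract_Omega[OF u(2)]]
    using c retract(1) by simp
qed

lemma alg_hom_jt: "alg_hom (qm_alg A) (qm_alg B) jt"
  unfolding alg_hom_def
proof (intro conjI ballI allI)
  show "jt \<in> carrier (qm_alg A) \<rightarrow> carrier (qm_alg B)"
    using jt_closed by blast
next
  fix r s assume rs: "r \<in> carrier (qm_alg A)" "s \<in> carrier (qm_alg A)"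
  obtain u v where u: "u \<in> carrier A" "v \<in> Omega A" "r = quasi A u v"
    using A.qm_carrierE[OF rs(1)] .
  obtain u' v' where u': "u' \<in> carrier A" "v' \<in> Omega A" "s = quasi A u' v'"
    using A.qm_carrierE[OF rs(2)] .
  note c = u(1) u'(1) A.Omega_carrier[OF u(2)] A.Omega_carrier[OF u'(2)]
  note A = A.Omega_mult[OF u(2) u'(2)]
    and B = j_closed[OF u(1)] j_Omega[OF u(2)] j_closed[OF u'(1)] j_Omega[OF u'(2)]
  show "jt (r \<otimes>\<^bsub>qm_alg A\<^esub> s) = jt r \<otimes>\<^bsub>qm_alg B\<^esub> jt s"
    unfolding u(3) u'(3) A.qm_mult[OF u(1,2) u'(1,2)] jt_quasi[OF u(1,2)] jt_quasi[OF u'(1,2)]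
      B.qm_mult[OF B] using c A by (simp add: jt_quasi j_mult)
  show "jt (r \<oplus>\<^bsub>qm_alg A\<^esub> s) = jt r \<oplus>\<^bsub>qm_alg B\<^esub> jt s"
    unfolding u(3) u'(3) A.qm_add[OF u(1,2) u'(1,2)] jt_quasi[OF u(1,2)] jt_quasi[OF u'(1,2)]
      B.qm_add[OF B] using c A by (simp add: jt_quasi j_mult bounded_linear_mapD(2)[OF j_bounded])
next
  fix c r assume r: "r \<in> carrier (qm_alg A)"
  obtain u v where u: "u \<in> carrier A" "v \<in> Omega A" "r = quasi A u v"
    using A.qm_carrierE[OF r] .
  show "jt (c \<odot>\<^bsub>qm_alg A\<^esub> r) = c \<odot>\<^bsub>qm_alg B\<^esub> jt r"
    unfolding u(3) A.qm_smult[OF u(1,2)] jt_quasi[OF u(1,2)]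
      B.qm_smult[OF j_closed[OF u(1)] j_Omega[OF u(2)]]
    using u by (simp add: jt_quasi bounded_linear_mapD(3)[OF j_bounded])
qed

lemma pseudobounded_jt:
  assumes "pseudobounded A V"
  shows "pseudobounded B (jt ` V)"
proof -
  have V: "V \<subseteq> carrier (qm_alg A)"
    using assms by (simp add: pseudobounded_def)
  obtain u where u: "u \<in> Omega A" and dom: "\<forall>s\<in>V. u \<in> dom s"
    and bdd: "bdd_above ((\<lambda>s. nrm A (the (s u))) ` V)"
    using assms unfolding pseudobounded_def by blast
  obtain K where K: "nrm A (the (s u)) \<le> K" if "s \<in> V" for s
    using bdd by (auto simp: bdd_above_def)
  have *: "j u \<in> dom (jt s) \<and> nrm B (the (jt s (j u))) \<le> K" if s: "s \<in> V" for s
  proof -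
    obtain y where y: "s u = Some y"
      using dom s by blast
    note jt = jt_apply[OF subsetD[OF V s] y]
    then show ?thesis
      using j_nrm[OF jt(3)] K[OF s] y by auto
  qed
  have "bdd_above ((\<lambda>r. nrm B (the (r (j u)))) ` jt ` V)"
    using * by (intro bdd_aboveI[where M = K]) auto
  moreover have "jt ` V \<subseteq> carrier (qm_alg B)"
    using V jt_closed by blast
  ultimately show ?thesis
    unfolding pseudobounded_def using * by (intro conjI bexI[OF _ j_Omega[OF u]]) auto
qed

text \<open>A test element \<open>u\<close> for \<open>V\<close> is replaced by
  \<open>retract u\<close>, on which the transported operators take the values
  \<open>retract y\<close>.\<close>

lemma pseudobounded_inv_jt:
  assumes "pseudobounded B V"
  shows "pseudobounded A (inv_into (carrier (qm_alg A)) jt ` V)"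
proof -
  let ?inv = "inv_into (carrier (qm_alg A)) jt"
  have V: "V \<subseteq> carrier (qm_alg B)"
    using assms by (simp add: pseudobounded_def)
  obtain u where u: "u \<in> Omega B" and dom: "\<forall>s\<in>V. u \<in> dom s"
    and bdd: "bdd_above ((\<lambda>s. nrm B (the (s u))) ` V)"
    using assms unfolding pseudobounded_def by blast
  obtain K where K: "nrm B (the (s u)) \<le> K" if "s \<in> V" for s
    using bdd by (auto simp: bdd_above_def)
  \<comment> \<open>The sign of \<open>M\<close> is not known, hence the absolute value.\<close>
  have *: "retract u \<in> dom (?inv s) \<and> nrm A (the (?inv s (retract u))) \<le> \<bar>M\<bar> * K" if s: "s \<in> V" for s
  proof -
    obtain y where y: "s u = Some y"
      using dom s by blast
    note inv = inv_jt_apply[OF subsetD[OF V s] y]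
    have "nrm A (retract y) \<le> M * nrm B y"
      by (rule retract(3)[OF inv(3)])
    also have "\<dots> \<le> \<bar>M\<bar> * K"
      using K[OF s] y B.nrm_nonneg[OF inv(3)] by (intro mult_mono) auto
    finally show ?thesis
      using inv(1) by auto
  qed
  have "bdd_above ((\<lambda>r. nrm A (the (r (retract u)))) ` ?inv ` V)"
    using * by (intro bdd_aboveI[where M = "\<bar>M\<bar> * K"]) auto
  moreover have "?inv ` V \<subseteq> carrier (qm_alg A)"
  proof (rule image_subsetI)
    fix s assume "s \<in> V"
    then show "?inv s \<in> carrier (qm_alg A)"
      using V bij_betw_imp_surj_on[OF bij_betw_jt] by (intro inv_into_into) auto
  qed
  ultimately show ?thesis
    unfolding pseudobounded_def using * by (intro conjI bexI[OF _ retract_Omega[OF u]]) auto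
qed

lemma pseudobounded_iso_jt: "pseudobounded_iso A B jt"
  unfolding pseudobounded_iso_def
  using alg_hom_jt bij_betw_jt pseudobounded_jt pseudobounded_inv_jt by blast

text \<open>With denominators \<open>e\<close> and \<open>j e\<close> the two multipliers become
  fractions whose numerators \<open>r e\<close> and \<open>r' (j e)\<close> correspond under
  \<open>j\<close>.\<close>

lemma jt_quasi_of_mult:
  assumes "r \<in> multipliers A" "r' \<in> multipliers B"
    and "\<And>u. u \<in> carrier A \<Longrightarrow> r' (j u) = j (r u)"
  shows "jt (quasi_of_mult A r) = quasi_of_mult B r'"
  using A.quasi_of_mult_eq[OF assms(1) e_Omega] B.quasi_of_mult_eq[OF assms(2) j_Omega[OF e_Omega]]
    jt_quasi[OF multipliersD(1)[OF assms(1) e_carrier] e_Omega] assms(3)[OF e_carrier] by simp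

end

section \<open>Sectors\<close>

lemma rcis_in_sector: "\<lbrakk>0 < r; a < \<theta>; \<theta> < b\<rbrakk> \<Longrightarrow> rcis r \<theta> \<in> sector a b"
  by (auto simp: sector_def)

text \<open>As the opening is at most pi, the sector is an intersection of two open half planes.
  Stability under sums and openness are then immediate.\<close>

lemma sector_iff:
  assumes "a < b" "b \<le> a + pi"
  shows "\<zeta> \<in> sector a b \<longleftrightarrow> 0 < Im (\<zeta> * cis (- a)) \<and> Im (\<zeta> * cis (- b)) < 0"
proof
  assume "\<zeta> \<in> sector a b"
  then obtain r \<theta> where r: "\<zeta> = rcis r \<theta>" "0 < r" "a < \<theta>" "\<theta> < b"
    by (auto simp: sector_def)
  have "\<zeta> * cis c = rcis r (\<theta> + c)" for c
    by (simp add: r(1) rcis_def cis_mult)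
  then have im: "Im (\<zeta> * cis c) = r * sin (\<theta> + c)" for c
    by (simp only: Im_rcis)
  have "0 < sin (\<theta> + - a)"
    using r assms by (intro sin_gt_zero) auto
  moreover have "0 < sin (- (\<theta> + - b))"
    using r assms by (intro sin_gt_zero) auto
  ultimately show "0 < Im (\<zeta> * cis (- a)) \<and> Im (\<zeta> * cis (- b)) < 0"
    unfolding im sin_minus using r(2) by (auto intro: mult_pos_neg)
next
  assume im: "0 < Im (\<zeta> * cis (- a)) \<and> Im (\<zeta> * cis (- b)) < 0"
  define \<phi> where "\<phi> = Arg (\<zeta> * cis (- a))"
  have "\<zeta> \<noteq> 0"
    using im by auto
  then have r: "0 < cmod \<zeta>"
    by simp
  have "\<zeta> * cis (- a) = rcis (cmod (\<zeta> * cis (- a))) \<phi>"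
    by (simp only: \<phi>_def rcis_cmod_Arg)
  then have polar: "\<zeta> * cis (- a) = rcis (cmod \<zeta>) \<phi>"
    by (simp add: norm_mult)
  have \<phi>: "- pi < \<phi>" "\<phi> \<le> pi"
    using Arg_bounded[of "\<zeta> * cis (- a)"] by (simp_all add: \<phi>_def)
  have "0 < sin \<phi>"
    using im r by (simp add: polar zero_less_mult_iff)
  then have \<phi>0: "0 < \<phi>" "\<phi> < pi"
    using \<phi> sin_ge_zero[of "- \<phi>"] sin_pi order.order_iff_strict by (fastforce simp: not_less)+
  have "cis (- a) * cis a = 1"
    by (simp add: cis_mult)
  then have \<zeta>: "\<zeta> = rcis (cmod \<zeta>) (a + \<phi>)"
    using arg_cong[OF polar, of "\<lambda>z. z * cis a"]
    by (simp add: mult.assoc rcis_def cis_mult add.commute)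
  have "\<zeta> * cis (- b) = rcis (cmod \<zeta>) (a + \<phi> - b)"
    by (subst \<zeta>) (simp add: rcis_def cis_mult)
  then have "sin (a + \<phi> - b) < 0"
    using im r by (simp add: mult_less_0_iff)
  \<comment> \<open>The sine is nonnegative on [0, pi], so together with this upper bound a negative
    sine forces a negative angle.\<close>
  moreover have "a + \<phi> - b \<le> pi"
    using \<phi>0 assms by simp
  ultimately have "a + \<phi> - b < 0"
    using sin_ge_zero[of "a + \<phi> - b"] by (meson not_less)
  then show "\<zeta> \<in> sector a b"
    using \<zeta> r \<phi>0 rcis_in_sector[of "cmod \<zeta>" a "a + \<phi>" b] by simp
qed

lemma sector_add:
  assumes "a < b" "b \<le> a + pi" "\<zeta> \<in> sector a b" "\<eta> \<in> sector a b"
  shows "\<zeta> + \<eta> \<in> sector a b"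
  using assms(3,4) unfolding sector_iff[OF assms(1,2)] by (simp add: distrib_right)

lemma sector_scale: "\<lbrakk>\<zeta> \<in> sector a b; 0 < t\<rbrakk> \<Longrightarrow> of_real t * \<zeta> \<in> sector a b"
proof -
  assume "\<zeta> \<in> sector a b" "0 < t"
  then obtain r \<theta> where r: "\<zeta> = rcis r \<theta>" "0 < r" "a < \<theta>" "\<theta> < b"
    by (auto simp: sector_def)
  have "of_real t * \<zeta> = rcis (t * r) \<theta>"
    by (simp add: r(1) rcis_def)
  then show ?thesis
    using r \<open>0 < t\<close> rcis_in_sector[of "t * r" a \<theta> b] by simp
qed


lemma zero_notin_sector: "0 \<notin> sector a b"
  by (auto simp: sector_def)

lemma open_sector:
  assumes "a < b" "b \<le> a + pi"
  shows "open (sector a b)"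
proof -
  have "sector a b = {\<zeta>. 0 < Im (\<zeta> * cis (- a))} \<inter> {\<zeta>. Im (\<zeta> * cis (- b)) < 0}"
    using sector_iff[OF assms] by blast
  moreover have "open {\<zeta>. 0 < Im (\<zeta> * cis (- a))}" "open {\<zeta>. Im (\<zeta> * cis (- b)) < 0}"
    by (intro open_Collect_less continuous_intros)+
  ultimately show ?thesis
    by (simp add: open_Int)
qed

lemma closed_sector_iff:
  assumes "\<alpha> < \<beta>" "\<beta> \<le> \<alpha> + pi"
  shows "\<zeta> \<in> closed_sector \<alpha> \<beta> \<longleftrightarrow> 0 \<le> Im (\<zeta> * cis (- \<alpha>)) \<and> Im (\<zeta> * cis (- \<beta>)) \<le> 0"
proof -
  let ?D = "{\<zeta>. 0 \<le> Im (\<zeta> * cis (- \<alpha>))} \<inter> {\<zeta>. Im (\<zeta> * cis (- \<beta>)) \<le> 0}"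
  have "closed ?D"
    by (intro closed_Int closed_Collect_le continuous_intros)
  moreover have "sector \<alpha> \<beta> \<subseteq> ?D"
    using sector_iff[OF assms] by auto
  ultimately have "closure (sector \<alpha> \<beta>) \<subseteq> ?D"
    by (rule closure_minimal[rotated])
  moreover have "\<zeta> \<in> closure (sector \<alpha> \<beta>)" if "\<zeta> \<in> ?D" for \<zeta>
  proof -
    \<comment> \<open>Points of the boundary are approximated from inside the sector by small
      translations along the bisector.\<close>
    let ?\<delta> = "cis ((\<alpha> + \<beta>) / 2)"
    have "?\<delta> \<in> sector \<alpha> \<beta>"
      using rcis_in_sector[of 1 \<alpha> "(\<alpha> + \<beta>) / 2" \<beta>] assms(1) by (simp add: rcis_def)
    then have "\<zeta> + of_real (1 / real (Suc n)) * ?\<delta> \<in> sector \<alpha> \<beta>" for n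
    proof -
      have "of_real (1 / real (Suc n)) * ?\<delta> \<in> sector \<alpha> \<beta>"
        by (rule sector_scale[OF \<open>?\<delta> \<in> sector \<alpha> \<beta>\<close>]) simp
      then show ?thesis
        using that unfolding sector_iff[OF assms] by (simp add: distrib_right)
    qed
    moreover have "(\<lambda>n. \<zeta> + of_real (1 / real (Suc n)) * ?\<delta>) \<longlonglongrightarrow> \<zeta> + of_real 0 * ?\<delta>"
      using LIMSEQ_inverse_real_of_nat by (intro tendsto_intros) (simp add: inverse_eq_divide)
    ultimately show ?thesis
      unfolding closure_sequential by (intro exI conjI allI) (assumption | simp)+
  qed
  ultimately show ?thesis
    using assms(1) by (auto simp: closed_sector_def)
qed

lemma zero_in_closed_sector: "\<lbrakk>\<alpha> < \<beta>; \<beta> \<le> \<alpha> + pi\<rbrakk> \<Longrightarrow> 0 \<in> closed_sector \<alpha> \<beta>"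
  by (simp add: closed_sector_iff)

lemma closed_sector_add:
  assumes "\<alpha> < \<beta>" "\<beta> \<le> \<alpha> + pi" "\<zeta> \<in> closed_sector \<alpha> \<beta>" "\<eta> \<in> closed_sector \<alpha> \<beta>"
  shows "\<zeta> + \<eta> \<in> closed_sector \<alpha> \<beta>"
  using assms(3,4) unfolding closed_sector_iff[OF assms(1,2)] by (simp add: distrib_right)

text \<open>Cramer's rule in the basis \<open>cis \<alpha>\<close>, \<open>cis \<beta>\<close>,
  whose determinant \<open>sin (\<beta> - \<alpha>)\<close> is positive because the opening is less
  than pi.\<close>

lemma closed_sector_decompose:
  assumes "\<alpha> < \<beta>" "\<beta> < \<alpha> + pi" "\<zeta> \<in> closed_sector \<alpha> \<beta>"
  obtains r s where "0 \<le> r" "0 \<le> s" "\<zeta> = rcis r \<alpha> + rcis s \<beta>"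
proof
  have pos: "0 < sin (\<beta> - \<alpha>)"
    using assms by (intro sin_gt_zero) auto
  have im: "0 \<le> Im (\<zeta> * cis (- \<alpha>))" "Im (\<zeta> * cis (- \<beta>)) \<le> 0"
    using assms closed_sector_iff[of \<alpha> \<beta> \<zeta>] by auto
  let ?r = "- Im (\<zeta> * cis (- \<beta>)) / sin (\<beta> - \<alpha>)" and ?s = "Im (\<zeta> * cis (- \<alpha>)) / sin (\<beta> - \<alpha>)"
  show "0 \<le> ?r" "0 \<le> ?s"
    using im pos by (simp_all add: divide_nonpos_pos)
  have "Re \<zeta> * sin (\<beta> - \<alpha>) = - Im (\<zeta> * cis (- \<beta>)) * cos \<alpha> + Im (\<zeta> * cis (- \<alpha>)) * cos \<beta>"
    "Im \<zeta> * sin (\<beta> - \<alpha>) = - Im (\<zeta> * cis (- \<beta>)) * sin \<alpha> + Im (\<zeta> * cis (- \<alpha>)) * sin \<beta>"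
    by (simp_all add: sin_diff algebra_simps)
  then have "Re \<zeta> = ?r * cos \<alpha> + ?s * cos \<beta>" "Im \<zeta> = ?r * sin \<alpha> + ?s * sin \<beta>"
    using pos by (simp_all add: field_simps)
  then show "\<zeta> = rcis ?r \<alpha> + rcis ?s \<beta>"
    by (intro complex_eqI) (simp_all only: plus_complex.sel Re_rcis Im_rcis)
qed

lemma closed_sector_subset:
  assumes "a < \<alpha>" "\<alpha> < \<beta>" "\<beta> < b" "b \<le> a + pi" "\<zeta> \<in> closed_sector \<alpha> \<beta>" "\<zeta> \<noteq> 0"
  shows "\<zeta> \<in> sector a b"
proof -
  have ab: "a < b" "\<beta> < \<alpha> + pi"
    using assms by auto
  obtain r s where rs: "0 \<le> r" "0 \<le> s" "\<zeta> = rcis r \<alpha> + rcis s \<beta>"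
    using closed_sector_decompose[OF assms(2) ab(2) assms(5)] .
  show ?thesis
  proof (cases "r = 0 \<or> s = 0")
    case True
    then consider "r = 0" "0 < s" | "s = 0" "0 < r"
      using rs assms(6) by force
    then show ?thesis
      using rs assms by cases (auto intro: rcis_in_sector)
  next
    case False
    then show ?thesis
      unfolding rs(3) using rs(1,2) assms ab by (intro sector_add rcis_in_sector) auto
  qed
qed

text \<open>The filter at 0 is nontrivial, which is what identifies a \<open>Limsup\<close> with the
  limit.\<close>

lemma islimpt_zero_sector:
  assumes "a < b"
  shows "at (0 :: complex) within sector a b \<noteq> bot"
proof -
  let ?\<theta> = "(a + b) / 2"
  have "\<exists>\<zeta>\<in>sector a b. \<zeta> \<noteq> 0 \<and> dist \<zeta> 0 < e" if "0 < e" for e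
  proof (intro bexI conjI)
    show "rcis (e / 2) ?\<theta> \<in> sector a b"
      using that assms by (intro rcis_in_sector) auto
    then show "rcis (e / 2) ?\<theta> \<noteq> 0"
      using zero_notin_sector by metis
    show "dist (rcis (e / 2) ?\<theta>) 0 < e"
      using that by simp
  qed
  then have "0 islimpt sector a b"
    unfolding islimpt_approachable by blast
  then show ?thesis
    using trivial_limit_within by blast
qed


section \<open>Growth of subadditive functions\<close>

text \<open>Fekete's lemma with a real parameter. The limit may be minus infinity, hence the
  extended reals. For t with f t / t close to the infimum, write r = k t + s with s between t and 2
  t and use subadditivity k times.\<close>

lemma fekete_real:
  fixes f :: "real \<Rightarrow> real"
  assumes sub: "\<And>r s. \<lbrakk>0 < r; 0 < s\<rbrakk> \<Longrightarrow> f (r + s) \<le> f r + f s"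
    and bdd: "\<And>t. 0 < t \<Longrightarrow> \<exists>M. \<forall>s\<in>{t..2 * t}. f s \<le> M"
  shows "((\<lambda>r. ereal (f r / r)) \<longlongrightarrow> (INF r\<in>{0<..}. ereal (f r / r))) at_top"
proof (rule order_tendstoI)
  let ?l = "INF r\<in>{0<..}. ereal (f r / r)"
  fix c assume c: "c < ?l"
  have "\<forall>\<^sub>F r in at_top. (0::real) < r"
    by (rule eventually_gt_at_top)
  then show "\<forall>\<^sub>F r in at_top. c < ereal (f r / r)"
  proof eventually_elim
    case (elim r)
    then have "?l \<le> ereal (f r / r)"
      by (intro INF_lower) auto
    then show ?case
      using c by (rule order_less_le_trans[rotated])
  qed
next
  let ?l = "INF r\<in>{0<..}. ereal (f r / r)"
  fix c assume "?l < c"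
  then obtain t where t: "0 < t" "ereal (f t / t) < c"
    by (auto simp: INF_less_iff)
  obtain M where "\<forall>s\<in>{t..2 * t}. f s \<le> M"
    using bdd[OF t(1)] by blast
  then have M: "f s \<le> M" if "t \<le> s" "s \<le> 2 * t" for s
    using that by simp
  have multiple: "f (real k * t + s) \<le> real k * f t + f s" if "0 < s" for k s
  proof (induction k)
    case (Suc k)
    have "f (real (Suc k) * t + s) = f (t + (real k * t + s))"
      by (simp add: algebra_simps)
    also have "\<dots> \<le> f t + f (real k * t + s)"
      using t(1) that by (intro sub add_nonneg_pos) auto
    finally show ?case
      using Suc by (simp add: algebra_simps)
  qed simp
  \<comment> \<open>Collects what the remainder s contributes: the term s f(t) / t with s at most 2
    t, and the local bound on f s. It disappears after division by r.\<close>
  define D where "D = \<bar>f t / t\<bar> * (2 * t) + \<bar>M\<bar>"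
  have upper: "f r / r \<le> f t / t + D / r" if "t \<le> r" for r
  proof -
    \<comment> \<open>Subtracting 1 from the integer part keeps the remainder s at least t, where
      the local bound applies; otherwise s could be arbitrarily small or 0.\<close>
    define k where "k = nat (\<lfloor>r / t\<rfloor> - 1)"
    define s where "s = r - real k * t"
    have r: "0 < r"
      using t(1) that by linarith
    have "1 \<le> r / t"
      using t(1) that by simp
    then have "1 \<le> \<lfloor>r / t\<rfloor>"
      by linarith
    then have k: "real k = of_int \<lfloor>r / t\<rfloor> - 1"
      unfolding k_def by linarith
    have "real k + 1 \<le> r / t" "r / t < real k + 2"
      unfolding k by linarith+
    then have "(real k + 1) * t \<le> r" "r < (real k + 2) * t"
      unfolding pos_le_divide_eq[OF t(1)] pos_divide_less_eq[OF t(1)] .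
    then have s: "t \<le> s" "s \<le> 2 * t"
      by (simp_all add: s_def algebra_simps)
    have "f r \<le> real k * f t + f s"
      using multiple[of s k] s(1) t(1) by (simp add: s_def)
    also have "\<dots> \<le> real k * f t + \<bar>M\<bar>"
      using M[OF s] by simp
    also have "real k * f t = r * (f t / t) - s * (f t / t)"
      using t(1) by (simp add: s_def field_simps)
    finally have 1: "f r \<le> r * (f t / t) - s * (f t / t) + \<bar>M\<bar>" .
    have 2: "- (s * (f t / t)) \<le> \<bar>f t / t\<bar> * (2 * t)"
    proof -
      have "- (s * (f t / t)) \<le> \<bar>s * (f t / t)\<bar>"
        by (rule abs_ge_minus_self)
      also have "\<dots> = s * \<bar>f t / t\<bar>"
        using s(1) t(1) by (simp only: abs_mult)
      also have "\<dots> \<le> \<bar>f t / t\<bar> * (2 * t)"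
        unfolding mult.commute[of s] using s(2) by (intro mult_left_mono) auto
      finally show ?thesis .
    qed
    have "f r \<le> r * (f t / t) + D"
      using 1 2 unfolding D_def by linarith
    then have "f r / r \<le> (r * (f t / t) + D) / r"
      using r by (intro divide_right_mono) auto
    then show ?thesis
      using r by (simp add: add_divide_distrib)
  qed
  have "((\<lambda>r. D / r) \<longlongrightarrow> 0) at_top"
    by (rule real_tendsto_divide_at_top[OF tendsto_const filterlim_ident])
  then have "((\<lambda>r. ereal (f t / t + D / r)) \<longlongrightarrow> ereal (f t / t + 0)) at_top"
    by (intro tendsto_ereal tendsto_add[OF tendsto_const])
  then have "\<forall>\<^sub>F r in at_top. ereal (f t / t + D / r) < c"
    using t(2) order_tendstoD(2) by fastforce
  then show "\<forall>\<^sub>F r in at_top. ereal (f r / r) < c"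
    using eventually_ge_at_top[of t]
  proof eventually_elim
    case (elim r)
    then show ?case
      using upper[of r] by (meson ereal_less_eq(3) order_le_less_trans)
  qed
qed

text \<open>\<open>Lim\<close> is a description that says nothing unless the limit exists, so
  convergence for f and g has to be known first. The maximum then converges too, and the strict
  inequality holds eventually.\<close>

lemma eventually_less_if_Lim_max_less:
  fixes f g :: "real \<Rightarrow> real"
  assumes f: "((\<lambda>r. ereal (ln (f r) / r)) \<longlongrightarrow> l) at_top" and g: "((\<lambda>r. ereal (ln (g r) / r)) \<longlongrightarrow> l') at_top"
    and pos: "\<And>r. 0 < r \<Longrightarrow> 0 < f r \<and> 0 < g r"
    and less: "ereal (1 / c) * Lim at_top (\<lambda>r. ereal (ln (max (f r) (g r)) / r)) < ereal \<mu>" and c: "0 < c"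
  shows "\<forall>\<^sub>F r in at_top. f r \<le> exp (\<mu> * c * r) \<and> g r \<le> exp (\<mu> * c * r)"
proof -
  let ?h = "\<lambda>r. ereal (ln (max (f r) (g r)) / r)"
  have eq: "\<forall>\<^sub>F r in at_top. max (ereal (ln (f r) / r)) (ereal (ln (g r) / r)) = ?h r"
    using eventually_gt_at_top[of "0 :: real"]
  proof eventually_elim
    case (elim r)
    then show ?case
      using pos[OF elim] by (auto simp: max_def divide_le_cancel)
  qed
  have "((\<lambda>r. max (ereal (ln (f r) / r)) (ereal (ln (g r) / r))) \<longlongrightarrow> max l l') at_top"
    by (rule tendsto_max[OF f g])
  then have "(?h \<longlongrightarrow> max l l') at_top"
    by (rule Lim_transform_eventually[OF _ eq])
  moreover from this have "Lim at_top ?h = max l l'"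
    by (intro tendsto_Lim) auto
  ultimately have lim: "(?h \<longlongrightarrow> Lim at_top ?h) at_top"
    by simp
  \<comment> \<open>The limit can be minus infinity, so multiplying by c needs a case distinction in
    the extended reals.\<close>
  have "Lim at_top ?h < ereal (\<mu> * c)"
    using less c by (cases "Lim at_top ?h") (auto simp: field_simps split: if_splits)
  then have "\<forall>\<^sub>F r in at_top. ?h r < ereal (\<mu> * c)"
    by (rule order_tendstoD(2)[OF lim])
  then show ?thesis
    using eventually_gt_at_top[of "0 :: real"]
  proof eventually_elim
    case (elim r)
    have "ln (max (f r) (g r)) < \<mu> * c * r"
      using elim by (simp add: field_simps)
    then have "max (f r) (g r) < exp (\<mu> * c * r)"
      using pos[OF elim(2)] by (metis exp_less_mono exp_ln less_max_iff_disj)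
    then show ?case
      by simp
  qed
qed


section \<open>Holomorphic semigroups of multipliers\<close>

locale holomorphic_multiplier_semigroup = wc_algebra A for A :: "'a normed_alg" (structure) +
  fixes a b :: real and T :: "complex \<Rightarrow> 'a \<Rightarrow> 'a"
  assumes a_less_b: "a < b" and b_le: "b \<le> a + pi"
    and holomorphic: "holomorphic_semigroup A a b T"
    and T_dense: "\<zeta> \<in> sector a b \<Longrightarrow> dense_in A (T \<zeta> ` carrier A)"
begin

sublocale MA: normed_algebra "mult_alg A"
  by (rule normed_algebra_mult_alg)

abbreviation "nT \<zeta> \<equiv> nrm (mult_alg A) (T \<zeta>)"
abbreviation "\<delta> \<equiv> cis ((a + b) / 2)"

lemma T_multiplier: "\<zeta> \<in> sector a b \<Longrightarrow> T \<zeta> \<in> multipliers A"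
  using holomorphic by (simp add: holomorphic_semigroup_def)

lemma T_add:
  "\<lbrakk>\<zeta> \<in> sector a b; \<eta> \<in> sector a b\<rbrakk> \<Longrightarrow> T (\<zeta> + \<eta>) = compose (carrier A) (T \<zeta>) (T \<eta>)"
  using holomorphic by (simp add: holomorphic_semigroup_def)

lemma T_add_apply:
  "\<lbrakk>\<zeta> \<in> sector a b; \<eta> \<in> sector a b; x \<in> carrier A\<rbrakk> \<Longrightarrow> T (\<zeta> + \<eta>) x = T \<zeta> (T \<eta> x)"
  by (simp add: T_add compose_def)

lemmas sector_plus = sector_add[OF a_less_b b_le]

lemma \<delta>_scale_in_sector: "0 < t \<Longrightarrow> of_real t * \<delta> \<in> sector a b"
  using rcis_in_sector[of t a "(a + b) / 2" b] a_less_b by (simp add: rcis_def)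

lemma \<delta>_in_sector: "\<delta> \<in> sector a b"
  using \<delta>_scale_in_sector[of 1] by simp

lemma nT_add_le: "\<lbrakk>\<zeta> \<in> sector a b; \<eta> \<in> sector a b\<rbrakk> \<Longrightarrow> nT (\<zeta> + \<eta>) \<le> nT \<zeta> * nT \<eta>"
  using multipliers_compose(2)[OF T_multiplier T_multiplier] by (simp add: T_add)

text \<open>Needed to take logarithms. If some \<open>T \<zeta>\<close> vanished, its dense range
  would be zero and every element would annihilate the algebra.\<close>

lemma nT_pos:
  assumes "\<zeta> \<in> sector a b"
  shows "0 < nT \<zeta>"
proof -
  have "nT \<zeta> \<noteq> 0"
  proof
    assume 0: "nT \<zeta> = 0"
    have "T \<zeta> x = \<zero>" if "x \<in> carrier A" for x
      using nrm_multiplier[OF T_multiplier[OF assms] that] 0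
        nrm_nonneg[OF multipliersD(1)[OF T_multiplier[OF assms] that]]
        nrm_eq_0_iff[OF multipliersD(1)[OF T_multiplier[OF assms] that]] by simp
    then have "u \<otimes> d = \<zero>" if "u \<in> carrier A" "d \<in> T \<zeta> ` carrier A" for u d
      using that by auto
    then have "u = \<zero>" if "u \<in> carrier A" for u
      by (rule mult_dense_eq_zeroD[OF T_dense[OF assms] that]) (use that in simp_all)
    then show False
      using weakly_cancellativeD(4)[OF wc] by blast
  qed
  then show ?thesis
    using nrm_mult_alg_nonneg[OF T_multiplier[OF assms]] by simp
qed

text \<open>The difference is (\<eta> - \<zeta>) times the difference quotient, whose norm is at
  most that of \<open>D\<close> plus an error tending to 0.\<close>

lemma T_diff_tendsto:
  assumes "\<zeta> \<in> sector a b"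
  shows "((\<lambda>\<eta>. nrm (mult_alg A) (T \<eta> \<ominus>\<^bsub>mult_alg A\<^esub> T \<zeta>)) \<longlongrightarrow> 0) (at \<zeta> within sector a b)"
proof -
  let ?F = "at \<zeta> within sector a b" and ?M = "mult_alg A"
  obtain D where D: "D \<in> multipliers A"
    "((\<lambda>\<eta>. nrm ?M ((1 / (\<eta> - \<zeta>)) \<odot>\<^bsub>?M\<^esub> (T \<eta> \<ominus>\<^bsub>?M\<^esub> T \<zeta>) \<ominus>\<^bsub>?M\<^esub> D)) \<longlongrightarrow> 0) ?F"
    (is "(?q \<longlongrightarrow> 0) ?F")
    using holomorphic assms by (auto simp: holomorphic_semigroup_def)
  have "((\<lambda>\<eta>. cmod (\<eta> - \<zeta>) * (nrm ?M D + ?q \<eta>)) \<longlongrightarrow> cmod (\<zeta> - \<zeta>) * (nrm ?M D + 0)) ?F"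
    by (intro tendsto_intros D(2))
  then have lim: "((\<lambda>\<eta>. cmod (\<eta> - \<zeta>) * (nrm ?M D + ?q \<eta>)) \<longlongrightarrow> 0) ?F"
    by simp
  have in_sector: "\<forall>\<^sub>F \<eta> in ?F. \<eta> \<in> sector a b \<and> \<eta> \<noteq> \<zeta>"
    by (simp add: eventually_at_filter)
  have "\<forall>\<^sub>F \<eta> in ?F. norm (nrm ?M (T \<eta> \<ominus>\<^bsub>?M\<^esub> T \<zeta>)) \<le> cmod (\<eta> - \<zeta>) * (nrm ?M D + ?q \<eta>)"
    using in_sector
  proof eventually_elim
    case (elim \<eta>)
    let ?d = "T \<eta> \<ominus>\<^bsub>?M\<^esub> T \<zeta>" and ?c = "1 / (\<eta> - \<zeta>)"
    have d: "?d \<in> carrier ?M"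
      using elim assms T_multiplier by (intro MA.diff_closed) auto
    have "nrm ?M (?c \<odot>\<^bsub>?M\<^esub> ?d) \<le> nrm ?M D + ?q \<eta>"
      using d D(1) by (intro MA.nrm_le_add_diff MA.scale_closed) auto
    moreover have "nrm ?M (?c \<odot>\<^bsub>?M\<^esub> ?d) = nrm ?M ?d / cmod (\<eta> - \<zeta>)"
      using MA.nrm_smult[OF d, of ?c] by (simp add: norm_divide del: mult_alg_sel)
    ultimately have "nrm ?M ?d / cmod (\<eta> - \<zeta>) \<le> nrm ?M D + ?q \<eta>"
      by (simp only:)
    then have "nrm ?M ?d \<le> cmod (\<eta> - \<zeta>) * (nrm ?M D + ?q \<eta>)"
      using elim by (simp add: pos_divide_le_eq mult.commute del: mult_alg_sel)
    then show ?case
      using MA.nrm_nonneg[OF d] by simp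
  qed
  then show ?thesis
    by (rule Lim_null_comparison[OF _ lim])
qed

lemma continuous_on_nT: "continuous_on (sector a b) nT"
  unfolding continuous_on_def
proof
  fix \<zeta> assume \<zeta>: "\<zeta> \<in> sector a b"
  have in_sector: "\<forall>\<^sub>F \<eta> in at \<zeta> within sector a b. \<eta> \<in> sector a b"
    by (simp add: eventually_at_filter)
  have "\<forall>\<^sub>F \<eta> in at \<zeta> within sector a b.
      norm (nT \<eta> - nT \<zeta>) \<le> nrm (mult_alg A) (T \<eta> \<ominus>\<^bsub>mult_alg A\<^esub> T \<zeta>)"
    using in_sector
    by eventually_elim (use MA.abs_nrm_diff T_multiplier \<zeta> in simp)
  then have "((\<lambda>\<eta>. nT \<eta> - nT \<zeta>) \<longlongrightarrow> 0) (at \<zeta> within sector a b)"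
    by (rule Lim_null_comparison[OF _ T_diff_tendsto[OF \<zeta>]])
  then show "(nT \<longlongrightarrow> nT \<zeta>) (at \<zeta> within sector a b)"
    by (simp add: LIM_zero_iff)
qed

lemma nT_bounded_on_compact:
  assumes "compact Q" "Q \<subseteq> sector a b"
  obtains M where "\<And>\<zeta>. \<zeta> \<in> Q \<Longrightarrow> nT \<zeta> \<le> M"
proof -
  have "bounded (nT ` Q)"
    by (intro compact_imp_bounded compact_continuous_image assms(1)
        continuous_on_subset[OF continuous_on_nT assms(2)])
  then obtain M where "\<forall>y\<in>nT ` Q. \<bar>y\<bar> \<le> M"
    by (auto simp: bounded_iff)
  then show ?thesis
    using that[of M] by force
qed

text \<open>Along a ray the logarithm of the norm is subadditive, and continuity in norm on compact
  segments supplies the local bound for \<open>fekete_real\<close>.\<close>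

lemma ln_nT_tendsto:
  assumes "a < \<theta>" "\<theta> < b"
  shows "\<exists>l. ((\<lambda>r. ereal (ln (nT (rcis r \<theta>)) / r)) \<longlongrightarrow> l) at_top"
proof -
  have ray: "rcis r \<theta> \<in> sector a b" if "0 < r" for r
    using that assms by (rule rcis_in_sector)
  have add: "rcis (r + s) \<theta> = rcis r \<theta> + rcis s \<theta>" for r s
    by (simp add: rcis_def distrib_right)
  have "((\<lambda>r. ereal (ln (nT (rcis r \<theta>)) / r)) \<longlongrightarrow>
      (INF r\<in>{0<..}. ereal (ln (nT (rcis r \<theta>)) / r))) at_top"
  proof (rule fekete_real)
    show "ln (nT (rcis (r + s) \<theta>)) \<le> ln (nT (rcis r \<theta>)) + ln (nT (rcis s \<theta>))" if "0 < r" "0 < s" for r s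
    proof -
      have "ln (nT (rcis (r + s) \<theta>)) \<le> ln (nT (rcis r \<theta>) * nT (rcis s \<theta>))"
        unfolding add using ray that nT_pos sector_plus nT_add_le by (subst ln_le_cancel_iff) auto
      also have "\<dots> = ln (nT (rcis r \<theta>)) + ln (nT (rcis s \<theta>))"
        using ray that nT_pos by (intro ln_mult_pos) auto
      finally show ?thesis .
    qed
    fix t :: real assume t: "0 < t"
    have "compact ((\<lambda>r. rcis r \<theta>) ` {t..2 * t})"
      unfolding rcis_def by (intro compact_continuous_image continuous_intros) simp
    moreover have "(\<lambda>r. rcis r \<theta>) ` {t..2 * t} \<subseteq> sector a b"
      using ray t by auto
    ultimately obtain M where M: "\<And>\<zeta>. \<zeta> \<in> (\<lambda>r. rcis r \<theta>) ` {t..2 * t} \<Longrightarrow> nT \<zeta> \<le> M"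
      using nT_bounded_on_compact by blast
    have "ln (nT (rcis s \<theta>)) \<le> M" if "s \<in> {t..2 * t}" for s
    proof -
      have "nT (rcis s \<theta>) \<le> M" "0 < nT (rcis s \<theta>)"
        using M[of "rcis s \<theta>"] nT_pos[OF ray[of s]] that t by auto
      then show ?thesis
        using ln_bound[of "nT (rcis s \<theta>)"] by simp
    qed
    then show "\<exists>M. \<forall>s\<in>{t..2 * t}. ln (nT (rcis s \<theta>)) \<le> M"
      by blast
  qed
  then show ?thesis ..
qed

lemma eventually_nT_le_exp:
  assumes "a < \<theta>" "\<theta> < b" "a < \<theta>'" "\<theta>' < b" "0 < c"
    and "ereal (1 / c) * Lim at_top (\<lambda>r. ereal (ln (max (nT (rcis r \<theta>)) (nT (rcis r \<theta>'))) / r)) < ereal \<nu>"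
  shows "\<forall>\<^sub>F r in at_top. nT (rcis r \<theta>) \<le> exp (\<nu> * c * r) \<and> nT (rcis r \<theta>') \<le> exp (\<nu> * c * r)"
proof -
  obtain l l' where "((\<lambda>r. ereal (ln (nT (rcis r \<theta>)) / r)) \<longlongrightarrow> l) at_top"
    "((\<lambda>r. ereal (ln (nT (rcis r \<theta>')) / r)) \<longlongrightarrow> l') at_top"
    using ln_nT_tendsto[OF assms(1,2)] ln_nT_tendsto[OF assms(3,4)] by blast
  then show ?thesis
    by (rule eventually_less_if_Lim_max_less[OF _ _ _ assms(6,5)])
      (use assms in \<open>auto intro: nT_pos rcis_in_sector\<close>)
qed

text \<open>The shift by \<eta> keeps the ray away from the origin, where the norms may be
  unbounded. What remains is a compact initial segment and a part where the exponential bound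
  already holds.\<close>

lemma nT_ray_bound:
  assumes "a < \<theta>" "\<theta> < b" "\<forall>\<^sub>F r in at_top. nT (rcis r \<theta>) \<le> exp (\<nu> * r)" "\<eta> \<in> sector a b"
  obtains M where "0 \<le> M" "\<And>r. 0 \<le> r \<Longrightarrow> nT (rcis r \<theta> + \<eta>) \<le> M * exp (\<nu> * r)"
proof -
  obtain R0 where R0: "\<And>r. R0 \<le> r \<Longrightarrow> nT (rcis r \<theta>) \<le> exp (\<nu> * r)"
    using assms(3) by (auto simp: eventually_at_top_linorder)
  define R where "R = max R0 1"
  have in_sector: "rcis r \<theta> + \<eta> \<in> sector a b" if "0 \<le> r" for r
    using that assms sector_plus[OF rcis_in_sector[of r a \<theta> b] assms(4)] by (cases "r = 0") auto
  have "compact ((\<lambda>r. rcis r \<theta> + \<eta>) ` {0..R})"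
    unfolding rcis_def by (intro compact_continuous_image continuous_intros) simp
  moreover have "(\<lambda>r. rcis r \<theta> + \<eta>) ` {0..R} \<subseteq> sector a b"
    using in_sector by auto
  ultimately obtain M where M: "\<And>\<zeta>. \<zeta> \<in> (\<lambda>r. rcis r \<theta> + \<eta>) ` {0..R} \<Longrightarrow> nT \<zeta> \<le> M"
    using nT_bounded_on_compact by blast
  \<comment> \<open>The first summand covers r up to R, where exp(|\<nu>| R) compensates a possibly
    small exp(\<nu> r); the second covers larger r.\<close>
  define M' where "M' = \<bar>M\<bar> * exp (\<bar>\<nu>\<bar> * R) + nT \<eta>"
  have nonneg: "0 \<le> nT \<eta>" "0 \<le> \<bar>M\<bar> * exp (\<bar>\<nu>\<bar> * R)"
    using nT_pos[OF assms(4)] by simp_all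
  have "nT (rcis r \<theta> + \<eta>) \<le> M' * exp (\<nu> * r)" if r: "0 \<le> r" for r
  proof (cases "r \<le> R")
    case True
    have "1 \<le> exp (\<bar>\<nu>\<bar> * R) * exp (\<nu> * r)"
    proof -
      have "- (\<nu> * r) \<le> \<bar>\<nu> * r\<bar>"
        by simp
      also have "\<dots> \<le> \<bar>\<nu>\<bar> * R"
        using True r by (simp add: abs_mult mult_left_mono)
      finally show ?thesis
        by (simp flip: exp_add)
    qed
    then have "\<bar>M\<bar> * 1 \<le> \<bar>M\<bar> * (exp (\<bar>\<nu>\<bar> * R) * exp (\<nu> * r))"
      by (intro mult_left_mono) auto
    moreover have "nT (rcis r \<theta> + \<eta>) \<le> M"
      using M True r by auto
    moreover have "0 \<le> nT \<eta> * exp (\<nu> * r)"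
      using nonneg by simp
    ultimately show ?thesis
      by (simp add: M'_def algebra_simps)
  next
    case False
    then have r': "0 < r" "R0 \<le> r"
      by (auto simp: R_def)
    have "nT (rcis r \<theta> + \<eta>) \<le> nT (rcis r \<theta>) * nT \<eta>"
      using r' assms by (intro nT_add_le rcis_in_sector) auto
    also have "\<dots> \<le> exp (\<nu> * r) * nT \<eta>"
      using R0[OF r'(2)] nonneg by (intro mult_right_mono) auto
    also have "\<dots> \<le> M' * exp (\<nu> * r)"
      using nonneg by (simp add: M'_def algebra_simps)
    finally show ?thesis .
  qed
  then show ?thesis
    using that[of M'] nonneg by (simp add: M'_def)
qed

end

section \<open>The two normalizations\<close>

context wc_algebra
begin

lemma multiplier_compose_one: "r \<in> multipliers A \<Longrightarrow> compose (carrier A) r (\<lambda>x\<in>carrier A. x) = r"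
  and one_compose_multiplier: "r \<in> multipliers A \<Longrightarrow> compose (carrier A) (\<lambda>x\<in>carrier A. x) r = r"
  by (rule extensionalityI[where A = "carrier A"]; simp add: compose_def multipliersD(1,2))+

lemma multiplier_compose_assoc:
  assumes "r \<in> multipliers A" "r' \<in> multipliers A" "r'' \<in> multipliers A"
  shows "compose (carrier A) (compose (carrier A) r r') r'' = compose (carrier A) r (compose (carrier A) r' r'')"
  using normed_algebra.mult_assoc[OF normed_algebra_mult_alg] assms by simp

lemma compose_swap:
  assumes "r1 \<in> multipliers A" "r2 \<in> multipliers A" "s1 \<in> multipliers A" "s2 \<in> multipliers A"
  shows "compose (carrier A) (compose (carrier A) r1 r2) (compose (carrier A) s1 s2) =
    compose (carrier A) (compose (carrier A) r1 s1) (compose (carrier A) r2 s2)"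
  using assms multipliersD(1) multipliers_commute[OF assms(2,3)]
  by (auto simp: compose_def multipliersD(1) intro!: restrict_ext)

lemma scale_compose:
  assumes "r \<in> multipliers A" "r' \<in> multipliers A"
  shows "compose (carrier A) (c \<odot>\<^bsub>mult_alg A\<^esub> r) r' = c \<odot>\<^bsub>mult_alg A\<^esub> compose (carrier A) r r'"
  using normed_algebra.smult_mult_l[OF normed_algebra_mult_alg, of r r' c] assms by simp

end

lemma norm_scalar_factor:
  "norm (exp (- complex_of_real m * \<zeta> * c)) = exp (- m * Re (\<zeta> * c))"
  unfolding norm_exp_eq_Re by (simp add: mult.assoc)

text \<open>For n = 0 the sector degenerates to its bisector, so the growth hypothesis with n = 0
  concerns \<open>T_zero\<close> itself and its cosine is 1.\<close>

lemma alpha_beta_seq_zero: "alpha_seq a b 0 = (a + b) / 2" "beta_seq a b 0 = (a + b) / 2"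
  by (simp_all add: alpha_seq_def beta_seq_def field_simps)

lemma alpha_beta_seq:
  assumes "a < b" "b \<le> a + pi"
  shows "a < alpha_seq a b n" "beta_seq a b n < b" "alpha_seq a b n + beta_seq a b n = a + b"
    "beta_seq a b n < alpha_seq a b n + pi" "alpha_seq a b n \<le> beta_seq a b n"
    "1 \<le> n \<Longrightarrow> alpha_seq a b n < beta_seq a b n"
proof -
  define d where "d = (b - a) / (2 * (real n + 1))"
  have eq: "alpha_seq a b n = a + d" "beta_seq a b n = b - d"
    by (simp_all add: alpha_seq_def beta_seq_def d_def)
  have d: "0 < d" "d * (2 * (real n + 1)) = b - a"
    using assms(1) by (simp_all add: d_def)
  have "d * (2 * 1) \<le> d * (2 * (real n + 1))"
    using d(1) by (intro mult_left_mono) auto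
  then show "a < alpha_seq a b n" "beta_seq a b n < b" "alpha_seq a b n + beta_seq a b n = a + b"
    "beta_seq a b n < alpha_seq a b n + pi" "alpha_seq a b n \<le> beta_seq a b n"
    unfolding eq using d assms by linarith+
  assume "1 \<le> n"
  then have "d * (2 * 2) \<le> d * (2 * (real n + 1))"
    using d(1) by (intro mult_left_mono) auto
  then show "alpha_seq a b n < beta_seq a b n"
    unfolding eq using d by linarith
qed

locale normalized_semigroup = holomorphic_multiplier_semigroup A a b T
  for A :: "'a normed_alg" (structure) and a b T +
  fixes \<mu> :: "nat \<Rightarrow> real"
  assumes mu_pos: "0 < \<mu> n"
    and mu_growth: "ereal (1 / cos ((beta_seq a b n - alpha_seq a b n) / 2)) *
      Lim at_top (\<lambda>r. ereal (ln (max (nrm (mult_alg A) (T (rcis r (alpha_seq a b n))))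
        (nrm (mult_alg A) (T (rcis r (beta_seq a b n))))) / r)) < ereal (\<mu> n)"
    and mu_L0: "\<lbrakk>1 \<le> n; \<zeta> \<in> closed_sector (alpha_seq a b n) (beta_seq a b n)\<rbrakk> \<Longrightarrow>
      nrm (mult_alg (L_T0 A a b T \<mu>)) (act_L_T0 A a b T \<mu>
        (exp (- of_real (\<mu> n) * \<zeta> * cis (- (a + b) / 2)) \<odot>\<^bsub>mult_alg A\<^esub>
          T (\<zeta> + of_real ((1 / 2) ^ n) * cis ((a + b) / 2))))
      \<le> exp ((1 / 2) ^ n * (\<mu> 0 + 1))"
begin

abbreviation "\<alpha> \<equiv> alpha_seq a b"
abbreviation "\<beta> \<equiv> beta_seq a b"
abbreviation "T' \<equiv> semigroup0 A T"
abbreviation "L0 \<equiv> L_T0 A a b T \<mu>"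
abbreviation "A0 \<equiv> A_T0 A a b T \<mu>"
abbreviation "act0 \<equiv> act_L_T0 A a b T \<mu>"
abbreviation "W \<equiv> W_set A a b T \<mu>"
abbreviation "re \<zeta> \<equiv> Re (\<zeta> * cis (- (a + b) / 2))"
abbreviation "scalar n \<zeta> \<equiv> exp (- complex_of_real (\<mu> n) * \<zeta> * cis (- (a + b) / 2))"

lemmas seq_bounds = alpha_beta_seq[OF a_less_b b_le]

lemma nT_ray:
  "\<forall>\<^sub>F r in at_top. nT (rcis r (\<alpha> n)) \<le> exp (\<mu> n * cos ((\<beta> n - \<alpha> n) / 2) * r) \<and>
    nT (rcis r (\<beta> n)) \<le> exp (\<mu> n * cos ((\<beta> n - \<alpha> n) / 2) * r)"
proof (rule eventually_nT_le_exp[OF _ _ _ _ _ mu_growth])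
  show "a < \<alpha> n" "\<alpha> n < b" "a < \<beta> n" "\<beta> n < b"
    using seq_bounds(1,2,5)[of n] by linarith+
  show "0 < cos ((\<beta> n - \<alpha> n) / 2)"
  proof (rule cos_gt_zero_pi)
    have "0 \<le> (\<beta> n - \<alpha> n) / 2"
      using seq_bounds(5)[of n] by simp
    then show "- (pi / 2) < (\<beta> n - \<alpha> n) / 2"
      using pi_half_gt_zero by linarith
    show "(\<beta> n - \<alpha> n) / 2 < pi / 2"
      using seq_bounds(4)[of n] by (intro divide_strict_right_mono) auto
  qed
qed

lemma T'_zero [simp]: "T' 0 = (\<lambda>x\<in>carrier A. x)"
  by (simp add: semigroup0_def)

lemma T'_sector: "\<zeta> \<in> sector a b \<Longrightarrow> T' \<zeta> = T \<zeta>"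
  using zero_notin_sector by (auto simp: semigroup0_def)

lemma T'_multiplier: "\<zeta> \<in> insert 0 (sector a b) \<Longrightarrow> T' \<zeta> \<in> multipliers A"
  using T_multiplier T'_sector multipliers_one by auto

lemma T'_add:
  assumes "\<zeta> \<in> insert 0 (sector a b)" "\<eta> \<in> insert 0 (sector a b)"
  shows "T' (\<zeta> + \<eta>) = compose (carrier A) (T' \<zeta>) (T' \<eta>)"
proof (cases "\<zeta> = 0 \<or> \<eta> = 0")
  case True
  then show ?thesis
    using T'_multiplier[OF assms(1)] T'_multiplier[OF assms(2)] multiplier_compose_one one_compose_multiplier by auto
next
  case False
  then show ?thesis
    using assms T'_sector sector_plus T_add by simp
qed

lemma T_zero_eq: "T_zero A a b T s = T' (of_real s * \<delta>)"
  by (simp add: T_zero_def)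

lemma \<delta>_scale_in_sector0: "0 \<le> s \<Longrightarrow> of_real s * \<delta> \<in> insert 0 (sector a b)"
  using \<delta>_scale_in_sector[of s] by (cases "s = 0") auto

lemma T_zero_multiplier: "0 \<le> s \<Longrightarrow> T_zero A a b T s \<in> multipliers A"
  using T'_multiplier[OF \<delta>_scale_in_sector0] by (simp add: T_zero_eq)

section \<open>First normalization, along the bisector\<close>

definition p0 :: "real \<Rightarrow> 'a \<Rightarrow> real" where
  "p0 s u = exp (- \<mu> 0 * s) * nrm A (T_zero A a b T s u)"

definition w0 :: "real \<Rightarrow> 'a \<Rightarrow> 'a" where
  "w0 s = of_real (exp (- \<mu> 0 * s)) \<odot>\<^bsub>mult_alg A\<^esub> T_zero A a b T s"

text \<open>Applying \<open>T \<eta>\<close> beforehand shifts the orbit away from time 0, so the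
  bound is uniform down to s = 0. It shows that \<open>T \<eta>\<close> maps \<open>A\<close> into
  \<open>L0\<close>.\<close>

lemma T_zero_bound:
  assumes "\<eta> \<in> sector a b"
  obtains M where "0 \<le> M" "\<And>s x. \<lbrakk>0 \<le> s; x \<in> carrier A\<rbrakk> \<Longrightarrow> p0 s (T \<eta> x) \<le> M * nrm A x"
proof -
  have mid: "a < (a + b) / 2" "(a + b) / 2 < b"
    using a_less_b by auto
  have "\<forall>\<^sub>F r in at_top. nT (rcis r ((a + b) / 2)) \<le> exp (\<mu> 0 * r)"
    using nT_ray[of 0] by (simp add: alpha_beta_seq_zero)
  then obtain M where M: "0 \<le> M"
    "\<And>r. 0 \<le> r \<Longrightarrow> nT (rcis r ((a + b) / 2) + \<eta>) \<le> M * exp (\<mu> 0 * r)"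
    using nT_ray_bound[OF mid _ assms] by blast
  have "p0 s (T \<eta> x) \<le> M * nrm A x" if s: "0 \<le> s" and x: "x \<in> carrier A" for s x
  proof -
    let ?\<zeta> = "of_real s * \<delta> + \<eta>"
    have \<zeta>: "?\<zeta> \<in> sector a b"
      using \<delta>_scale_in_sector0[OF s] assms sector_plus by auto
    have "T' ?\<zeta> x = T_zero A a b T s (T' \<eta> x)"
      unfolding T_zero_eq using T'_add[OF \<delta>_scale_in_sector0[OF s], of \<eta>] assms x
      by (simp add: compose_def)
    then have "T_zero A a b T s (T \<eta> x) = T ?\<zeta> x"
      using \<zeta> assms by (simp add: T'_sector)
    then have "p0 s (T \<eta> x) \<le> exp (- \<mu> 0 * s) * (nT ?\<zeta> * nrm A x)"
      unfolding p0_def using nrm_multiplier[OF T_multiplier[OF \<zeta>] x] by (simp add: mult_left_mono)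
    also have "\<dots> \<le> exp (- \<mu> 0 * s) * (M * exp (\<mu> 0 * s) * nrm A x)"
      using M(2)[OF s] nrm_nonneg[OF x] by (intro mult_left_mono mult_right_mono) (auto simp: rcis_def)
    also have "\<dots> = M * nrm A x"
      by (simp add: exp_minus)
    finally show ?thesis .
  qed
  then show ?thesis
    using that M(1) by blast
qed

lemma p0_eq: "\<lbrakk>0 \<le> s; u \<in> carrier A\<rbrakk> \<Longrightarrow> p0 s u = nrm A (w0 s u)"
  using multipliersD(1)[OF T_zero_multiplier]
  by (simp add: p0_def w0_def nrm_smult)

lemma p0_nonneg: "\<lbrakk>0 \<le> s; u \<in> carrier A\<rbrakk> \<Longrightarrow> 0 \<le> p0 s u"
  using nrm_nonneg[OF multipliersD(1)[OF T_zero_multiplier]] by (simp add: p0_def)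

text \<open>\<open>L_T0\<close> is defined by the behaviour at 0 alone, whereas
  \<open>orbit_algebra\<close> asks for a bounded weighted orbit over all times. The choice of
  \<open>\<mu> 0\<close> takes care of the times away from 0.\<close>

lemma Limsup_finite_iff_p0_bounded:
  assumes u: "u \<in> carrier A"
  shows "Limsup (at_right 0) (\<lambda>t. ereal (nrm A (T_zero A a b T t u))) < \<infinity> \<longleftrightarrow>
    bdd_above ((\<lambda>s. p0 s u) ` {0..})"
    (is "?L < \<infinity> \<longleftrightarrow> _")
proof
  assume "?L < \<infinity>"
  then obtain n where "?L < ereal (real n)"
    using less_PInf_Ex_of_nat by auto
  then have "\<forall>\<^sub>F t in at_right 0. ereal (nrm A (T_zero A a b T t u)) < ereal (real n)"
    by (rule Limsup_lessD)
  then obtain d where d: "0 < d" "\<And>t. \<lbrakk>0 < t; t < d\<rbrakk> \<Longrightarrow> nrm A (T_zero A a b T t u) < real n"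
    unfolding eventually_at_right_field by auto
  have h: "of_real (d / 2) * \<delta> \<in> sector a b"
    using \<delta>_scale_in_sector[of "d / 2"] d(1) by simp
  obtain M where M: "0 \<le> M"
    "\<And>s x. \<lbrakk>0 \<le> s; x \<in> carrier A\<rbrakk> \<Longrightarrow> p0 s (T (of_real (d / 2) * \<delta>) x) \<le> M * nrm A x"
    using T_zero_bound[OF h] by blast
  \<comment> \<open>One summand for each range of s: \<open>real n\<close> for 0 < s < d, the norm
    of u for s = 0, and the last one for s at least d.\<close>
  have "p0 s u \<le> real n + nrm A u + M * nrm A u" if s: "0 \<le> s" for s
  proof -
    consider "s = 0" | "0 < s" "s < d" | "d \<le> s"
      using s by linarith
    then show ?thesis
    proof cases
      case 1
      then show ?thesis
        using u M(1) nrm_nonneg[OF u] by (simp add: p0_def T_zero_eq)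
    next
      case 2
      have "p0 s u \<le> 1 * nrm A (T_zero A a b T s u)"
        unfolding p0_def using 2 mu_pos[of 0] nrm_nonneg[OF multipliersD(1)[OF T_zero_multiplier[OF s] u]]
        by (intro mult_right_mono) auto
      also have "\<dots> \<le> real n"
        using d(2)[OF 2] by simp
      finally show ?thesis
        using M(1) nrm_nonneg[OF u] by (simp add: add_increasing2)
    next
      case 3
      \<comment> \<open>Splitting off the time d/2 turns u into an element of the range of the
        semigroup, to which \<open>T_zero_bound\<close> applies.\<close>
      let ?s = "s - d / 2"
      have "of_real s * \<delta> = of_real ?s * \<delta> + of_real (d / 2) * \<delta>"
        by (simp add: algebra_simps)
      then have "T_zero A a b T s u = T_zero A a b T ?s (T (of_real (d / 2) * \<delta>) u)"
        unfolding T_zero_eq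
        using T'_add[OF \<delta>_scale_in_sector0[of ?s], of "of_real (d / 2) * \<delta>"] h T'_sector[OF h] 3 d(1) u
        by (simp add: compose_def)
      then have "p0 s u = exp (- \<mu> 0 * (d / 2)) * p0 ?s (T (of_real (d / 2) * \<delta>) u)"
        unfolding p0_def by (simp add: algebra_simps flip: exp_add)
      also have "\<dots> \<le> 1 * (M * nrm A u)"
        using M(2)[of ?s u] 3 d(1) u M(1) nrm_nonneg[OF u] mu_pos[of 0]
          p0_nonneg[of ?s, OF _ multipliersD(1)[OF T_multiplier[OF h] u]]
        by (intro mult_mono) auto
      finally show ?thesis
        using nrm_nonneg[OF u] by simp
    qed
  qed
  then show "bdd_above ((\<lambda>s. p0 s u) ` {0..})"
    by (intro bdd_aboveI2) auto
next
  assume "bdd_above ((\<lambda>s. p0 s u) ` {0..})"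
  then obtain K where K: "p0 s u \<le> K" if "0 \<le> s" for s
    by (auto simp: bdd_above_def)
  \<comment> \<open>For times below 1 removing the weight costs at most the factor
    exp(\<open>\<mu> 0\<close>).\<close>
  have "\<forall>\<^sub>F t in at_right 0. ereal (nrm A (T_zero A a b T t u)) \<le> ereal (exp (\<mu> 0) * \<bar>K\<bar>)"
    unfolding eventually_at_right_field
  proof (intro exI conjI allI impI)
    show "(0::real) < 1"
      by simp
    fix t :: real assume t: "0 < t" "t < 1"
    have "nrm A (T_zero A a b T t u) = exp (\<mu> 0 * t) * p0 t u"
      by (simp add: p0_def exp_minus)
    also have "\<dots> \<le> exp (\<mu> 0 * t) * \<bar>K\<bar>"
      using K[of t] t by (intro mult_left_mono) auto
    also have "\<dots> \<le> exp (\<mu> 0) * \<bar>K\<bar>"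
      using t mu_pos[of 0] by (intro mult_right_mono) auto
    finally show "ereal (nrm A (T_zero A a b T t u)) \<le> ereal (exp (\<mu> 0) * \<bar>K\<bar>)"
      by simp
  qed
  then have "?L \<le> ereal (exp (\<mu> 0) * \<bar>K\<bar>)"
    by (rule Limsup_bounded)
  then show "?L < \<infinity>"
    by auto
qed

lemma orbit_algebra_L0: "orbit_algebra A {0..} p0 w0 0 L0"
proof
  fix s u
  show "w0 s \<in> multipliers A" if "s \<in> {0..}"
    using MA.scale_closed[of "T_zero A a b T s"] T_zero_multiplier[of s] that
    unfolding w0_def by simp
  show "p0 s u = nrm A (w0 s u)" if "s \<in> {0..}" "u \<in> carrier A"
    using that p0_eq by simp
  show "p0 0 u = nrm A u" if "u \<in> carrier A"
    using that by (simp add: p0_def T_zero_eq)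
  have "{u \<in> carrier A. Limsup (at_right 0) (\<lambda>t. ereal (nrm A (T_zero A a b T t u))) < \<infinity>} =
      {u \<in> carrier A. bdd_above ((\<lambda>i. p0 i u) ` {0..})}"
    by (rule Collect_cong, rule conj_cong[OF refl], rule Limsup_finite_iff_p0_bounded)
  then show "L0 = A\<lparr>carrier := {u \<in> carrier A. bdd_above ((\<lambda>i. p0 i u) ` {0..})},
      nrm := \<lambda>u. SUP i\<in>{0..}. p0 i u\<rparr>"
    unfolding L_T0_def p0_def by simp
qed simp

lemma T_in_L0:
  assumes "\<eta> \<in> sector a b" "x \<in> carrier A"
  shows "T \<eta> x \<in> carrier L0"
proof -
  obtain M where "0 \<le> M"
    and M: "\<And>s x. \<lbrakk>0 \<le> s; x \<in> carrier A\<rbrakk> \<Longrightarrow> p0 s (T \<eta> x) \<le> M * nrm A x"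
    using T_zero_bound[OF assms(1)] by blast
  have "p0 s (T \<eta> x) \<le> M * nrm A x" if "s \<in> {0..}" for s
    using M[of s x] that assms(2) by simp
  then show ?thesis
    by (rule orbit_algebra.in_L_I(1)[OF orbit_algebra_L0 multipliersD(1)[OF T_multiplier[OF assms(1)] assms(2)]])
qed

lemma L0_dense: "dense_in A (carrier L0)"
proof (rule dense_in_superset[OF T_dense[OF \<delta>_in_sector]])
  show "T \<delta> ` carrier A \<subseteq> carrier L0"
    using T_in_L0[OF \<delta>_in_sector] by (rule image_subsetI)
  show "carrier L0 \<subseteq> carrier A"
    by (rule orbit_algebra.L_subset[OF orbit_algebra_L0])
qed

sublocale N0: normalization A "{0..}" p0 w0 0 L0 A0
  by (intro normalization.intro normalization_axioms.intro orbit_algebra_L0 wc_algebra_axioms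
      L0_dense) (simp add: A_T0_def)

lemma act0_eq: "act0 r = restrict r (carrier L0)"
  by (simp add: act_L_T0_def)

lemma act0_multiplier: "r \<in> multipliers A \<Longrightarrow> act0 r \<in> multipliers L0"
  unfolding act0_eq by (rule N0.restrict_multiplier)

lemma act0_compose:
  assumes "r \<in> multipliers A" "r' \<in> multipliers A"
  shows "act0 (compose (carrier A) r r') = compose (carrier L0) (act0 r) (act0 r')"
  unfolding act0_eq compose_def
  by (auto simp: fun_eq_iff restrict_def N0.multiplier_L(1)[OF assms(2)])

lemma act0_scale:
  "act0 (c \<odot>\<^bsub>mult_alg A\<^esub> r) = c \<odot>\<^bsub>mult_alg L0\<^esub> act0 r"
  unfolding act0_eq by (auto simp: fun_eq_iff restrict_def)

lemma act0_one: "act0 (\<lambda>x\<in>carrier A. x) = (\<lambda>x\<in>carrier L0. x)"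
  unfolding act0_eq by (auto simp: fun_eq_iff restrict_def)

section \<open>Norms of multipliers of \<open>A\<close> as operators on \<open>L0\<close>\<close>

abbreviation "n0 r \<equiv> nrm (mult_alg L0) (act0 r)"

lemma n0_nonneg: "r \<in> multipliers A \<Longrightarrow> 0 \<le> n0 r"
  by (rule N0.L.nrm_mult_alg_nonneg[OF act0_multiplier])

lemma n0_le: "r \<in> multipliers A \<Longrightarrow> n0 r \<le> nrm (mult_alg A) r"
  unfolding act0_eq by (rule N0.restrict_multiplier)

lemma n0_compose:
  "\<lbrakk>r \<in> multipliers A; r' \<in> multipliers A\<rbrakk> \<Longrightarrow> n0 (compose (carrier A) r r') \<le> n0 r * n0 r'"
  unfolding act0_compose by (rule N0.L.multipliers_compose(2)[OF act0_multiplier act0_multiplier])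

text \<open>\<open>T(t\<delta>)\<close> moves the orbit from time s to time s + t, and comparing the
  weights costs exp(t \<open>\<mu> 0\<close>). The norm on \<open>A\<close> does not enter, so the
  bound stays near 1 for small t.\<close>

lemma n0_T_ray:
  assumes "0 < t"
  shows "n0 (T (of_real t * \<delta>)) \<le> exp (\<mu> 0 * t)"
  unfolding act0_eq
proof (rule N0.nrm_restrict_multiplier_le[OF T_multiplier[OF \<delta>_scale_in_sector[OF assms]]])
  fix s :: real assume "s \<in> {0..}"
  then have s: "0 \<le> s"
    by simp
  have "p0 s (T (of_real t * \<delta>) u) \<le> exp (\<mu> 0 * t) * p0 (s + t) u" if "u \<in> carrier L0" for u
  proof -
    have u: "u \<in> carrier A"
      using that by simp
    have "of_real (s + t) * \<delta> = of_real s * \<delta> + of_real t * \<delta>"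
      by (simp add: algebra_simps)
    then have "T_zero A a b T (s + t) u = T_zero A a b T s (T (of_real t * \<delta>) u)"
      unfolding T_zero_eq
      using T'_add[OF \<delta>_scale_in_sector0[OF s] \<delta>_scale_in_sector0[of t]] assms u
        T'_sector[OF \<delta>_scale_in_sector[OF assms]] by (simp add: compose_def)
    moreover have "exp (- \<mu> 0 * s) = exp (\<mu> 0 * t) * exp (- \<mu> 0 * (s + t))"
      by (simp add: algebra_simps flip: exp_add)
    ultimately show ?thesis
      unfolding p0_def by simp
  qed
  then show "\<exists>k\<in>{0..}. \<forall>u\<in>carrier L0. p0 s (T (of_real t * \<delta>) u) \<le> exp (\<mu> 0 * t) * p0 k u"
    using s assms by (intro bexI[of _ "s + t"]) auto
qed simp

section \<open>The sets \<open>V_n\<close> and the product semigroup \<open>W\<close>\<close>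

abbreviation "V n \<zeta> \<equiv> scalar n \<zeta> \<odot>\<^bsub>mult_alg A\<^esub> T' \<zeta>"
abbreviation "cs n \<equiv> closed_sector (\<alpha> n) (\<beta> n)"

lemma cs_subset:
  assumes "1 \<le> n"
  shows "cs n \<subseteq> insert 0 (sector a b)"
  using closed_sector_subset[OF seq_bounds(1) seq_bounds(6)[OF assms] seq_bounds(2) b_le] by blast

lemma zero_in_cs: "1 \<le> n \<Longrightarrow> 0 \<in> cs n"
  using seq_bounds(4,6)[of n] by (intro zero_in_closed_sector) auto

lemma cs_add: "\<lbrakk>1 \<le> n; \<zeta> \<in> cs n; \<eta> \<in> cs n\<rbrakk> \<Longrightarrow> \<zeta> + \<eta> \<in> cs n"
  using seq_bounds(4,6)[of n] by (intro closed_sector_add) auto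

lemma V_set_eq: "V_set A a b T \<mu> n = V n ` cs n"
  by (auto simp: V_set_def)

lemma V_multiplier: "\<lbrakk>1 \<le> n; \<zeta> \<in> cs n\<rbrakk> \<Longrightarrow> V n \<zeta> \<in> multipliers A"
  using MA.scale_closed[of "T' \<zeta>" "scalar n \<zeta>"] T'_multiplier[of \<zeta>] cs_subset[of n] by auto

lemma scale_compose_scale:
  assumes "r \<in> multipliers A" "r' \<in> multipliers A"
  shows "compose (carrier A) (c \<odot>\<^bsub>mult_alg A\<^esub> r) (d \<odot>\<^bsub>mult_alg A\<^esub> r') =
    (c * d) \<odot>\<^bsub>mult_alg A\<^esub> compose (carrier A) r r'"
proof -
  have "compose (carrier A) (c \<odot>\<^bsub>mult_alg A\<^esub> r) (d \<odot>\<^bsub>mult_alg A\<^esub> r') =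
      c \<odot>\<^bsub>mult_alg A\<^esub> (r \<otimes>\<^bsub>mult_alg A\<^esub> (d \<odot>\<^bsub>mult_alg A\<^esub> r'))"
    using MA.smult_mult_l[of r "d \<odot>\<^bsub>mult_alg A\<^esub> r'" c] MA.scale_closed[of r' d] assms by simp
  also have "r \<otimes>\<^bsub>mult_alg A\<^esub> (d \<odot>\<^bsub>mult_alg A\<^esub> r') = d \<odot>\<^bsub>mult_alg A\<^esub> (r \<otimes>\<^bsub>mult_alg A\<^esub> r')"
    using MA.smult_mult_r[of r r' d] assms by simp
  also have "c \<odot>\<^bsub>mult_alg A\<^esub> (d \<odot>\<^bsub>mult_alg A\<^esub> (r \<otimes>\<^bsub>mult_alg A\<^esub> r')) =
      (c * d) \<odot>\<^bsub>mult_alg A\<^esub> (r \<otimes>\<^bsub>mult_alg A\<^esub> r')"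
    using MA.scale_assoc[of "r \<otimes>\<^bsub>mult_alg A\<^esub> r'" c d] MA.mult_closed[of r r'] assms by simp
  finally show ?thesis
    by (simp only: mult_alg_sel(2))
qed

lemma scalar_add: "scalar n (\<zeta> + \<eta>) = scalar n \<zeta> * scalar n \<eta>"
  by (simp add: algebra_simps flip: exp_add)

lemma V_add:
  assumes "1 \<le> n" "\<zeta> \<in> cs n" "\<eta> \<in> cs n"
  shows "compose (carrier A) (V n \<zeta>) (V n \<eta>) = V n (\<zeta> + \<eta>)"
proof -
  have s: "\<zeta> \<in> insert 0 (sector a b)" "\<eta> \<in> insert 0 (sector a b)"
    using assms cs_subset[OF assms(1)] by blast+
  show ?thesis
    unfolding scale_compose_scale[OF T'_multiplier[OF s(1)] T'_multiplier[OF s(2)]]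
      T'_add[OF s] scalar_add ..
qed

lemma V_zero: "V n 0 = (\<lambda>x\<in>carrier A. x)"
  using MA.scale_one[of "\<lambda>x\<in>carrier A. x"] multipliers_one by simp

abbreviation "Wn \<equiv> W_upto A a b T \<mu>"

declare W_upto.simps [simp del]

lemma Wn_0: "Wn 0 = {\<lambda>x\<in>carrier A. x}"
  by (simp add: W_upto.simps)

lemma Wn_Suc: "Wn (Suc n) = {compose (carrier A) w (V (Suc n) \<zeta>) |w \<zeta>. w \<in> Wn n \<and> \<zeta> \<in> cs (Suc n)}"
  by (auto simp: set_mult_def V_set_eq W_upto.simps)

lemma Wn_SucE:
  assumes "w \<in> Wn (Suc n)"
  obtains w' \<zeta> where "w' \<in> Wn n" "\<zeta> \<in> cs (Suc n)" "w = compose (carrier A) w' (V (Suc n) \<zeta>)"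
  using assms unfolding Wn_Suc by blast

lemma Wn_multiplier: "w \<in> Wn n \<Longrightarrow> w \<in> multipliers A"
proof (induction n arbitrary: w)
  case 0
  then show ?case
    unfolding Wn_0 by (simp only: singleton_iff multipliers_one)
next
  case (Suc n)
  then show ?case
    using multipliers_compose(1)[OF Suc.IH V_multiplier] by (elim Wn_SucE) simp
qed

lemma Wn_step: "\<lbrakk>w \<in> Wn n; \<zeta> \<in> cs (Suc n)\<rbrakk> \<Longrightarrow> compose (carrier A) w (V (Suc n) \<zeta>) \<in> Wn (Suc n)"
  unfolding Wn_Suc by blast

text \<open>The identity is \<open>V n 0\<close>, so one more factor can always be appended.\<close>

lemma Wn_mono: "n \<le> m \<Longrightarrow> Wn n \<subseteq> Wn m"
proof (rule lift_Suc_mono_le[of Wn])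
  show "Wn k \<subseteq> Wn (Suc k)" for k
  proof
    fix w assume "w \<in> Wn k"
    then show "w \<in> Wn (Suc k)"
      using Wn_step[of w k 0] zero_in_cs[of "Suc k"] multiplier_compose_one[OF Wn_multiplier] unfolding V_zero by simp
  qed
qed

lemma one_in_Wn: "(\<lambda>x\<in>carrier A. x) \<in> Wn n"
  using Wn_mono[of 0 n] unfolding Wn_0 by blast

text \<open>Multipliers commute, so the factors can be paired by index, and each \<open>V_n\<close>
  is closed under products because its closed sector is closed under addition.\<close>

lemma Wn_mult: "\<lbrakk>w \<in> Wn n; w' \<in> Wn n\<rbrakk> \<Longrightarrow> compose (carrier A) w w' \<in> Wn n"
proof (induction n arbitrary: w w')
  case 0
  then show ?case
    unfolding Wn_0 using multiplier_compose_one[OF multipliers_one] by (simp only: singleton_iff)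
next
  case (Suc n)
  obtain v \<zeta> where v: "v \<in> Wn n" "\<zeta> \<in> cs (Suc n)" "w = compose (carrier A) v (V (Suc n) \<zeta>)"
    using Wn_SucE[OF Suc.prems(1)] .
  obtain v' \<eta> where v': "v' \<in> Wn n" "\<eta> \<in> cs (Suc n)" "w' = compose (carrier A) v' (V (Suc n) \<eta>)"
    using Wn_SucE[OF Suc.prems(2)] .
  have n: "1 \<le> Suc n"
    by simp
  have "compose (carrier A) w w' = compose (carrier A) (compose (carrier A) v v') (V (Suc n) (\<zeta> + \<eta>))"
    unfolding v(3) v'(3) V_add[OF n v(2) v'(2), symmetric]
    by (rule compose_swap[OF Wn_multiplier[OF v(1)] V_multiplier[OF n v(2)]
          Wn_multiplier[OF v'(1)] V_multiplier[OF n v'(2)]])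
  then show ?case
    using Wn_step[OF Suc.IH[OF v(1) v'(1)] cs_add[OF n v(2) v'(2)]] by simp
qed

lemma V_in_Wn:
  assumes "1 \<le> n" "\<zeta> \<in> cs n"
  shows "V n \<zeta> \<in> Wn n"
proof -
  obtain m where m: "n = Suc m"
    using assms(1) by (cases n) auto
  show ?thesis
    using Wn_step[OF one_in_Wn, of \<zeta> m] one_compose_multiplier[OF V_multiplier[OF assms]] assms(2)
    unfolding m by simp
qed

lemma W_iff: "w \<in> W \<longleftrightarrow> (\<exists>n. w \<in> Wn n)"
proof
  assume "\<exists>n. w \<in> Wn n"
  then obtain n where "w \<in> Wn n" ..
  then have "w \<in> Wn (Suc n)"
    by (rule subsetD[OF Wn_mono, rotated]) simp
  then show "w \<in> W"
    unfolding W_set_def by (intro UN_I[of "Suc n"]) auto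
qed (auto simp: W_set_def)

lemma W_multiplier: "w \<in> W \<Longrightarrow> w \<in> multipliers A"
  using W_iff Wn_multiplier by blast

lemma W_mult:
  assumes "w \<in> W" "w' \<in> W"
  shows "compose (carrier A) w w' \<in> W"
proof -
  obtain n m where "w \<in> Wn n" "w' \<in> Wn m"
    using assms W_iff by blast
  then have "w \<in> Wn (max n m)" "w' \<in> Wn (max n m)"
    using Wn_mono[of n "max n m"] Wn_mono[of m "max n m"] by auto
  then show ?thesis
    using Wn_mult W_iff by blast
qed

lemma one_in_W: "(\<lambda>x\<in>carrier A. x) \<in> W"
  using one_in_Wn W_iff by blast

lemma V_in_W: "\<lbrakk>1 \<le> n; \<zeta> \<in> cs n\<rbrakk> \<Longrightarrow> V n \<zeta> \<in> W"
  using V_in_Wn W_iff by blast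

section \<open>Bounds for \<open>W\<close> composed with the semigroup\<close>

lemma V_T_eq:
  assumes "1 \<le> n" "\<zeta> \<in> cs n" "\<eta> \<in> sector a b"
  shows "compose (carrier A) (V n \<zeta>) (T \<eta>) = scalar n \<zeta> \<odot>\<^bsub>mult_alg A\<^esub> T (\<zeta> + \<eta>)"
    "\<zeta> + \<eta> \<in> sector a b"
proof -
  have \<zeta>: "\<zeta> \<in> insert 0 (sector a b)"
    using cs_subset[OF assms(1)] assms(2) by blast
  then show s: "\<zeta> + \<eta> \<in> sector a b"
    using sector_plus assms(3) by auto
  have "compose (carrier A) (T' \<zeta>) (T \<eta>) = T (\<zeta> + \<eta>)"
    using T'_add[OF \<zeta>, of \<eta>] assms(3) s by (simp add: T'_sector)
  then show "compose (carrier A) (V n \<zeta>) (T \<eta>) = scalar n \<zeta> \<odot>\<^bsub>mult_alg A\<^esub> T (\<zeta> + \<eta>)"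
    using scale_compose[OF T'_multiplier[OF \<zeta>] T_multiplier[OF assms(3)]] by (simp only:)
qed

text \<open>The scalar is chosen to cancel the exponential growth on the closed sector. Growth is
  known on the two boundary rays, and every point of the sector is a sum of points on them.\<close>

lemma nT_scalar_bound:
  assumes n: "1 \<le> n" and \<eta>: "\<eta> \<in> sector a b"
  obtains M where "0 \<le> M" "\<And>\<zeta>. \<zeta> \<in> cs n \<Longrightarrow> cmod (scalar n \<zeta>) * nT (\<zeta> + \<eta>) \<le> M"
proof -
  let ?c = "cos ((\<beta> n - \<alpha> n) / 2)"
  have bounds: "a < \<alpha> n" "\<alpha> n < b" "a < \<beta> n" "\<beta> n < b"
    using seq_bounds(1,2,5)[of n] by linarith+
  \<comment> \<open>Each of the two rays needs its own shift away from the origin, so \<eta> is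
    divided equally between them.\<close>
  have half: "of_real (1 / 2) * \<eta> \<in> sector a b" "\<eta> = of_real (1 / 2) * \<eta> + of_real (1 / 2) * \<eta>"
    using sector_scale[OF \<eta>, of "1 / 2"] by simp_all
  have ray: "\<forall>\<^sub>F r in at_top. nT (rcis r (\<alpha> n)) \<le> exp (\<mu> n * ?c * r)"
    "\<forall>\<^sub>F r in at_top. nT (rcis r (\<beta> n)) \<le> exp (\<mu> n * ?c * r)"
    using nT_ray[of n] by (auto elim: eventually_mono)
  obtain M1 where M1: "0 \<le> M1"
    "\<And>r. 0 \<le> r \<Longrightarrow> nT (rcis r (\<alpha> n) + of_real (1 / 2) * \<eta>) \<le> M1 * exp (\<mu> n * ?c * r)"
    using nT_ray_bound[OF bounds(1,2) ray(1) half(1)] by blast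
  obtain M2 where M2: "0 \<le> M2"
    "\<And>r. 0 \<le> r \<Longrightarrow> nT (rcis r (\<beta> n) + of_real (1 / 2) * \<eta>) \<le> M2 * exp (\<mu> n * ?c * r)"
    using nT_ray_bound[OF bounds(3,4) ray(2) half(1)] by blast
  have "cmod (scalar n \<zeta>) * nT (\<zeta> + \<eta>) \<le> M1 * M2" if \<zeta>: "\<zeta> \<in> cs n" for \<zeta>
  proof -
    obtain r s where rs: "0 \<le> r" "0 \<le> s" "\<zeta> = rcis r (\<alpha> n) + rcis s (\<beta> n)"
      using closed_sector_decompose[OF seq_bounds(6)[OF n] seq_bounds(4) \<zeta>] .
    let ?u = "rcis r (\<alpha> n) + of_real (1 / 2) * \<eta>" and ?v = "rcis s (\<beta> n) + of_real (1 / 2) * \<eta>"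
    have in_sector: "?u \<in> sector a b" "?v \<in> sector a b"
      using sector_plus[OF rcis_in_sector[OF _ bounds(1,2)] half(1)]
        sector_plus[OF rcis_in_sector[OF _ bounds(3,4)] half(1)] half(1) rs(1,2)
      by (cases "r = 0"; cases "s = 0"; simp)+
    have "\<zeta> + \<eta> = ?u + ?v"
      unfolding rs(3) by (subst half(2)) simp
    then have "nT (\<zeta> + \<eta>) \<le> nT ?u * nT ?v"
      using nT_add_le[OF in_sector] by (simp only:)
    also have "\<dots> \<le> (M1 * exp (\<mu> n * ?c * r)) * (M2 * exp (\<mu> n * ?c * s))"
      using M1 M2 rs(1,2) nT_pos[OF in_sector(1)] nT_pos[OF in_sector(2)] by (intro mult_mono) auto
    also have "\<dots> = M1 * M2 * exp (\<mu> n * (?c * (r + s)))"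
      by (simp add: algebra_simps exp_add)
    \<comment> \<open>Both boundary rays make the angle (\<beta> n - \<alpha> n) / 2 with the
      bisector, so the cosines in the two exponents combine to the projection of \<zeta> on
      it.\<close>
    also have "?c * (r + s) = re \<zeta>"
    proof -
      have "\<alpha> n - (a + b) / 2 = - ((\<beta> n - \<alpha> n) / 2)" "\<beta> n - (a + b) / 2 = (\<beta> n - \<alpha> n) / 2"
        using seq_bounds(3)[of n] by (simp_all add: field_simps)
      then have "cos (\<alpha> n - (a + b) / 2) = ?c" "cos (\<beta> n - (a + b) / 2) = ?c"
        by (metis cos_minus)+
      moreover have "rcis q \<theta> * cis (- (a + b) / 2) = rcis q (\<theta> - (a + b) / 2)" for q \<theta>
        unfolding minus_divide_left[symmetric] by (simp add: rcis_def cis_mult)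
      ultimately show ?thesis
        unfolding rs(3) distrib_right plus_complex.sel by (simp add: algebra_simps)
    qed
    finally have le: "nT (\<zeta> + \<eta>) \<le> M1 * M2 * exp (\<mu> n * re \<zeta>)" .
    have "cmod (scalar n \<zeta>) * nT (\<zeta> + \<eta>) \<le> exp (- \<mu> n * re \<zeta>) * (M1 * M2 * exp (\<mu> n * re \<zeta>))"
      unfolding norm_scalar_factor by (rule mult_left_mono[OF le]) simp
    also have "\<dots> = M1 * M2"
      by (simp add: exp_minus)
    finally show ?thesis .
  qed
  then show ?thesis
    using that[of "M1 * M2"] M1(1) M2(1) by simp
qed

lemma n0_V_T_bound:
  assumes "1 \<le> n" "\<eta> \<in> sector a b"
  obtains M where "0 \<le> M" "\<And>\<zeta>. \<zeta> \<in> cs n \<Longrightarrow> n0 (compose (carrier A) (V n \<zeta>) (T \<eta>)) \<le> M"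
proof -
  obtain M where M: "0 \<le> M" "\<And>\<zeta>. \<zeta> \<in> cs n \<Longrightarrow> cmod (scalar n \<zeta>) * nT (\<zeta> + \<eta>) \<le> M"
    using nT_scalar_bound[OF assms] by blast
  have "n0 (compose (carrier A) (V n \<zeta>) (T \<eta>)) \<le> M" if \<zeta>: "\<zeta> \<in> cs n" for \<zeta>
  proof -
    note VT = V_T_eq[OF assms(1) \<zeta> assms(2)]
    have "n0 (compose (carrier A) (V n \<zeta>) (T \<eta>)) \<le>
        nrm (mult_alg A) (compose (carrier A) (V n \<zeta>) (T \<eta>))"
      by (intro n0_le multipliers_compose(1) V_multiplier T_multiplier assms \<zeta>)
    also have "\<dots> = cmod (scalar n \<zeta>) * nT (\<zeta> + \<eta>)"
      unfolding VT(1) using MA.nrm_smult[of "T (\<zeta> + \<eta>)" "scalar n \<zeta>"] T_multiplier[OF VT(2)]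
      by (simp only: mult_alg_sel(1))
    finally show ?thesis
      using M(2)[OF \<zeta>] by linarith
  qed
  then show ?thesis
    using that M(1) by blast
qed

text \<open>Here the constant is explicit, unlike in \<open>n0_V_T_bound\<close>, and its exponent
  is summable in n.\<close>

lemma n0_V_T_dyadic:
  assumes "1 \<le> n" "\<zeta> \<in> cs n"
  shows "n0 (compose (carrier A) (V n \<zeta>) (T (of_real ((1 / 2) ^ n) * \<delta>))) \<le> exp ((1 / 2) ^ n * (\<mu> 0 + 1))"
proof -
  have "of_real ((1 / 2) ^ n) * \<delta> \<in> sector a b"
    by (rule \<delta>_scale_in_sector) simp
  then show ?thesis
    using mu_L0[OF assms] V_T_eq(1)[OF assms] by (simp only:)
qed

lemma T_\<delta>_add:
  assumes "0 < s" "0 < t"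
  shows "T (of_real (s + t) * \<delta>) = compose (carrier A) (T (of_real s * \<delta>)) (T (of_real t * \<delta>))"
  using T_add[OF \<delta>_scale_in_sector[OF assms(1)] \<delta>_scale_in_sector[OF assms(2)]]
  by (simp add: distrib_right)

text \<open>The available time is shared out: part s goes to w, part t to v. Commutativity allows
  the regrouping, and the bounds multiply.\<close>

lemma n0_step:
  assumes "w \<in> multipliers A" "v \<in> multipliers A" "0 < s" "0 < t"
    and "n0 (compose (carrier A) w (T (of_real s * \<delta>))) \<le> K"
    and "n0 (compose (carrier A) v (T (of_real t * \<delta>))) \<le> K'" "0 \<le> K"
  shows "n0 (compose (carrier A) (compose (carrier A) w v) (T (of_real (s + t) * \<delta>))) \<le> K * K'"
proof -
  note T = T_multiplier[OF \<delta>_scale_in_sector[OF assms(3)]] T_multiplier[OF \<delta>_scale_in_sector[OF assms(4)]]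
  note c = multipliers_compose(1)[OF assms(1) T(1)] multipliers_compose(1)[OF assms(2) T(2)]
  have "n0 (compose (carrier A) (compose (carrier A) w v) (T (of_real (s + t) * \<delta>))) \<le>
      n0 (compose (carrier A) w (T (of_real s * \<delta>))) * n0 (compose (carrier A) v (T (of_real t * \<delta>)))"
    unfolding T_\<delta>_add[OF assms(3,4)] compose_swap[OF assms(1,2) T] by (rule n0_compose[OF c])
  also have "\<dots> \<le> K * K'"
    using assms(5-7) n0_nonneg[OF c(2)] by (intro mult_mono) auto
  finally show ?thesis .
qed

text \<open>The constant \<open>K\<close> may depend on n, since each factor brings its own. Halving
  the time for every new factor makes any positive t sufficient.\<close>

lemma n0_Wn_T_bound:
  assumes "0 < t"
  shows "\<exists>K\<ge>0. \<forall>w\<in>Wn n. n0 (compose (carrier A) w (T (of_real t * \<delta>))) \<le> K"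
  using assms
proof (induction n arbitrary: t)
  case 0
  have "n0 (compose (carrier A) w (T (of_real t * \<delta>))) \<le> exp (\<mu> 0 * t)" if "w \<in> Wn 0" for w
    using that n0_T_ray[OF 0] one_compose_multiplier[OF T_multiplier[OF \<delta>_scale_in_sector[OF 0]]]
    unfolding Wn_0 by simp
  then show ?case
    by (intro exI[of _ "exp (\<mu> 0 * t)"]) auto
next
  case (Suc n)
  have half: "0 < t / 2"
    using Suc.prems by simp
  obtain K where K: "0 \<le> K" "\<forall>w\<in>Wn n. n0 (compose (carrier A) w (T (of_real (t / 2) * \<delta>))) \<le> K"
    using Suc.IH[OF half] by blast
  obtain K' where K': "0 \<le> K'"
    "\<And>\<zeta>. \<zeta> \<in> cs (Suc n) \<Longrightarrow> n0 (compose (carrier A) (V (Suc n) \<zeta>) (T (of_real (t / 2) * \<delta>))) \<le> K'"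
    using n0_V_T_bound[OF _ \<delta>_scale_in_sector[OF half], of "Suc n"] by auto
  have "n0 (compose (carrier A) w (T (of_real t * \<delta>))) \<le> K * K'" if w: "w \<in> Wn (Suc n)" for w
  proof -
    obtain v \<zeta> where v: "v \<in> Wn n" "\<zeta> \<in> cs (Suc n)" "w = compose (carrier A) v (V (Suc n) \<zeta>)"
      using Wn_SucE[OF w] .
    have "n0 (compose (carrier A) (compose (carrier A) v (V (Suc n) \<zeta>)) (T (of_real (t / 2 + t / 2) * \<delta>))) \<le> K * K'"
      by (rule n0_step[OF Wn_multiplier[OF v(1)] V_multiplier[OF _ v(2)] half half bspec[OF K(2) v(1)] K'(2)[OF v(2)] K(1)])
        simp
    then show ?thesis
      by (simp only: v(3) field_sum_of_halves)
  qed
  then show ?case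
    using K(1) K'(1) by (intro exI[of _ "K * K'"]) auto
qed

text \<open>The dyadic times sum to at most one, so the factors from the hypothesis on \<open>\<mu>\<close> multiply to
  a bound that is uniform in \<open>n\<close>.\<close>

lemma n0_Wn_T_bound_tail:
  assumes "0 < t" "0 \<le> K" "\<forall>w\<in>Wn N. n0 (compose (carrier A) w (T (of_real t * \<delta>))) \<le> K"
  shows "\<forall>w\<in>Wn (N + k). n0 (compose (carrier A) w (T (of_real (t + (1 / 2) ^ N - (1 / 2) ^ (N + k)) * \<delta>)))
    \<le> K * exp (((1 / 2) ^ N - (1 / 2) ^ (N + k)) * (\<mu> 0 + 1))"
proof (induction k)
  case 0
  then show ?case
    using assms(3) by simp
next
  case (Suc k)
  let ?s = "t + (1 / 2) ^ N - (1 / 2) ^ (N + k) :: real" and ?n = "Suc (N + k)"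
  let ?E = "K * exp (((1 / 2) ^ N - (1 / 2) ^ (N + k)) * (\<mu> 0 + 1))"
  \<comment> \<open>The difference of consecutive dyadic powers is exactly the time reserved for the
    next factor, so both the total time and the exponent telescope.\<close>
  have eq: "(1 / 2) ^ (N + k) = (2::real) * (1 / 2) ^ ?n"
    by simp
  have "(1 / 2) ^ (N + k) \<le> ((1 / 2) ^ N :: real)"
    by (intro power_decreasing) auto
  then have s: "0 < ?s"
    using assms(1) by linarith
  have sum: "t + (1 / 2) ^ N - (1 / 2) ^ (N + Suc k) = ?s + (1 / 2) ^ ?n"
    using eq by simp
  have E: "?E * exp ((1 / 2) ^ ?n * (\<mu> 0 + 1)) =
      K * exp (((1 / 2) ^ N - (1 / 2) ^ (N + Suc k)) * (\<mu> 0 + 1))"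
    unfolding eq mult.assoc exp_add[symmetric] distrib_right[symmetric] by simp
  show ?case
  proof
    fix w assume "w \<in> Wn (N + Suc k)"
    then have "w \<in> Wn ?n"
      by simp
    then obtain v \<zeta> where v: "v \<in> Wn (N + k)" "\<zeta> \<in> cs ?n" "w = compose (carrier A) v (V ?n \<zeta>)"
      by (rule Wn_SucE)
    have n: "1 \<le> ?n"
      by simp
    have "n0 (compose (carrier A) w (T (of_real (?s + (1 / 2) ^ ?n) * \<delta>))) \<le> ?E * exp ((1 / 2) ^ ?n * (\<mu> 0 + 1))"
      unfolding v(3)
      by (rule n0_step[OF Wn_multiplier[OF v(1)] V_multiplier[OF n v(2)] s _ bspec[OF Suc v(1)]
            n0_V_T_dyadic[OF n v(2)]]) (use assms(2) in simp_all)
    then show "n0 (compose (carrier A) w (T (of_real (t + (1 / 2) ^ N - (1 / 2) ^ (N + Suc k)) * \<delta>)))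
        \<le> K * exp (((1 / 2) ^ N - (1 / 2) ^ (N + Suc k)) * (\<mu> 0 + 1))"
      by (simp only: sum E)
  qed
qed

lemma n0_W_T_ray_bound:
  assumes "0 < t"
  shows "\<exists>K\<ge>0. \<forall>w\<in>W. n0 (compose (carrier A) w (T (of_real t * \<delta>))) \<le> K"
proof -
  obtain N where N: "(1 / 2) ^ N < t"
    using real_arch_pow_inv[OF assms, of "1 / 2"] by auto
  \<comment> \<open>All factors beyond N together use less than (1/2)^N, and the time s remains for
    the first N factors, where the constants are not controlled.\<close>
  define s where "s = t - (1 / 2) ^ N"
  have s: "0 < s"
    using N by (simp add: s_def)
  obtain K where K: "0 \<le> K" "\<forall>w\<in>Wn N. n0 (compose (carrier A) w (T (of_real s * \<delta>))) \<le> K"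
    using n0_Wn_T_bound[OF s] by blast
  have "n0 (compose (carrier A) w (T (of_real t * \<delta>))) \<le> K * exp (\<mu> 0 + 1) * exp (\<mu> 0)" if "w \<in> W" for w
  proof -
    obtain n where "w \<in> Wn n"
      using \<open>w \<in> W\<close> W_iff by blast
    then have w: "w \<in> Wn (N + n)"
      using Wn_mono[of n "N + n"] by auto
    \<comment> \<open>After N + n factors the time spent is t - \<open>?q\<close>. The leftover
      \<open>?q\<close> is spent by the semigroup alone, paired with the identity, at a cost of at
      most exp(\<open>\<mu> 0\<close>).\<close>
    let ?q = "(1 / 2) ^ (N + n) :: real"
    have q: "0 < ?q" "?q \<le> (1 / 2) ^ N" "(1 / 2) ^ N \<le> (1 :: real)"
      by (auto intro: power_decreasing power_le_one)
    have pos: "0 < s + (1 / 2) ^ N - ?q"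
      using s q by linarith
    have "(1 / 2) ^ N - ?q \<le> 1"
      using q by linarith
    then have "((1 / 2) ^ N - ?q) * (\<mu> 0 + 1) \<le> 1 * (\<mu> 0 + 1)"
      using mu_pos[of 0] by (intro mult_right_mono) auto
    then have le: "n0 (compose (carrier A) w (T (of_real (s + (1 / 2) ^ N - ?q) * \<delta>))) \<le> K * exp (\<mu> 0 + 1)"
      using bspec[OF n0_Wn_T_bound_tail[OF s K] w] mult_left_mono[OF _ K(1)]
      by (smt (verit) exp_le_cancel_iff mult_cancel_right1)
    have "?q \<le> 1"
      using q by linarith
    then have "\<mu> 0 * ?q \<le> \<mu> 0 * 1"
      using mu_pos[of 0] by (intro mult_left_mono) auto
    then have "n0 (compose (carrier A) (\<lambda>x\<in>carrier A. x) (T (of_real ?q * \<delta>))) \<le> exp (\<mu> 0)"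
      unfolding one_compose_multiplier[OF T_multiplier[OF \<delta>_scale_in_sector[OF q(1)]]]
      using n0_T_ray[OF q(1)] by (smt (verit) exp_le_cancel_iff mult.right_neutral)
    then have "n0 (compose (carrier A) (compose (carrier A) w (\<lambda>x\<in>carrier A. x))
        (T (of_real (s + (1 / 2) ^ N - ?q + ?q) * \<delta>))) \<le> K * exp (\<mu> 0 + 1) * exp (\<mu> 0)"
      using K(1) by (intro n0_step[OF Wn_multiplier[OF w] multipliers_one pos q(1) le]) auto
    moreover have "s + (1 / 2) ^ N - ?q + ?q = t"
      by (simp add: s_def)
    ultimately show ?thesis
      by (simp only: multiplier_compose_one[OF Wn_multiplier[OF w]])
  qed
  then show ?thesis
    using K(1) by (intro exI[of _ "K * exp (\<mu> 0 + 1) * exp (\<mu> 0)"]) auto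
qed

lemma sector_diff_\<delta>:
  assumes "\<zeta> \<in> sector a b"
  obtains t where "0 < t" "\<zeta> - of_real t * \<delta> \<in> sector a b"
proof -
  obtain e where e: "0 < e" "ball \<zeta> e \<subseteq> sector a b"
    using open_sector[OF a_less_b b_le] assms open_contains_ball by blast
  have "\<zeta> - of_real (e / 2) * \<delta> \<in> ball \<zeta> e"
    using e(1) by (simp add: dist_norm norm_mult)
  then show ?thesis
    by (intro that[of "e / 2"] subsetD[OF e(2)]) (use e(1) in simp_all)
qed

text \<open>The sector is open, so a small multiple of \<open>\<delta>\<close> can be subtracted
  from \<zeta>. Then \<open>T \<zeta>\<close> factors through the bisector, where the bound is
  already known.\<close>

lemma n0_W_T_bound:
  assumes "\<zeta> \<in> sector a b"
  shows "\<exists>K\<ge>0. \<forall>w\<in>W. n0 (compose (carrier A) w (T \<zeta>)) \<le> K"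
proof -
  obtain t where t: "0 < t" "\<zeta> - of_real t * \<delta> \<in> sector a b" (is "?\<eta> \<in> _")
    using sector_diff_\<delta>[OF assms] .
  obtain K where K: "0 \<le> K" "\<forall>w\<in>W. n0 (compose (carrier A) w (T (of_real t * \<delta>))) \<le> K"
    using n0_W_T_ray_bound[OF t(1)] by blast
  note T = T_multiplier[OF \<delta>_scale_in_sector[OF t(1)]] T_multiplier[OF t(2)]
  have T_eq: "T \<zeta> = compose (carrier A) (T (of_real t * \<delta>)) (T ?\<eta>)"
    using T_add[OF \<delta>_scale_in_sector[OF t(1)] t(2)] by simp
  have "n0 (compose (carrier A) w (T \<zeta>)) \<le> K * n0 (T ?\<eta>)" if w: "w \<in> W" for w
  proof -
    have "n0 (compose (carrier A) w (T \<zeta>)) \<le> n0 (compose (carrier A) w (T (of_real t * \<delta>))) * n0 (T ?\<eta>)"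
      unfolding T_eq multiplier_compose_assoc[OF W_multiplier[OF w] T, symmetric]
      by (rule n0_compose[OF multipliers_compose(1)[OF W_multiplier[OF w] T(1)] T(2)])
    also have "\<dots> \<le> K * n0 (T ?\<eta>)"
      using K(2) w n0_nonneg[OF T(2)] by (intro mult_right_mono) auto
    finally show ?thesis .
  qed
  then show ?thesis
    using K(1) n0_nonneg[OF T(2)] by (intro exI[of _ "K * n0 (T ?\<eta>)"]) auto
qed


section \<open>Second normalization, along \<open>W\<close>\<close>

abbreviation "L \<equiv> L_mu A a b T \<mu>"
abbreviation "B \<equiv> A_mu A a b T \<mu>"
abbreviation "act1 \<equiv> act_L_mu A a b T \<mu>"
abbreviation "actB \<equiv> act_A_mu A a b T \<mu>"
abbreviation "j \<equiv> incl_A_mu A a b T \<mu>"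

definition p1 :: "('a \<Rightarrow> 'a) \<Rightarrow> ('a \<Rightarrow> 'a) \<Rightarrow> real" where
  "p1 r u = nrm (mult_alg L0) (act0 r \<otimes>\<^bsub>A0\<^esub> u)"

definition w1 :: "('a \<Rightarrow> 'a) \<Rightarrow> ('a \<Rightarrow> 'a) \<Rightarrow> ('a \<Rightarrow> 'a)" where
  "w1 r = mult_op A0 (act0 r)"

lemma w1_multiplier:
  assumes "r \<in> multipliers A"
  shows "w1 r \<in> multipliers A0" "nrm (mult_alg A0) (w1 r) \<le> nrm (mult_alg A) r"
    and "u \<in> carrier A \<Longrightarrow> w1 r (mult_op L0 u) = mult_op L0 (r u)"
  unfolding w1_def act0_eq using N0.mult_op_C_multiplier[OF assms] by simp_all

lemma w1_apply: "u \<in> carrier A0 \<Longrightarrow> w1 r u = act0 r \<otimes>\<^bsub>A0\<^esub> u"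
  by (simp add: w1_def mult_op_def)

lemma p1_eq: "u \<in> carrier A0 \<Longrightarrow> p1 r u = nrm A0 (w1 r u)"
  by (simp only: p1_def w1_apply N0.C_sel)

lemma p1_compose_eq:
  assumes "r \<in> multipliers A" "r' \<in> multipliers A" "u \<in> carrier A0"
  shows "p1 r (w1 r' u) = p1 (compose (carrier A) r r') u"
  unfolding p1_def w1_apply[OF assms(3)] act0_compose[OF assms(1,2)] N0.C_sel mult_alg_sel
    N0.L.multiplier_compose_assoc[OF act0_multiplier[OF assms(1)] act0_multiplier[OF assms(2)] N0.C_multiplier[OF assms(3)]] ..

lemma orbit_algebra_L: "orbit_algebra A0 W p1 w1 (\<lambda>x\<in>carrier A. x) L"
proof (intro orbit_algebra.intro orbit_algebra_axioms.intro N0.banach_algebra_C)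
  show "w1 r \<in> multipliers A0" if "r \<in> W" for r
    by (rule w1_multiplier(1)[OF W_multiplier[OF that]])
  show "p1 r u = nrm A0 (w1 r u)" if "r \<in> W" "u \<in> carrier A0" for r u
    by (rule p1_eq[OF that(2)])
  show "(\<lambda>x\<in>carrier A. x) \<in> W"
    by (rule one_in_W)
  show "p1 (\<lambda>x\<in>carrier A. x) u = nrm A0 u" if "u \<in> carrier A0" for u
    unfolding p1_def act0_one N0.C_sel mult_alg_sel N0.L.one_compose_multiplier[OF N0.C_multiplier[OF that]] ..
  \<comment> \<open>Each closed sector contains 0, so the identity is already in \<open>W\<close>;
    adjoining it in the norm of \<open>L_mu\<close> changes nothing, and one index set serves for
    carrier and norm.\<close>
  have "W \<union> {\<one>\<^bsub>mult_alg A\<^esub>} = W"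
    using one_in_W unfolding mult_alg_sel by blast
  then show "L = A0\<lparr>carrier := {u \<in> carrier A0. bdd_above ((\<lambda>i. p1 i u) ` W)}, nrm := \<lambda>u. SUP i\<in>W. p1 i u\<rparr>"
    unfolding L_mu_def p1_def by (simp only:)
qed

lemma T_in_L:
  assumes "\<zeta> \<in> sector a b" "u \<in> carrier A0"
  shows "w1 (T \<zeta>) u \<in> carrier L"
proof -
  obtain K where K: "0 \<le> K" "\<forall>r\<in>W. n0 (compose (carrier A) r (T \<zeta>)) \<le> K"
    using n0_W_T_bound[OF assms(1)] by blast
  note T = T_multiplier[OF assms(1)]
  have "p1 r (w1 (T \<zeta>) u) \<le> K * nrm A0 u" if r: "r \<in> W" for r
  proof -
    note rT = multipliers_compose(1)[OF W_multiplier[OF r] T]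
    have "p1 r (w1 (T \<zeta>) u) \<le> n0 (compose (carrier A) r (T \<zeta>)) * nrm A0 u"
      unfolding p1_compose_eq[OF W_multiplier[OF r] T assms(2)]
      unfolding p1_def N0.C_sel mult_alg_sel
      by (rule N0.L.multipliers_compose(2)[OF act0_multiplier[OF rT] N0.C_multiplier[OF assms(2)]])
    also have "\<dots> \<le> K * nrm A0 u"
      using bspec[OF K(2) r] N0.C.nrm_nonneg[OF assms(2)] by (rule mult_right_mono)
    finally show ?thesis .
  qed
  then show ?thesis
    by (rule orbit_algebra.in_L_I(1)[OF orbit_algebra_L multipliersD(1)[OF w1_multiplier(1)[OF T] assms(2)]])
qed

lemma L_dense: "dense_in A0 (carrier L)"
proof (rule N0.C.dense_in_superset)
  show "dense_in A0 (mult_op L0 ` T \<delta> ` carrier A)"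
    by (rule dense_in_image[OF normed N0.C.normed N0.mult_op_bounded_linear_map T_dense[OF \<delta>_in_sector]
          N0.mult_op_L_dense])
  have "mult_op L0 (T \<delta> u) \<in> carrier L" if "u \<in> carrier A" for u
    using T_in_L[OF \<delta>_in_sector N0.mult_op_in_C[OF that]]
    unfolding w1_multiplier(3)[OF T_multiplier[OF \<delta>_in_sector] that] .
  then show "mult_op L0 ` T \<delta> ` carrier A \<subseteq> carrier L"
    by blast
  show "carrier L \<subseteq> carrier A0"
    by (rule orbit_algebra.L_subset[OF orbit_algebra_L])
qed

sublocale N1: normalization A0 W p1 w1 "\<lambda>x\<in>carrier A. x" L B
  by (intro normalization.intro normalization_axioms.intro orbit_algebra_L N0.C.wc_algebra_axioms
      L_dense) (simp only: A_mu_def)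

lemma j_eq: "j u = mult_op L (mult_op L0 u)"
  by (simp add: incl_A_mu_def)

lemma act1_eq: "act1 r = restrict (w1 r) (carrier L)"
  unfolding act_L_mu_def w1_def by (rule N1.mult_op_L_eq)

lemma act1_multiplier: "r \<in> multipliers A \<Longrightarrow> act1 r \<in> multipliers L"
  unfolding act1_eq by (rule N1.restrict_multiplier(1)[OF w1_multiplier(1)])

lemma actB_multiplier:
  assumes "r \<in> multipliers A"
  shows "actB r \<in> multipliers B" "nrm (mult_alg B) (actB r) \<le> nrm (mult_alg L) (act1 r)"
    and "nrm (mult_alg B) (actB r) \<le> nrm (mult_alg A) r"
    and "u \<in> carrier A \<Longrightarrow> actB r (j u) = j (r u)"
proof -
  note w1 = w1_multiplier[OF assms]
  show "actB r \<in> multipliers B" "nrm (mult_alg B) (actB r) \<le> nrm (mult_alg L) (act1 r)"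
    unfolding act_A_mu_def act1_eq by (rule N1.mult_op_C_multiplier[OF w1(1)])+
  show "nrm (mult_alg B) (actB r) \<le> nrm (mult_alg A) r"
    unfolding act_A_mu_def act1_eq by (rule order_trans[OF N1.mult_op_C_multiplier(3)[OF w1(1)] w1(2)])
  show "actB r (j u) = j (r u)" if "u \<in> carrier A"
    unfolding act_A_mu_def act1_eq j_eq
      N1.mult_op_C_multiplier(4)[OF w1(1) N0.mult_op_in_C[OF that]] w1(3)[OF that] ..
qed

lemma j_closed: "u \<in> carrier A \<Longrightarrow> j u \<in> carrier B"
  unfolding j_eq by (rule N1.mult_op_in_C[OF N0.mult_op_in_C])

lemma j_bounded: "bounded_linear_map A B j 1"
  unfolding bounded_linear_map_def
proof (intro conjI ballI allI)
  note f = bounded_linear_mapD[OF N0.mult_op_bounded_linear_map]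
    and g = bounded_linear_mapD[OF N1.mult_op_bounded_linear_map]
  show "j \<in> carrier A \<rightarrow> carrier B"
    using j_closed by blast
  show "j (x \<oplus> y) = j x \<oplus>\<^bsub>B\<^esub> j y" if "x \<in> carrier A" "y \<in> carrier A" for x y
    unfolding j_eq f(2)[OF that] by (rule g(2)[OF f(1)[OF that(1)] f(1)[OF that(2)]])
  show "j (c \<odot> x) = c \<odot>\<^bsub>B\<^esub> j x" if "x \<in> carrier A" for c x
    unfolding j_eq f(3)[OF that] by (rule g(3)[OF f(1)[OF that]])
  show "nrm B (j x) \<le> 1 * nrm A x" if "x \<in> carrier A" for x
    using g(4)[OF f(1)[OF that]] f(4)[OF that] unfolding j_eq by linarith
qed

lemma j_mult:
  assumes "x \<in> carrier A" "y \<in> carrier A"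
  shows "j (x \<otimes> y) = j x \<otimes>\<^bsub>B\<^esub> j y"
  unfolding j_eq N0.mult_op_L_hom(3)[OF assms] N1.C_sel
  by (rule N1.mult_op_L_hom(3)[OF N0.mult_op_in_C[OF assms(1)] N0.mult_op_in_C[OF assms(2)], unfolded N0.C_sel])

lemma j_dense_image:
  assumes "dense_in A S"
  shows "dense_in B (j ` S)"
proof -
  have "dense_in B (mult_op L ` mult_op L0 ` S)"
    by (rule dense_in_image[OF N0.C.normed N1.C.normed N1.mult_op_bounded_linear_map _ N1.mult_op_L_dense])
      (rule dense_in_image[OF normed N0.C.normed N0.mult_op_bounded_linear_map assms N0.mult_op_L_dense])
  moreover have "mult_op L ` mult_op L0 ` S = j ` S"
    by (simp add: image_image j_eq)
  ultimately show ?thesis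
    by simp
qed

lemma j_inj: "inj_on j (carrier A)"
proof (rule inj_onI)
  fix x y assume xy: "x \<in> carrier A" "y \<in> carrier A" "j x = j y"
  have "mult_op L0 x = mult_op L0 y"
    using inj_onD[OF N1.mult_op_L_inj _ N0.mult_op_in_C[OF xy(1)] N0.mult_op_in_C[OF xy(2)]] xy(3)
    unfolding j_eq by blast
  then show "x = y"
    by (rule inj_onD[OF N0.mult_op_L_inj _ xy(1,2)])
qed

section \<open>Returning from \<open>A_mu\<close> to \<open>A\<close> by multiplication with
  \<open>T(\<zeta>)w\<^sup>2\<close>\<close>

lemma half_sector: "\<zeta> \<in> sector a b \<Longrightarrow> \<zeta> / 2 \<in> sector a b"
  using sector_scale[of \<zeta> a b "1 / 2"] by simp

lemma T_square:
  assumes "\<zeta> \<in> sector a b" "w \<in> carrier A"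
  shows "T \<zeta> (w \<otimes> w) = T (\<zeta> / 2) w \<otimes> T (\<zeta> / 2) w"
proof -
  let ?T = "T (\<zeta> / 2)"
  note T = T_multiplier[OF half_sector[OF assms(1)]]
  have "T \<zeta> (w \<otimes> w) = ?T (?T (w \<otimes> w))"
    using T_add_apply[OF half_sector[OF assms(1)] half_sector[OF assms(1)], of "w \<otimes> w"] assms(2) by simp
  also have "\<dots> = ?T (?T w \<otimes> w)"
    using multipliersD(5)[OF T assms(2,2)] by simp
  also have "\<dots> = ?T w \<otimes> ?T w"
    by (rule multiplier_mult_right[OF T multipliersD(1)[OF T assms(2)] assms(2)])
  finally show ?thesis .
qed

text \<open>With \<open>x = T(\<zeta>/2)w\<close>, which lies in \<open>L0\<close> and whose image lies in \<open>L\<close>, one has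
  \<open>j(x\<^sup>2) b = j((b x) x)\<close> for every \<open>b\<close> in \<open>B\<close>.\<close>

lemma qm_embedding_j:
  assumes "\<zeta> \<in> sector a b" "w \<in> Omega A"
  shows "\<exists>M. qm_embedding A B j (T \<zeta> (w \<otimes> w)) M"
proof -
  let ?e = "T \<zeta> (w \<otimes> w)"
  define x where "x = T (\<zeta> / 2) w"
  define y where "y = mult_op L0 x"
  have w: "w \<in> carrier A"
    using assms(2) by simp
  have x0: "x \<in> carrier L0"
    unfolding x_def by (rule T_in_L0[OF half_sector[OF assms(1)] w])
  then have xA: "x \<in> carrier A"
    by simp
  have y1: "y \<in> carrier L"
    using T_in_L[OF half_sector[OF assms(1)] N0.mult_op_in_C[OF w]]
    unfolding w1_multiplier(3)[OF T_multiplier[OF half_sector[OF assms(1)]] w] y_def x_def .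
  have yA0: "y \<in> carrier A0"
    unfolding y_def by (rule N0.mult_op_in_C[OF xA])
  have e: "?e = x \<otimes> x"
    unfolding x_def by (rule T_square[OF assms(1) w])
  have jx: "j x \<in> carrier B" "j x = mult_op L y"
    using j_closed[OF xA] by (simp_all add: j_eq y_def)
  \<comment> \<open>One factor for each return: \<open>y\<close> brings \<open>b\<close> into
    \<open>A0\<close>, and \<open>x\<close> brings \<open>b y\<close> into \<open>A\<close>. The
    norms are the stronger ones of \<open>L\<close> and \<open>L0\<close>.\<close>
  let ?M = "nrm L y * nrm L0 x"
  have range: "\<exists>u\<in>carrier A. j u = j ?e \<otimes>\<^bsub>B\<^esub> b \<and> nrm A u \<le> ?M * nrm B b" if b: "b \<in> carrier B" for b
  proof (intro bexI conjI)
    note by1 = N1.mult_op_L_compose_C[OF b y1]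
    have byA0: "b y \<in> carrier A0"
      using by1(3) by simp
    note byx = N0.mult_op_L_compose_C[OF byA0 x0]
    show u: "b y x \<in> carrier A"
      using byx(3) by simp
    have "j (b y x) = mult_op L (mult_op L0 x \<otimes>\<^bsub>A0\<^esub> b y)"
      unfolding j_eq byx(1) ..
    also have "\<dots> = mult_op L y \<otimes>\<^bsub>B\<^esub> mult_op L (b y)"
      unfolding y_def[symmetric] N1.C_sel by (rule N1.mult_op_L_hom(3)[OF yA0 byA0])
    also have "\<dots> = j x \<otimes>\<^bsub>B\<^esub> (j x \<otimes>\<^bsub>B\<^esub> b)"
      unfolding by1(1)[symmetric] jx(2) ..
    also have "\<dots> = j ?e \<otimes>\<^bsub>B\<^esub> b"
      unfolding e j_mult[OF xA xA] by (rule N1.C.mult_assoc[OF jx(1) jx(1) b, symmetric])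
    finally show "j (b y x) = j ?e \<otimes>\<^bsub>B\<^esub> b" .
    have "nrm A (b y x) \<le> nrm A0 (b y) * nrm L0 x"
      by (rule byx(2))
    also have "\<dots> \<le> (nrm B b * nrm L y) * nrm L0 x"
      by (rule mult_right_mono[OF by1(2) N0.L.nrm_nonneg[OF x0]])
    finally show "nrm A (b y x) \<le> ?M * nrm B b"
      by (simp only: mult.commute mult.left_commute)
  qed
  have "?e \<in> Omega A"
    by (rule dense_multiplier_Omega[OF T_multiplier[OF assms(1)] T_dense[OF assms(1)] Omega_mult[OF assms(2,2)]])
  then have "qm_embedding A B j ?e ?M"
    using range
    by (intro qm_embedding.intro qm_embedding_axioms.intro wc_algebra_axioms N1.C.wc_algebra_axioms
        j_bounded j_mult j_inj j_dense_image dense_in_carrier)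
  then show ?thesis ..
qed

text \<open>\<open>W\<close> is stable under multiplication by \<open>V n \<zeta>\<close>, so
  \<open>nrm_restrict_multiplier_le\<close> applies with index r replaced by that product. The
  factor is the inverse modulus of the scalar in \<open>V n \<zeta>\<close>.\<close>

lemma act1_bound:
  assumes n: "1 \<le> n" and \<zeta>: "\<zeta> \<in> cs n"
  shows "nrm (mult_alg L) (act1 (T' \<zeta>)) \<le> exp (\<mu> n * re \<zeta>)"
  unfolding act1_eq
proof (rule N1.nrm_restrict_multiplier_le)
  have T': "T' \<zeta> \<in> multipliers A"
    using T'_multiplier cs_subset[OF n] \<zeta> by blast
  show "w1 (T' \<zeta>) \<in> multipliers A0"
    by (rule w1_multiplier(1)[OF T'])
  fix r assume r: "r \<in> W"
  note rA = W_multiplier[OF r]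
  have "p1 r (w1 (T' \<zeta>) u) = exp (\<mu> n * re \<zeta>) * p1 (compose (carrier A) r (V n \<zeta>)) u"
    if "u \<in> carrier L" for u
  proof -
    have u: "u \<in> carrier A0"
      using that by simp
    let ?c = "compose (carrier A) r (T' \<zeta>)"
    have c: "?c \<in> multipliers A"
      by (rule multipliers_compose(1)[OF rA T'])
    have "compose (carrier A) r (V n \<zeta>) = scalar n \<zeta> \<odot>\<^bsub>mult_alg A\<^esub> ?c"
      using MA.smult_mult_r[of r "T' \<zeta>" "scalar n \<zeta>"] rA T' by (simp only: mult_alg_sel)
    then have "act0 (compose (carrier A) r (V n \<zeta>)) \<otimes>\<^bsub>A0\<^esub> u =
        scalar n \<zeta> \<odot>\<^bsub>mult_alg L0\<^esub> (act0 ?c \<otimes>\<^bsub>A0\<^esub> u)"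
      using act0_scale[of "scalar n \<zeta>" ?c] N0.L.scale_compose[OF act0_multiplier[OF c] N0.C_multiplier[OF u], of "scalar n \<zeta>"]
      by (simp only: N0.C_sel mult_alg_sel(2))
    then have "p1 (compose (carrier A) r (V n \<zeta>)) u = cmod (scalar n \<zeta>) * p1 ?c u"
      unfolding p1_def
      using N0.OpL.nrm_smult[of "act0 ?c \<otimes>\<^bsub>A0\<^esub> u" "scalar n \<zeta>"]
        N0.L.multipliers_compose(1)[OF act0_multiplier[OF c] N0.C_multiplier[OF u]]
      by (simp only: N0.C_sel mult_alg_sel(1,2))
    then show ?thesis
      unfolding p1_compose_eq[OF rA T' u] norm_scalar_factor by (simp add: exp_minus)
  qed
  then show "\<exists>k\<in>W. \<forall>u\<in>carrier L. p1 r (w1 (T' \<zeta>) u) \<le> exp (\<mu> n * re \<zeta>) * p1 k u"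
    using W_mult[OF r V_in_W[OF n \<zeta>]] by (intro bexI[of _ "compose (carrier A) r (V n \<zeta>)"]) auto
qed simp

section \<open>Strong continuity at the origin\<close>

lemma sector_subset_cs:
  assumes "a < \<alpha>'" "\<beta>' < b"
  obtains n where "1 \<le> n" "sector \<alpha>' \<beta>' \<subseteq> cs n"
proof -
  define \<epsilon> where "\<epsilon> = min (\<alpha>' - a) (b - \<beta>')"
  have \<epsilon>: "0 < \<epsilon>"
    using assms by (simp add: \<epsilon>_def)
  \<comment> \<open>Large n makes the gap between the n-th closed sector and the full sector smaller
    than \<epsilon>, the smaller of the two given gaps.\<close>
  obtain n :: nat where n: "(b - a) / \<epsilon> < real n"
    using reals_Archimedean2 by blast
  have "0 < (b - a) / \<epsilon>"
    using \<epsilon> a_less_b by simp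
  then have n1: "1 \<le> n"
    using n by (cases n) auto
  have "b - a < \<epsilon> * real n"
    using n \<epsilon> by (simp add: field_simps)
  also have "\<epsilon> * real n \<le> \<epsilon> * (2 * (real n + 1))"
    using \<epsilon> by (intro mult_left_mono) auto
  finally have "(b - a) / (2 * (real n + 1)) < \<epsilon>"
    by (simp add: pos_divide_less_eq)
  then have le: "\<alpha> n \<le> \<alpha>'" "\<beta>' \<le> \<beta> n"
    by (simp_all add: alpha_seq_def beta_seq_def \<epsilon>_def)
  have "sector \<alpha>' \<beta>' \<subseteq> sector (\<alpha> n) (\<beta> n)"
    using le unfolding sector_def by fastforce
  also have "\<dots> \<subseteq> cs n"
    using seq_bounds(6)[OF n1] closure_subset by (simp add: closed_sector_def)
  finally show ?thesis
    using that n1 by blast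
qed

text \<open>The operators are uniformly bounded near 0 on a smaller sector, so convergence is needed
  only on a dense set. On the image of \<open>T \<delta>\<close> the product with
  \<open>T \<zeta>\<close> is \<open>T (\<delta> + \<zeta>)\<close>, and continuity in norm at the
  interior point \<open>\<delta>\<close> suffices.\<close>

lemma actB_T_tendsto:
  assumes "a < \<alpha>'" "\<beta>' < b" "v \<in> carrier B"
  shows "((\<lambda>\<zeta>. nrm B (actB (T \<zeta>) v \<ominus>\<^bsub>B\<^esub> v)) \<longlongrightarrow> 0) (at 0 within sector \<alpha>' \<beta>')"
proof (rule tendstoI)
  let ?F = "at (0 :: complex) within sector \<alpha>' \<beta>'"
  fix \<epsilon> :: real assume \<epsilon>: "0 < \<epsilon>"
  obtain n where n: "1 \<le> n" "sector \<alpha>' \<beta>' \<subseteq> cs n"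
    using sector_subset_cs[OF assms(1,2)] .
  have in_sector: "\<zeta> \<in> sector a b" if "\<zeta> \<in> sector \<alpha>' \<beta>'" for \<zeta>
    using n(2) cs_subset[OF n(1)] that zero_notin_sector by blast
  \<comment> \<open>Replacing v by an approximant costs \<eta> directly and at most
    exp(\<open>\<mu> n\<close>) \<eta> after applying the operator; together this is \<epsilon> /
    2.\<close>
  define \<eta> where "\<eta> = \<epsilon> / 2 / (exp (\<mu> n) + 1)"
  have pos: "0 < exp (\<mu> n) + 1"
    by (simp add: add_pos_pos)
  then have "0 < \<eta>"
    using \<epsilon> by (simp add: \<eta>_def)
  moreover have "(exp (\<mu> n) + 1) * \<eta> = \<epsilon> / 2"
    using pos unfolding \<eta>_def by (subst times_divide_eq_right, subst nonzero_mult_div_cancel_left) auto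
  ultimately have \<eta>: "0 < \<eta>" "exp (\<mu> n) * \<eta> + \<eta> = \<epsilon> / 2"
    by (simp_all add: distrib_right)
  obtain s where s: "range s \<subseteq> j ` T \<delta> ` carrier A" "converges_to B s v"
    using j_dense_image[OF T_dense[OF \<delta>_in_sector]] assms(3) unfolding N1.C.dense_in_iff by blast
  have "\<forall>\<^sub>F k in sequentially. nrm B (s k \<ominus>\<^bsub>B\<^esub> v) < \<eta>"
    by (rule order_tendstoD(2)[OF converges_toD(3)[OF s(2)] \<eta>(1)])
  then obtain k where k: "nrm B (s k \<ominus>\<^bsub>B\<^esub> v) < \<eta>"
    by (auto simp: eventually_sequentially)
  have "s k \<in> j ` T \<delta> ` carrier A"
    by (rule range_subsetD[OF s(1)])
  then obtain u where u: "u \<in> carrier A" "s k = j (T \<delta> u)"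
    by blast
  let ?v = "j (T \<delta> u)"
  note T\<delta> = T_multiplier[OF \<delta>_in_sector]
  note Tu = multipliersD(1)[OF T\<delta> u(1)]
  note v' = j_closed[OF Tu]
  let ?D = "\<lambda>\<zeta>. nrm (mult_alg A) (T (\<delta> + \<zeta>) \<ominus>\<^bsub>mult_alg A\<^esub> T \<delta>)"
  have F_in: "\<forall>\<^sub>F \<zeta> in ?F. \<zeta> \<in> sector \<alpha>' \<beta>'"
    by (simp add: eventually_at_filter)
  \<comment> \<open>The target filter is punctured at \<open>\<delta>\<close>; this is harmless
    because 0 is not in the sector.\<close>
  have "filterlim (\<lambda>\<zeta>. \<delta> + \<zeta>) (at \<delta> within sector a b) ?F"
    unfolding filterlim_at
  proof
    show "\<forall>\<^sub>F \<zeta> in ?F. \<delta> + \<zeta> \<in> sector a b \<and> \<delta> + \<zeta> \<noteq> \<delta>"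
      using F_in
    proof eventually_elim
      case (elim \<zeta>)
      then show ?case
        using sector_plus[OF \<delta>_in_sector in_sector[OF elim]] zero_notin_sector by auto
    qed
    have "((\<lambda>\<zeta>. \<delta> + \<zeta>) \<longlongrightarrow> \<delta> + 0) ?F"
      by (intro tendsto_intros)
    then show "((\<lambda>\<zeta>. \<delta> + \<zeta>) \<longlongrightarrow> \<delta>) ?F"
      by simp
  qed
  then have "(?D \<longlongrightarrow> 0) ?F"
    by (rule filterlim_compose[OF T_diff_tendsto[OF \<delta>_in_sector]])
  then have "((\<lambda>\<zeta>. ?D \<zeta> * nrm A u) \<longlongrightarrow> 0 * nrm A u) ?F"
    by (intro tendsto_intros)
  then have D: "\<forall>\<^sub>F \<zeta> in ?F. ?D \<zeta> * nrm A u < \<epsilon> / 2"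
    using \<epsilon> by (intro order_tendstoD(2)) auto
  have "\<forall>\<^sub>F \<zeta> in ?F. cmod \<zeta> < 1"
  proof -
    have "((\<lambda>\<zeta>. cmod \<zeta>) \<longlongrightarrow> cmod 0) ?F"
      by (intro tendsto_intros)
    then show ?thesis
      by (rule order_tendstoD(2)) simp
  qed
  with F_in D show "\<forall>\<^sub>F \<zeta> in ?F. dist (nrm B (actB (T \<zeta>) v \<ominus>\<^bsub>B\<^esub> v)) 0 < \<epsilon>"
  proof eventually_elim
    case (elim \<zeta>)
    note \<zeta> = in_sector[OF elim(1)]
    note T = T_multiplier[OF \<zeta>]
    note R = actB_multiplier(1)[OF T]
    note Rv = multipliersD(1)[OF R assms(3)] and Rv' = multipliersD(1)[OF R v']
    have \<zeta>n: "\<zeta> \<in> cs n"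
      using n(2) elim(1) by blast
    have "re \<zeta> \<le> cmod (\<zeta> * cis (- (a + b) / 2))"
      by (rule complex_Re_le_cmod)
    also have "\<dots> \<le> 1"
      using elim(3) by (simp add: norm_mult)
    finally have "\<mu> n * re \<zeta> \<le> \<mu> n * 1"
      using mu_pos[of n] by (intro mult_left_mono) auto
    then have exp_le: "exp (\<mu> n * re \<zeta>) \<le> exp (\<mu> n)"
      by simp
    have "nrm (mult_alg B) (actB (T \<zeta>)) \<le> exp (\<mu> n * re \<zeta>)"
      using order_trans[OF actB_multiplier(2)[OF T'_multiplier] act1_bound[OF n(1) \<zeta>n]] \<zeta>
      unfolding T'_sector[OF \<zeta>] by blast
    then have norm_T: "nrm (mult_alg B) (actB (T \<zeta>)) \<le> exp (\<mu> n)"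
      using exp_le by (rule order_trans)
    have k': "nrm B (v \<ominus>\<^bsub>B\<^esub> ?v) < \<eta>"
      using k N1.C.nrm_diff_commute[OF assms(3) v'] unfolding u(2) by simp
    have "nrm B (actB (T \<zeta>) v \<ominus>\<^bsub>B\<^esub> actB (T \<zeta>) ?v) = nrm B (actB (T \<zeta>) (v \<ominus>\<^bsub>B\<^esub> ?v))"
      unfolding N1.C.multiplier_diff[OF R assms(3) v'] ..
    also have "\<dots> \<le> nrm (mult_alg B) (actB (T \<zeta>)) * nrm B (v \<ominus>\<^bsub>B\<^esub> ?v)"
      by (rule N1.C.nrm_multiplier[OF R N1.C.diff_closed[OF assms(3) v']])
    also have "\<dots> \<le> exp (\<mu> n) * \<eta>"
      using norm_T k' N1.C.nrm_nonneg[OF N1.C.diff_closed[OF assms(3) v']] by (intro mult_mono) auto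
    finally have 1: "nrm B (actB (T \<zeta>) v \<ominus>\<^bsub>B\<^esub> actB (T \<zeta>) ?v) \<le> exp (\<mu> n) * \<eta>" .
    have \<delta>\<zeta>: "\<delta> + \<zeta> \<in> sector a b"
      by (rule sector_plus[OF \<delta>_in_sector \<zeta>])
    note T\<delta>\<zeta> = T_multiplier[OF \<delta>\<zeta>]
    note Tu' = multipliersD(1)[OF T\<delta>\<zeta> u(1)]
    have "actB (T \<zeta>) ?v = j (T (\<delta> + \<zeta>) u)"
      unfolding actB_multiplier(4)[OF T Tu] using T_add_apply[OF \<zeta> \<delta>_in_sector u(1)] by (simp add: add.commute)
    then have "nrm B (actB (T \<zeta>) ?v \<ominus>\<^bsub>B\<^esub> ?v) = nrm B (j (T (\<delta> + \<zeta>) u \<ominus> T \<delta> u))"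
      using bounded_linear_map_diff[OF normed N1.C.normed j_bounded Tu' Tu] by simp
    also have "\<dots> \<le> nrm A ((T (\<delta> + \<zeta>) \<ominus>\<^bsub>mult_alg A\<^esub> T \<delta>) u)"
      using bounded_linear_mapD(4)[OF j_bounded diff_closed[OF Tu' Tu]] mult_alg_diff[OF T\<delta>\<zeta> T\<delta> u(1)] by simp
    also have "\<dots> \<le> ?D \<zeta> * nrm A u"
      using MA.diff_closed[of "T (\<delta> + \<zeta>)" "T \<delta>"] T\<delta>\<zeta> T\<delta> by (intro nrm_multiplier u(1)) simp
    finally have 2: "nrm B (actB (T \<zeta>) ?v \<ominus>\<^bsub>B\<^esub> ?v) < \<epsilon> / 2"
      using elim(2) by simp
    have "nrm B (actB (T \<zeta>) v \<ominus>\<^bsub>B\<^esub> v) \<le>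
        nrm B (actB (T \<zeta>) v \<ominus>\<^bsub>B\<^esub> actB (T \<zeta>) ?v) + nrm B (actB (T \<zeta>) ?v \<ominus>\<^bsub>B\<^esub> v)"
      by (rule N1.C.nrm_diff_triangle[OF Rv Rv' assms(3)])
    also have "nrm B (actB (T \<zeta>) ?v \<ominus>\<^bsub>B\<^esub> v) \<le>
        nrm B (actB (T \<zeta>) ?v \<ominus>\<^bsub>B\<^esub> ?v) + nrm B (?v \<ominus>\<^bsub>B\<^esub> v)"
      by (rule N1.C.nrm_diff_triangle[OF Rv' v' assms(3)])
    finally have "nrm B (actB (T \<zeta>) v \<ominus>\<^bsub>B\<^esub> v) < \<epsilon>"
      using 1 2 k \<eta>(2) unfolding u(2) by linarith
    then show ?case
      using N1.C.nrm_nonneg[OF N1.C.diff_closed[OF Rv assms(3)]] by simp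
  qed
qed

text \<open>\<open>B\<close> carries the operator norm of \<open>mult_alg L\<close>, so the larger
  quantity is the norm of an element of \<open>B\<close>, while the smaller is the norm of
  multiplication by that element.\<close>

lemma Limsup_actB_T:
  assumes "a < \<alpha>'" "\<alpha>' < \<beta>'" "\<beta>' < b" "v \<in> carrier B"
  shows "Limsup (at 0 within sector \<alpha>' \<beta>')
      (\<lambda>\<zeta>. ereal (nrm (mult_alg B) (mult_op B (actB (T \<zeta>) v \<ominus>\<^bsub>B\<^esub> v))))
    \<le> Limsup (at 0 within sector \<alpha>' \<beta>') (\<lambda>\<zeta>. ereal (nrm (mult_alg L) (actB (T \<zeta>) v \<ominus>\<^bsub>B\<^esub> v)))"
    and "Limsup (at 0 within sector \<alpha>' \<beta>') (\<lambda>\<zeta>. ereal (nrm (mult_alg L) (actB (T \<zeta>) v \<ominus>\<^bsub>B\<^esub> v))) = 0"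
proof -
  let ?F = "at (0 :: complex) within sector \<alpha>' \<beta>'"
  obtain n where n: "1 \<le> n" "sector \<alpha>' \<beta>' \<subseteq> cs n"
    using sector_subset_cs[OF assms(1,3)] .
  have F_in: "\<forall>\<^sub>F \<zeta> in ?F. \<zeta> \<in> sector \<alpha>' \<beta>'"
    by (simp add: eventually_at_filter)
  have "\<forall>\<^sub>F \<zeta> in ?F. ereal (nrm (mult_alg B) (mult_op B (actB (T \<zeta>) v \<ominus>\<^bsub>B\<^esub> v)))
      \<le> ereal (nrm (mult_alg L) (actB (T \<zeta>) v \<ominus>\<^bsub>B\<^esub> v))"
    using F_in
  proof eventually_elim
    case (elim \<zeta>)
    then have "\<zeta> \<in> sector a b"
      using n(2) cs_subset[OF n(1)] zero_notin_sector by blast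
    then have "actB (T \<zeta>) v \<ominus>\<^bsub>B\<^esub> v \<in> carrier B"
      by (intro N1.C.diff_closed multipliersD(1)[OF actB_multiplier(1)[OF T_multiplier]] assms(4))
    then have "nrm (mult_alg B) (mult_op B (actB (T \<zeta>) v \<ominus>\<^bsub>B\<^esub> v)) \<le> nrm B (actB (T \<zeta>) v \<ominus>\<^bsub>B\<^esub> v)"
      by (rule N1.C.mult_op_multiplier(2))
    then show ?case
      unfolding N1.C_sel by simp
  qed
  then show "Limsup ?F (\<lambda>\<zeta>. ereal (nrm (mult_alg B) (mult_op B (actB (T \<zeta>) v \<ominus>\<^bsub>B\<^esub> v))))
    \<le> Limsup ?F (\<lambda>\<zeta>. ereal (nrm (mult_alg L) (actB (T \<zeta>) v \<ominus>\<^bsub>B\<^esub> v)))"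
    by (rule Limsup_mono)
  have "((\<lambda>\<zeta>. ereal (nrm (mult_alg L) (actB (T \<zeta>) v \<ominus>\<^bsub>B\<^esub> v))) \<longlongrightarrow> ereal 0) ?F"
    using actB_T_tendsto[OF assms(1,3,4)] unfolding N1.C_sel by (rule tendsto_ereal)
  then show "Limsup ?F (\<lambda>\<zeta>. ereal (nrm (mult_alg L) (actB (T \<zeta>) v \<ominus>\<^bsub>B\<^esub> v))) = 0"
    unfolding zero_ereal_def by (rule lim_imp_Limsup[OF islimpt_zero_sector[OF assms(2)]])
qed


section \<open>The parts of the statement\<close>

lemma jt_inverse_formula:
  assumes "\<zeta> \<in> sector a b" "w \<in> Omega A" "u \<in> carrier B" "v \<in> Omega B"
  shows "let e = j (T \<zeta> (w \<otimes>\<^bsub>A\<^esub> w));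
      p = inv_into (carrier A) j (e \<otimes>\<^bsub>B\<^esub> u);
      q = inv_into (carrier A) j (e \<otimes>\<^bsub>B\<^esub> v)
    in q \<in> Omega A \<and>
      inv_into (carrier (qm_alg A)) (qm_extension A B j) (quasi B u v) = quasi A p q"
proof -
  obtain M where "qm_embedding A B j (T \<zeta> (w \<otimes>\<^bsub>A\<^esub> w)) M"
    using qm_embedding_j[OF assms(1,2)] ..
  then interpret Q: qm_embedding A B j "T \<zeta> (w \<otimes>\<^bsub>A\<^esub> w)" M .
  show ?thesis
    unfolding Let_def Q.retract_def[symmetric]
    using Q.retract_Omega[OF assms(4)] Q.inv_jt_quasi[OF assms(3,4)] by blast
qed

text \<open>\<open>qm_extension\<close> mentions neither \<zeta> nor w. One element of
  \<open>Omega A\<close> together with the direction \<open>\<delta>\<close> therefore establishes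
  its properties, and the inverse formulas for all other choices concern the same map.\<close>

lemma jt_properties:
  assumes "Omega A \<noteq> {}"
  shows "\<lbrakk>u \<in> carrier A; v \<in> Omega A\<rbrakk>
      \<Longrightarrow> j v \<in> Omega B \<and> qm_extension A B j (quasi A u v) = quasi B (j u) (j v)"
    and "pseudobounded_iso A B (qm_extension A B j)"
    and "r \<in> multipliers A
      \<Longrightarrow> qm_extension A B j (quasi_of_mult A r) = quasi_of_mult B (actB r)"
proof -
  obtain w where "w \<in> Omega A"
    using assms by blast
  then obtain M where "qm_embedding A B j (T \<delta> (w \<otimes>\<^bsub>A\<^esub> w)) M"
    using qm_embedding_j[OF \<delta>_in_sector] by blast
  then interpret Q: qm_embedding A B j "T \<delta> (w \<otimes>\<^bsub>A\<^esub> w)" M .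
  show "j v \<in> Omega B \<and> qm_extension A B j (quasi A u v) = quasi B (j u) (j v)"
    if "u \<in> carrier A" "v \<in> Omega A"
    using Q.j_Omega[OF that(2)] Q.jt_quasi[OF that] ..
  show "pseudobounded_iso A B (qm_extension A B j)"
    by (rule Q.pseudobounded_iso_jt)
  show "qm_extension A B j (quasi_of_mult A r) = quasi_of_mult B (actB r)" if "r \<in> multipliers A"
    by (rule Q.jt_quasi_of_mult[OF that actB_multiplier(1)[OF that] actB_multiplier(4)[OF that]])
qed

lemma qm_homomorphism_incl:
  assumes "\<zeta> \<in> sector a b" "w \<in> Omega A"
  shows "qm_homomorphism A B j (T \<zeta> (w \<otimes>\<^bsub>A\<^esub> w))"
proof -
  obtain M where "qm_embedding A B j (T \<zeta> (w \<otimes>\<^bsub>A\<^esub> w)) M"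
    using qm_embedding_j[OF assms] ..
  then show ?thesis
    by (rule qm_embedding.qm_homomorphism_j)
qed

lemma act1_T'_bounds:
  assumes "1 \<le> n" "\<zeta> \<in> cs n"
  shows "act1 (T' \<zeta>) \<in> multipliers L"
    "nrm (mult_alg B) (actB (T' \<zeta>)) \<le> nrm (mult_alg L) (act1 (T' \<zeta>))"
    "nrm (mult_alg L) (act1 (T' \<zeta>)) \<le> exp (\<mu> n * re \<zeta>)"
proof -
  have "T' \<zeta> \<in> multipliers A"
    using T'_multiplier cs_subset[OF assms(1)] assms(2) by blast
  then show "act1 (T' \<zeta>) \<in> multipliers L"
    "nrm (mult_alg B) (actB (T' \<zeta>)) \<le> nrm (mult_alg L) (act1 (T' \<zeta>))"
    by (fact act1_multiplier, fact actB_multiplier(2))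
qed (rule act1_bound[OF assms])

lemma W_mult_closed: "\<lbrakk>w \<in> W; w' \<in> W\<rbrakk> \<Longrightarrow> w \<otimes>\<^bsub>mult_alg A\<^esub> w' \<in> W"
  unfolding mult_alg_sel by (rule W_mult)

lemma act0_T_in_L: "\<lbrakk>\<zeta> \<in> sector a b; u \<in> carrier A0\<rbrakk> \<Longrightarrow> act0 (T \<zeta>) \<otimes>\<^bsub>A0\<^esub> u \<in> carrier L"
  using T_in_L w1_apply by simp

end

theorem proposition4p2:
  fixes A :: "'a normed_alg" and T :: "complex \<Rightarrow> 'a \<Rightarrow> 'a"
    and a b :: real and \<mu> :: "nat \<Rightarrow> real"
  defines "\<alpha> \<equiv> alpha_seq a b" and "\<beta> \<equiv> beta_seq a b"
    and "MA \<equiv> mult_alg A"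
    and "L0 \<equiv> L_T0 A a b T \<mu>"
    and "A0 \<equiv> A_T0 A a b T \<mu>"
    and "L \<equiv> L_mu A a b T \<mu>"
    and "B \<equiv> A_mu A a b T \<mu>"
    and "W \<equiv> W_set A a b T \<mu>"
    and "j \<equiv> incl_A_mu A a b T \<mu>"
    and "actL0 \<equiv> act_L_T0 A a b T \<mu>"
    and "actL \<equiv> act_L_mu A a b T \<mu>"
    and "actB \<equiv> act_A_mu A a b T \<mu>"
    and "T' \<equiv> semigroup0 A T"
  assumes "a < b" and "b \<le> a + pi"
    and "weakly_cancellative A" and "dense_principal_ideals A"
    and "holomorphic_semigroup A a b T"
    and "\<forall>\<zeta>\<in>sector a b. dense_in A (T \<zeta> ` carrier A)"
    and "mono \<mu>" and "\<forall>n. 0 < \<mu> n"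
    and "\<forall>n. ereal (\<mu> n) > ereal (1 / cos ((\<beta> n - \<alpha> n) / 2)) *
           Lim at_top (\<lambda>r. ereal (ln (max (nrm MA (T (rcis r (\<alpha> n)))) (nrm MA (T (rcis r (\<beta> n))))) / r))"
    and "\<forall>n\<ge>1. (SUP \<zeta>\<in>closed_sector (\<alpha> n) (\<beta> n).
             ereal (nrm (mult_alg L0)
               (actL0 (exp (- of_real (\<mu> n) * \<zeta> * cis (- (a + b) / 2))
                  \<odot>\<^bsub>MA\<^esub> T (\<zeta> + of_real ((1 / 2) ^ n) * cis ((a + b) / 2))))))
           \<le> ereal (exp ((1 / 2) ^ n * (\<mu> 0 + 1)))"
  shows
    "(\<forall>w\<in>W. \<forall>w'\<in>W. w \<otimes>\<^bsub>MA\<^esub> w' \<in> W) \<and>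
     (\<forall>\<zeta>\<in>sector a b. \<forall>u\<in>carrier A0. actL0 (T \<zeta>) \<otimes>\<^bsub>A0\<^esub> u \<in> carrier L) \<and>
     banach_algebra L \<and>
     (\<forall>\<zeta>\<in>sector a b. \<forall>w\<in>Omega A. qm_homomorphism A B j (T \<zeta> (w \<otimes>\<^bsub>A\<^esub> w))) \<and>
     (\<exists>jt.
        \<comment> \<open>(i)\<close>
        (\<forall>u\<in>carrier A. \<forall>v\<in>Omega A. j v \<in> Omega B \<and> jt (quasi A u v) = quasi B (j u) (j v)) \<and>
        pseudobounded_iso A B jt \<and>
        (\<forall>\<zeta>\<in>sector a b. \<forall>w\<in>Omega A. \<forall>u\<in>carrier B. \<forall>v\<in>Omega B.
           let e = j (T \<zeta> (w \<otimes>\<^bsub>A\<^esub> w));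
               p = inv_into (carrier A) j (e \<otimes>\<^bsub>B\<^esub> u);
               q = inv_into (carrier A) j (e \<otimes>\<^bsub>B\<^esub> v)
           in q \<in> Omega A \<and> inv_into (carrier (qm_alg A)) jt (quasi B u v) = quasi A p q) \<and>
        \<comment> \<open>(ii)\<close>
        (\<forall>R\<in>carrier MA.
           actB R \<in> carrier (mult_alg B) \<and>
           jt (quasi_of_mult A R) = quasi_of_mult B (actB R) \<and>
           nrm (mult_alg B) (actB R) \<le> nrm MA R)) \<and>
     \<comment> \<open>(iii)\<close>
     (\<forall>n\<ge>1. \<forall>\<zeta>\<in>closed_sector (\<alpha> n) (\<beta> n).
        actL (T' \<zeta>) \<in> carrier (mult_alg L) \<and>
        nrm (mult_alg B) (actB (T' \<zeta>)) \<le> nrm (mult_alg L) (actL (T' \<zeta>)) \<and>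
        nrm (mult_alg L) (actL (T' \<zeta>)) \<le> exp (\<mu> n * Re (\<zeta> * cis (- (a + b) / 2)))) \<and>
     \<comment> \<open>(iv)\<close>
     (\<forall>\<alpha>' \<beta>'. a < \<alpha>' \<and> \<alpha>' < \<beta>' \<and> \<beta>' < b \<longrightarrow> (\<forall>v\<in>carrier B.
        Limsup (at 0 within sector \<alpha>' \<beta>')
            (\<lambda>\<zeta>. ereal (nrm (mult_alg B) (mult_op B (actB (T \<zeta>) v \<ominus>\<^bsub>B\<^esub> v))))
          \<le> Limsup (at 0 within sector \<alpha>' \<beta>')
              (\<lambda>\<zeta>. ereal (nrm (mult_alg L) (actB (T \<zeta>) v \<ominus>\<^bsub>B\<^esub> v))) \<and>
        Limsup (at 0 within sector \<alpha>' \<beta>')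
            (\<lambda>\<zeta>. ereal (nrm (mult_alg L) (actB (T \<zeta>) v \<ominus>\<^bsub>B\<^esub> v))) = 0))"
proof -
  have semigroup: "holomorphic_multiplier_semigroup A a b T"
    by (rule holomorphic_multiplier_semigroup.intro[OF wc_algebraI[OF assms(16)]],
        rule holomorphic_multiplier_semigroup_axioms.intro)
      (use assms(14,15,18,19) in blast)+
  interpret N: normalized_semigroup A a b T \<mu>
  proof (rule normalized_semigroup.intro[OF semigroup], rule normalized_semigroup_axioms.intro)
    show "0 < \<mu> n" for n
      using assms(21) by blast
    show "ereal (1 / cos ((beta_seq a b n - alpha_seq a b n) / 2)) *
        Lim at_top (\<lambda>r. ereal (ln (max (nrm (mult_alg A) (T (rcis r (alpha_seq a b n))))
          (nrm (mult_alg A) (T (rcis r (beta_seq a b n))))) / r)) < ereal (\<mu> n)" for n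
      using spec[OF assms(22), of n] unfolding \<alpha>_def \<beta>_def MA_def .
    fix n :: nat and \<zeta> assume n: "1 \<le> n"
      and \<zeta>: "\<zeta> \<in> closed_sector (alpha_seq a b n) (beta_seq a b n)"
    show "nrm (mult_alg (L_T0 A a b T \<mu>)) (act_L_T0 A a b T \<mu>
        (exp (- of_real (\<mu> n) * \<zeta> * cis (- (a + b) / 2)) \<odot>\<^bsub>mult_alg A\<^esub>
          T (\<zeta> + of_real ((1 / 2) ^ n) * cis ((a + b) / 2))))
      \<le> exp ((1 / 2) ^ n * (\<mu> 0 + 1))"
      \<comment> \<open>The supremum in the hypothesis is taken in the extended reals, so each
        member lies below it without a boundedness condition.\<close>
      using order_trans[OF SUP_upper[OF \<zeta>] mp[OF spec[OF assms(23)] n, unfolded \<alpha>_def \<beta>_def]]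
      unfolding MA_def L0_def actL0_def by (simp only: ereal_less_eq(3))
  qed
  have Omega: "Omega A \<noteq> {}"
    using assms(17) by (simp add: dense_principal_ideals_def)
  show ?thesis
    unfolding \<alpha>_def \<beta>_def MA_def L0_def A0_def L_def B_def W_def j_def actL0_def actL_def
      actB_def T'_def
  proof (intro conjI, goal_cases)
    case 1
    show ?case
      by (intro ballI N.W_mult_closed)
  next
    case 2
    show ?case
      by (intro ballI N.act0_T_in_L)
  next
    case 3
    show ?case
      by (rule N.N1.banach_algebra_L)
  next
    case 4
    show ?case
      by (intro ballI N.qm_homomorphism_incl)
  next
    case 5
    show ?case
      unfolding mult_alg_sel
      by (rule exI[of _ "qm_extension A (A_mu A a b T \<mu>) (incl_A_mu A a b T \<mu>)"],
          intro conjI ballI N.jt_properties[OF Omega] N.jt_inverse_formula N.actB_multiplier(1,3))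
        (simp_all add: N.jt_properties(1)[OF Omega])
  next
    case 6
    show ?case
      unfolding mult_alg_sel by (intro allI impI ballI conjI N.act1_T'_bounds)
  next
    case 7
    show ?case
      by (intro allI impI ballI conjI N.Limsup_actB_T) auto
  qed
qed

end
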